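(* Let $b\geq 2$ be an integer, and let $$Q_b^*(x):=\#\{n\in\mathscr{P}_b^*(x): n\ \text{is square-free}\}.$$ Then for any $A>0$ and all $x\ge 2$, $$Q_b^*(x)=\frac{\#\mathscr{P}_b^*(x)}{\zeta(2)}\prod_{p\mid b^3-b}\left(1-\frac{1}{p^2}\right)^{-1}\left(1+O_{b,A}\left(\frac{1}{(\log x)^A}\right)\right),$$ where $\zeta(\cdot)$ is the Riemann zeta function, the product is over primes $p$ dividing $b^3-b$, and the implied constant depends only on $b$ and $A$.
   Context: Fix an integer base $b\ge 2$. A positive integer $n$ with base-$b$ expansion $n=\sum_{0\le i<N} n_i b^i$, $0\le n_i<b$, $n_{N-1}\neq 0$ and $n_0\neq 0$, has digital reverse $\overleftarrow{n}=\sum_{0\le i<N} n_i b^{N-1-i}$. The set of base-$b$ palindromes is $\mathscr{P}_b=\{n\geq 0: b\nmid n\text{ and } n=\overleftarrow{n}\}$, and $\mathscr{P}_b(x)=\{n\in\mathscr{P}_b: n\le x\}$. The restricted set is $\mathscr{P}_b^*(x)=\{n\in\mathscr{P}_b(x): \gcd(n,b^3-b)=1\}$. A square-free number is a positive integer with no repeated prime factors. *)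

theory Defs
  imports
    "HOL-Analysis.Analysis"
    "HOL-Library.Log_Nat"
    "HOL-Computational_Algebra.Computational_Algebra"
begin

definition digit :: "nat \<Rightarrow> nat \<Rightarrow> nat \<Rightarrow> nat" where
  "digit b n i = n div b ^ i mod b"

text \<open>
  For \<open>b \<ge> 2\<close> and \<open>n \<ge> 1\<close>, \<open>floorlog b n\<close> is the number \<open>N\<close> of base-\<open>b\<close> digits of \<open>n\<close>,
  so \<open>b ^ (N - 1) \<le> n < b ^ N\<close> and \<open>digit b n (N - 1) \<noteq> 0\<close>.
\<close>
definition digit_reverse :: "nat \<Rightarrow> nat \<Rightarrow> nat" where
  "digit_reverse b n =
     (\<Sum>i<floorlog b n. digit b n i * b ^ (floorlog b n - 1 - i))"

definition palindromes :: "nat \<Rightarrow> nat set" where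
  "palindromes b = {n. \<not> b dvd n \<and> n = digit_reverse b n}"

definition palindromes_upto :: "nat \<Rightarrow> real \<Rightarrow> nat set" where
  "palindromes_upto b x = {n \<in> palindromes b. real n \<le> x}"

text \<open>For \<open>b \<ge> 1\<close> the subtraction \<open>b ^ 3 - b\<close> on \<open>nat\<close> does not truncate.\<close>
definition restricted_palindromes_upto :: "nat \<Rightarrow> real \<Rightarrow> nat set" where
  "restricted_palindromes_upto b x = {n \<in> palindromes_upto b x. gcd n (b ^ 3 - b) = 1}"

definition squarefree_count :: "nat \<Rightarrow> real \<Rightarrow> nat" where
  "squarefree_count b x = card {n \<in> restricted_palindromes_upto b x. squarefree n}"

text \<open>
  The Riemann zeta function on the half-line \<open>s > 1\<close>, where it is given by its Dirichlet series
  (the index is shifted so that the sum starts at 1). No meaning is intended for \<open>s \<le> 1\<close>.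
\<close>
definition zeta :: "real \<Rightarrow> real" where
  "zeta s = (\<Sum>n. 1 / real (Suc n) powr s)"

end

theory Submission
  imports Defs "HOL-Number_Theory.Cong" "HOL-Real_Asymp.Real_Asymp"
begin

text \<open>
  Write \<open>m = b^3 - b\<close>. A palindrome with an even number of digits is a multiple of \<open>b + 1\<close>, so the
  restricted palindromes have odd length \<open>2 k + 1\<close>. Choose \<open>K\<close> with \<open>b^(2K) \<le> x < b^(2K + 2)\<close>; the
  number \<open>N\<close> of restricted palindromes up to \<open>x\<close> then has order of magnitude \<open>b^K\<close>, and \<open>K\<close> that
  of \<open>ln x\<close>. Sieving by squares,
  the number of squarefree ones is the sum of \<open>\<mu>(d) S(d^2)\<close> over \<open>d\<close> coprime to \<open>m\<close>, where \<open>S(q)\<close>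
  counts the restricted palindromes divisible by \<open>q\<close>. If \<open>S(d^2)\<close> could be replaced by \<open>N / d^2\<close>,
  the result would be \<open>N\<close> divided by the sum of \<open>1 / n^2\<close> over \<open>n\<close> coprime to \<open>m\<close>, which is the
  asserted main term (\<open>coprime_zeta_eq\<close>, \<open>moebius_partial_sum\<close>). The error must be smaller than
  \<open>b^K\<close> by an arbitrary power of \<open>K\<close>. The integers \<open>d\<close> fall into three ranges.

  Small \<open>d\<close>, up to a power of \<open>K\<close>. Exponential sums over palindromes factor over the digits, with
  factors that are geometric sums at \<open>\<zeta>^(b^i + b^(2k - i))\<close>. Two consecutive factors can both be close
  to their trivial bound only if \<open>\<zeta>^(b^i (b^2 - 1))\<close> is close to 1. At a frequency whose
  denominator involves a factor of \<open>q = d^2\<close>, multiplication by \<open>b\<close> drives this number away from 1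
  within \<open>O(log q)\<close> steps, so a constant factor is gained every \<open>O(log q)\<close> digits. The resulting
  bound is the lemma \<open>equidistribution_mod\<close>.

  Medium \<open>d\<close>. Fixing all digits but about \<open>log d^2\<close> central ones shows that at most about \<open>b^k / d\<close>
  palindromes of length \<open>2 k + 1\<close> are divisible by \<open>d^2\<close>. A range of \<open>d\<close> between \<open>D\<close> and a bounded
  power of \<open>D\<close> thus contributes \<open>b^k\<close> up to logarithms: any power saving on
  average over \<open>d\<close> suffices. To get one, fix the outer digits and write the inner part as
  \<open>z + b^s y + b^(s + L) rev(z)\<close> with \<open>z < b^s\<close> and \<open>y < b^L\<close>, where \<open>b^L\<close> is a little smaller than
  \<open>d^2\<close>. Divisibility by \<open>d^2\<close> forces \<open>\<rho> z / b^s - b^L rev(z) / d^2\<close>, with \<open>\<rho>\<close> the inverse of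
  \<open>d^2\<close> modulo \<open>b^s\<close>, into an arc of length about \<open>b^L / d^2\<close> modulo 1. While \<open>d\<close> runs through
  \<open>b^s\<close> consecutive integers the coefficient of \<open>rev(z)\<close> hardly changes, and \<open>\<rho>\<close> takes each value
  \<open>O_b(1)\<close> times, because a unit modulo \<open>b^s\<close> has boundedly many square roots. Parseval's identity in
  \<open>\<rho>\<close> therefore shows square root cancellation on average, and only the expected proportion of the
  \<open>z\<close> survives (\<open>sum_window_le\<close>, \<open>middle_range_le\<close>).

  Large \<open>d\<close>, with \<open>d \<ge> b^(9k/10)\<close>. The cofactor \<open>e = n / d^2\<close> takes few values. For fixed \<open>e\<close>, the
  outer half of the digits of \<open>n\<close> confines \<open>d\<close> to a short interval and \<open>d^2\<close> to a residue class
  modulo the same power of \<open>b\<close>; this leaves boundedly many \<open>d\<close> (\<open>large_range_le\<close>).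
\<close>

section \<open>Digit reversal and palindromes of odd length\<close>

text \<open>
  Reversal of \<open>z\<close> read as a string of exactly \<open>s\<close> digits, leading zeros included; outer digits can
  then be peeled off without keeping track of the length.
\<close>
primrec rev_digits :: "nat \<Rightarrow> nat \<Rightarrow> nat \<Rightarrow> nat" where
  "rev_digits b 0 z = 0"
| "rev_digits b (Suc s) z = (z mod b) * b ^ s + rev_digits b s (z div b)"

text \<open>
  Palindromic digit strings of length \<open>2 k + 1\<close>. Leading zeros are admitted: only in this way is every
  inner part of a palindrome again of this form.
\<close>
primrec pal :: "nat \<Rightarrow> nat \<Rightarrow> nat set" where
  "pal b 0 = {..<b}"
| "pal b (Suc k) = (\<lambda>(a, p). a * (1 + b ^ (2 * k + 2)) + b * p) ` ({..<b} \<times> pal b k)"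

lemma rev_digits_eq_sum: "rev_digits b s n = (\<Sum>i<s. digit b n i * b ^ (s - 1 - i))"
proof (induction s arbitrary: n)
  case (Suc s)
  have "digit b n (Suc i) = digit b (n div b) i" for i
    by (simp add: digit_def div_mult2_eq)
  then show ?case
    by (simp add: Suc sum.lessThan_Suc_shift digit_def del: sum.lessThan_Suc)
qed simp

lemma add_mult_less:
  fixes a b p q :: nat
  assumes "a < b" "p < q"
  shows "a + b * p < b * q"
proof -
  have "a + b * p < b * (p + 1)" using assms by simp
  also have "\<dots> \<le> b * q" using assms by (intro mult_le_mono) auto
  finally show ?thesis .
qed

context
  fixes b :: nat
  assumes b2: "b \<ge> 2"
begin

lemma rev_digits_append:
  "p < b ^ s \<Longrightarrow> c < b \<Longrightarrow> rev_digits b (Suc s) (p + b ^ s * c) = b * rev_digits b s p + c"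
proof (induction s arbitrary: p)
  case (Suc s)
  have "p div b < b ^ s"
    using Suc.prems by (simp add: less_mult_imp_div_less mult.commute)
  have "(p + b ^ Suc s * c) div b = p div b + b ^ s * c"
    using b2 by (simp add: mult.assoc)
  moreover have "(p + b ^ Suc s * c) mod b = p mod b"
    by (simp add: mult.assoc)
  ultimately show ?case
    using Suc.IH[OF \<open>p div b < b ^ s\<close> \<open>c < b\<close>] by (simp add: algebra_simps)
qed simp

lemma rev_digits_less: "rev_digits b s z < b ^ s"
proof (induction s arbitrary: z)
  case (Suc s)
  show ?case using add_mult_less[OF Suc.IH[of "z div b"], of "z mod b" b] b2
    by (simp add: mult.commute add.commute)
qed simp

text \<open>
  Peeling off the first and the last digit. For odd lengths this identifies the strings \<open>pal b k\<close>
  with the fixed points of the reversal; for even lengths it gives the divisibility by \<open>b + 1\<close>.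
\<close>
lemma rev_digits_fixed_step:
  assumes "a < b" "c < b" "p < b ^ s"
  shows "rev_digits b (s + 2) (a + b * p + b ^ (s + 1) * c) = a + b * p + b ^ (s + 1) * c
           \<longleftrightarrow> a = c \<and> rev_digits b s p = p"
proof -
  have "(a + b * p + b ^ (s + 1) * c) mod b = a" using assms by (simp add: mult.assoc)
  moreover have "(a + b * p + b ^ (s + 1) * c) div b = p + b ^ s * c"
    using assms by (simp add: mult.assoc)
  ultimately have "rev_digits b (s + 2) (a + b * p + b ^ (s + 1) * c) = c + b * rev_digits b s p + b ^ (s+1) * a"
    using rev_digits_append[OF assms(3,2)] by (simp add: algebra_simps)
  moreover have "a = c \<and> rev_digits b s p = p"
    if e: "c + b * rev_digits b s p + b ^ (s+1) * a = a + b * p + b ^ (s + 1) * c"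
  proof -
    have "(c + b * rev_digits b s p + b ^ (s+1) * a) mod b = c"
      using assms by (simp add: mult.assoc)
    moreover have "(a + b * p + b ^ (s + 1) * c) mod b = a" using assms by (simp add: mult.assoc)
    ultimately have "a = c" using e by simp
    then show ?thesis using e b2 by simp
  qed
  ultimately show ?thesis by auto
qed

lemma pal_less: "n \<in> pal b k \<Longrightarrow> n < b ^ (2 * k + 1)"
proof (induction k arbitrary: n)
  case (Suc k)
  then obtain a p where ap: "a < b" "p \<in> pal b k" "n = a * (1 + b ^ (2 * k + 2)) + b * p" by auto
  have "a + b * p < b * b ^ (2 * k + 1)" using add_mult_less[OF ap(1) Suc.IH[OF ap(2)]] .
  from add_mult_less[OF this ap(1)] show ?case by (simp add: ap(3) algebra_simps)
qed simp

lemma ends_decomp: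
  assumes "n < b ^ (s + 2)"
  obtains a p c where "a < b" "c < b" "p < b ^ s" "n = a + b * p + b ^ (s + 1) * c"
proof
  show "n mod b < b" "n div b mod b ^ s < b ^ s" using b2 by auto
  show "n div b ^ (s + 1) < b"
    using assms by (simp add: less_mult_imp_div_less mult.commute mult.left_commute)
  have "n div b = n div b mod b ^ s + b ^ s * (n div b ^ (s + 1))"
    by (metis Suc_eq_plus1 add.commute div_mult2_eq mult_div_mod_eq power_Suc)
  moreover have "n = n mod b + b * (n div b)" by simp
  ultimately show "n = n mod b + b * (n div b mod b ^ s) + b ^ (s + 1) * (n div b ^ (s + 1))"
    by (metis (no_types, lifting) Suc_eq_plus1 add.assoc distrib_left mult.assoc power_Suc)
qed

lemma pal_iff: "n \<in> pal b k \<longleftrightarrow> n < b ^ (2 * k + 1) \<and> rev_digits b (2 * k + 1) n = n"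
proof (induction k arbitrary: n)
  case (Suc k)
  have e: "2 * Suc k + 1 = (2 * k + 1) + 2" by simp
  show ?case
  proof
    assume n: "n \<in> pal b (Suc k)"
    then obtain a p where ap: "a < b" "p \<in> pal b k" "n = a * (1 + b ^ (2 * k + 2)) + b * p" by auto
    then have "p < b ^ (2 * k + 1)" "rev_digits b (2 * k + 1) p = p" using Suc.IH by auto
    with rev_digits_fixed_step[OF ap(1) ap(1), of p "2 * k + 1"] ap(3)
    have "rev_digits b (2 * Suc k + 1) n = n" unfolding e by (simp add: algebra_simps del: rev_digits.simps)
    then show "n < b ^ (2 * Suc k + 1) \<and> rev_digits b (2 * Suc k + 1) n = n"
      using pal_less[OF n] by simp
  next
    assume n: "n < b ^ (2 * Suc k + 1) \<and> rev_digits b (2 * Suc k + 1) n = n"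
    then obtain a p c where *: "a < b" "c < b" "p < b ^ (2 * k + 1)"
       "n = a + b * p + b ^ (2 * k + 1 + 1) * c"
      using ends_decomp[of n "2 * k + 1"] unfolding e by blast
    with n rev_digits_fixed_step[OF *(1-3)] have "a = c" "rev_digits b (2 * k + 1) p = p"
      unfolding e by auto
    then have "p \<in> pal b k" using Suc.IH * by blast
    then show "n \<in> pal b (Suc k)" using * \<open>a = c\<close>
      by (auto intro!: image_eqI[of _ _ "(a, p)"] simp: algebra_simps)
  qed
qed auto

text \<open>
  Each pair of mirrored digits contributes \<open>b^i (1 + b^j)\<close> with \<open>j\<close> odd, and \<open>b \<equiv> -1\<close> modulo \<open>b + 1\<close>.
\<close>
lemma even_palindrome_dvd:
  "n < b ^ (2 * k) \<Longrightarrow> rev_digits b (2 * k) n = n \<Longrightarrow> b + 1 dvd n"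
proof (induction k arbitrary: n)
  case (Suc k)
  have e: "2 * Suc k = 2 * k + 2" by simp
  obtain a p c where *: "a < b" "c < b" "p < b ^ (2 * k)"
       "n = a + b * p + b ^ (2 * k + 1) * c"
    using ends_decomp[of n "2 * k"] Suc.prems unfolding e by blast
  with Suc.prems rev_digits_fixed_step[OF *(1-3)] have "a = c" "rev_digits b (2 * k) p = p"
    unfolding e by auto
  have "b + 1 dvd p" using Suc.IH * \<open>rev_digits b (2 * k) p = p\<close> by blast
  moreover have "b + 1 dvd 1 + b ^ (2 * k + 1)"
  proof -
    have "int b - (-1) dvd int b ^ (2 * k + 1) - (-1) ^ (2 * k + 1)"
      by (metis dvd_triv_left power_diff_sumr2)
    then have "int (b + 1) dvd int (1 + b ^ (2 * k + 1))" by (simp add: algebra_simps)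
    then show ?thesis by (simp only: int_dvd_int_iff)
  qed
  moreover have "n = a * (1 + b ^ (2 * k + 1)) + b * p" using * \<open>a = c\<close> by (simp add: algebra_simps)
  ultimately show ?case by (metis dvd_add dvd_mult)
qed simp

lemma digit_shell_inject:
  assumes "a < b" "a' < b" "a * (1 + b ^ (2 * j + 2)) + b * q = a' * (1 + b ^ (2 * j + 2)) + b * q'"
  shows "a = a' \<and> q = q'"
proof -
  have "(a * (1 + b ^ (2 * j + 2)) + b * q) mod b = a" if "a < b" for a q
  proof -
    have "a * (1 + b ^ (2 * j + 2)) + b * q = a + b * (q + a * b ^ (2 * j + 1))"
      by (simp add: algebra_simps)
    then show ?thesis using that by (metis mod_less mod_mult_self2)
  qed
  with assms have "a = a'" by metis
  with assms b2 show ?thesis by simp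
qed

lemma pal_inj: "inj_on (\<lambda>(a, p). a * (1 + b ^ (2 * k + 2)) + b * p) ({..<b} \<times> pal b k)"
proof (rule inj_onI, clarify)
  fix a p a' p'
  assume "a < b" "a' < b" "a * (1 + b ^ (2 * k + 2)) + b * p = a' * (1 + b ^ (2 * k + 2)) + b * p'"
  then show "a = a' \<and> p = p'" by (rule digit_shell_inject)
qed

lemma finite_pal [simp]: "finite (pal b k)"
  by (induction k) auto

lemma card_pal: "card (pal b k) = b ^ (k + 1)"
proof (induction k)
  case (Suc k)
  then show ?case by (simp only: pal.simps card_image[OF pal_inj] card_cartesian_product) simp
qed simp

lemma sum_pal_Suc:
  fixes f :: "nat \<Rightarrow> 'a :: comm_monoid_add"
  shows "sum f (pal b (Suc k)) = (\<Sum>a<b. \<Sum>p\<in>pal b k. f (a * (1 + b ^ (2 * k + 2)) + b * p))"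
  by (simp only: pal.simps sum.reindex[OF pal_inj] sum.cartesian_product) (simp add: case_prod_unfold)

text \<open>
  Fixing the \<open>s\<close> outermost digits on both sides leaves a palindromic string in the middle.
\<close>
lemma pal_split:
  assumes "n \<in> pal b k" "s \<le> k"
  obtains z p where "z < b ^ s" "p \<in> pal b (k - s)"
    "n = z + b ^ (2 * k + 1 - s) * rev_digits b s z + b ^ s * p"
proof -
  have "\<exists>z p. z < b ^ s \<and> p \<in> pal b (k - s) \<and> n = z + b ^ (2 * k + 1 - s) * rev_digits b s z + b ^ s * p"
    using assms
  proof (induction s arbitrary: n k)
    case 0
    then show ?case by auto
  next
    case (Suc s)
    then obtain k' where k: "k = Suc k'" by (cases k) auto
    from Suc.prems obtain a p where ap: "a < b" "p \<in> pal b k'" "n = a * (1 + b ^ (2 * k' + 2)) + b * p"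
      unfolding k by auto
    from Suc.IH[OF ap(2)] Suc.prems k obtain z q where zq: "z < b ^ s" "q \<in> pal b (k' - s)"
      "p = z + b ^ (2 * k' + 1 - s) * rev_digits b s z + b ^ s * q" by auto
    have "(a + b * z) mod b = a" "(a + b * z) div b = z" using ap by auto
    then have r: "rev_digits b (Suc s) (a + b * z) = a * b ^ s + rev_digits b s z" by simp
    have l: "a + b * z < b ^ Suc s" using add_mult_less[OF ap(1) zq(1)] by simp
    have s: "s \<le> k'" using Suc.prems k by simp
    have e1: "b ^ (2 * k' + 2 - s) * b ^ s = b ^ (2 * k' + 2)" "b * b ^ (2 * k' + 1 - s) = b ^ (2 * k' + 2 - s)"
      using s by (simp_all flip: power_add power_Suc add: Suc_diff_le)
    have e2: "2 * k + 1 - Suc s = 2 * k' + 2 - s" using k s by simp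
    have "n = (a + b * z) + b ^ (2 * k + 1 - Suc s) * rev_digits b (Suc s) (a + b * z) + b ^ Suc s * q"
      unfolding r e2 ap(3) zq(3)
      by (simp only: distrib_left distrib_right e1(1)[symmetric] e1(2)[symmetric] power_Suc mult_1_right) (simp only: mult_ac add_ac)
    then show ?case using l zq(2) k by (intro exI[of _ "a + b * z"] exI[of _ q]) auto
  qed
  then show ?thesis using that by blast
qed

lemma pal_lower:
  assumes "n \<in> pal b k" "\<not> b dvd n"
  shows "b ^ (2 * k) \<le> n"
proof (cases k)
  case 0
  then show ?thesis using assms by (cases "n = 0") auto
next
  case (Suc k')
  then obtain a p where ap: "a < b" "p \<in> pal b k'" "n = a * (1 + b ^ (2 * k' + 2)) + b * p"
    using assms by auto
  have "a \<noteq> 0" using assms ap(3) by (intro notI) auto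
  then have "1 * b ^ (2 * k' + 2) \<le> a * (1 + b ^ (2 * k' + 2))"
    by (intro mult_le_mono) auto
  then show ?thesis unfolding ap(3) Suc by simp
qed

lemma dvd_cube_minus: "b dvd b ^ 3 - b" "b + 1 dvd b ^ 3 - b" "b ^ 3 - b > 0"
proof -
  have e: "b ^ 3 - b = b * (b\<^sup>2 - 1)" by (simp add: eval_nat_numeral diff_mult_distrib2)
  then show "b dvd b ^ 3 - b" by simp
  have "b\<^sup>2 - 1 = (b + 1) * (b - 1)" using b2
    by (simp add: algebra_simps power2_eq_square)
  then show "b + 1 dvd b ^ 3 - b" unfolding e by (metis dvd_mult dvd_triv_left)
  have "b\<^sup>2 \<ge> 2\<^sup>2" using b2 by (intro power_mono) auto
  then show "b ^ 3 - b > 0" using e b2 by simp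
qed

text \<open>
  Even lengths are excluded by the common divisor \<open>b + 1\<close>. Conversely a string in \<open>pal b k\<close> that is
  coprime to \<open>b\<close> has a nonzero last, hence a nonzero first digit, so its length is exactly \<open>2 k + 1\<close>.
\<close>
lemma restricted_palindromes_eq:
  "n \<in> palindromes b \<and> coprime n (b ^ 3 - b) \<longleftrightarrow> (\<exists>k. n \<in> pal b k \<and> coprime n (b ^ 3 - b))"
proof (intro iffI)
  assume n: "n \<in> palindromes b \<and> coprime n (b ^ 3 - b)"
  then have nd: "\<not> b dvd n" and n0: "n > 0" and r: "rev_digits b (floorlog b n) n = n"
    by (auto simp: palindromes_def digit_reverse_def rev_digits_eq_sum intro!: gr0I)
  have l: "n < b ^ floorlog b n" using floorlog_bounds[OF n0] b2 by auto
  have "odd (floorlog b n)"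
  proof
    assume "even (floorlog b n)"
    then obtain j where j: "floorlog b n = 2 * j" by auto
    have "b + 1 dvd n" using even_palindrome_dvd[of n j] l r j by simp
    then have "is_unit (b + 1)" using n dvd_cube_minus(2) coprime_common_divisor by blast
    then show False using b2 by simp
  qed
  then obtain k where "floorlog b n = 2 * k + 1" by (auto elim: oddE)
  then have "n \<in> pal b k" using l r pal_iff by simp
  then show "\<exists>k. n \<in> pal b k \<and> coprime n (b ^ 3 - b)" using n by blast
next
  assume "\<exists>k. n \<in> pal b k \<and> coprime n (b ^ 3 - b)"
  then obtain k where k: "n \<in> pal b k" and c: "coprime n (b ^ 3 - b)" by blast
  have nd: "\<not> b dvd n"
    using c dvd_cube_minus(1) coprime_common_divisor[of n "b ^ 3 - b" b] b2 by auto
  then have n0: "n > 0" by (intro gr0I) auto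
  have "b ^ (2 * k) \<le> n" "n < b ^ (2 * k + 1)" using pal_lower[OF k nd] pal_less[OF k] by auto
  then have "floorlog b n = 2 * k + 1"
    using floorlog_bounds[OF n0, of b] b2 floorlog_leI[of n b "2 * k + 1"]
      floorlog_le_iff[of b n "2 * k"] by (auto simp: le_Suc_eq)
  then have "n = digit_reverse b n" using k pal_iff unfolding digit_reverse_def rev_digits_eq_sum[symmetric] by metis
  then show "n \<in> palindromes b \<and> coprime n (b ^ 3 - b)" using nd c by (simp add: palindromes_def)
qed

end

section \<open>Palindromes coprime to the sieve modulus\<close>

context
  fixes b :: nat
  assumes b2: "b \<ge> 2"
begin

lemma middle_one_palindrome:
  "z < b ^ j \<Longrightarrow> z + b ^ j + b ^ (j + 1) * rev_digits b j z \<in> pal b j"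
proof (induction j arbitrary: z)
  case 0
  then show ?case using b2 by simp
next
  case (Suc j)
  have "z div b < b ^ j" using Suc.prems by (simp add: less_mult_imp_div_less mult.commute)
  then have 1: "z div b + b ^ j + b ^ (j + 1) * rev_digits b j (z div b) \<in> pal b j" by (rule Suc.IH)
  have "z = z mod b + b * (z div b)" by simp
  then have "z + b ^ Suc j + b ^ (Suc j + 1) * rev_digits b (Suc j) z =
    z mod b * (1 + b ^ (2 * j + 2)) + b * (z div b + b ^ j + b ^ (j + 1) * rev_digits b j (z div b))"
    by (simp add: algebra_simps mult_2_right power_add)
  then show ?case using 1 b2 by (auto intro!: image_eqI[of _ _ "(z mod b, z div b + b ^ j + b ^ (j + 1) * rev_digits b j (z div b))"])
qed

text \<open>
  Modulo \<open>b^2 - 1\<close> mirrored digits carry equal weights, because their exponents have the same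
  parity. Hence everything but the central digit contributes an even multiple.
\<close>
lemma middle_one_palindrome_cong:
  "z < b ^ j \<Longrightarrow> \<exists>x. [int (z + b ^ j + b ^ (j + 1) * rev_digits b j z) = 2 * x + int b ^ j] (mod (int b)\<^sup>2 - 1)"
proof (induction j arbitrary: z)
  case 0
  then show ?case by (intro exI[of _ 0]) simp
next
  case (Suc j)
  have "z div b < b ^ j" using Suc.prems by (simp add: less_mult_imp_div_less mult.commute)
  then obtain x where x: "[int (z div b + b ^ j + b ^ (j + 1) * rev_digits b j (z div b)) = 2 * x + int b ^ j] (mod (int b)\<^sup>2 - 1)"
    using Suc.IH by blast
  have b1: "[(int b)\<^sup>2 = 1] (mod (int b)\<^sup>2 - 1)" by (simp add: cong_iff_dvd_diff)
  have b1': "[int b ^ (2 * j + 2) = 1] (mod (int b)\<^sup>2 - 1)"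
  proof -
    have "2 * j + 2 = 2 * (j + 1)" by simp
    then have "int b ^ (2 * j + 2) = ((int b)\<^sup>2) ^ (j + 1)" by (simp only: power_mult)
    then show ?thesis using cong_pow[OF b1, of "j + 1"] by simp
  qed
  have "z = z mod b + b * (z div b)" by simp
  then have e: "z + b ^ Suc j + b ^ (Suc j + 1) * rev_digits b (Suc j) z =
    z mod b * (1 + b ^ (2 * j + 2)) + b * (z div b + b ^ j + b ^ (j + 1) * rev_digits b j (z div b))"
    by (simp add: algebra_simps mult_2_right power_add)
  have "[int (z mod b) * (1 + int b ^ (2 * j + 2)) + int b * int (z div b + b ^ j + b ^ (j + 1) * rev_digits b j (z div b))
      = int (z mod b) * (1 + 1) + int b * (2 * x + int b ^ j)] (mod (int b)\<^sup>2 - 1)"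
    by (intro cong_add cong_mult cong_refl b1' x)
  also have "int (z mod b) * (1 + 1) + int b * (2 * x + int b ^ j) = 2 * (int (z mod b) + int b * x) + int b ^ Suc j"
    by (simp add: algebra_simps)
  finally have "[int (z mod b) * (1 + int b ^ (2 * j + 2)) + int b * int (z div b + b ^ j + b ^ (j + 1) * rev_digits b j (z div b))
      = 2 * (int (z mod b) + int b * x) + int b ^ Suc j] (mod (int b)\<^sup>2 - 1)" .
  moreover have "int (z mod b * (1 + b ^ (2 * j + 2)) + b * Q) = int (z mod b) * (1 + int b ^ (2 * j + 2)) + int b * int Q" for Q
    by (simp only: of_nat_add of_nat_mult of_nat_1 of_nat_power)
  ultimately show ?case unfolding e by (intro exI[of _ "int (z mod b) + int b * x"]) (simp only:)
qed

text \<open>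
  The lower bound for the number of restricted palindromes: with last digit 1 and central digit 1, all
  but two of the remaining digits are free. The digits \<open>a1\<close> and \<open>a2\<close> have weights \<open>b\<close> and
  \<open>b^2 \<equiv> 1\<close> modulo \<open>b^2 - 1\<close>, so together they represent every residue and can be used to reach
  \<open>n \<equiv> 1\<close>. That \<open>k\<close> is even makes the central weight \<open>b^k\<close> congruent to 1.
\<close>
lemma exists_palindrome_cong_1:
  assumes k: "even k" "k \<ge> 3" and z: "z < b ^ (k - 3)"
  defines "p \<equiv> z + b ^ (k - 3) + b ^ (k - 3 + 1) * rev_digits b (k - 3) z"
  shows "\<exists>a1 a2 n. a1 < b \<and> a2 < b \<and> n \<in> pal b k \<and> coprime n (b ^ 3 - b) \<and>
     n = 1 * (1 + b ^ (2 * (k - 1) + 2)) + b * (a1 * (1 + b ^ (2 * (k - 2) + 2)) + b * (a2 * (1 + b ^ (2 * (k - 3) + 2)) + b * p))"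
proof -
  \<comment> \<open>Coprimality to \<open>b^3 - b = b M\<close> is checked separately for the two factors.\<close>
  define M where "M = (int b)\<^sup>2 - 1"
  have M: "M > 0"
  proof -
    have "(2::int)\<^sup>2 \<le> (int b)\<^sup>2" using b2 by (intro power_mono) auto
    then show ?thesis by (simp add: M_def)
  qed
  obtain x where x: "[int p = 2 * x + int b ^ (k - 3)] (mod M)"
    using middle_one_palindrome_cong[OF z] unfolding p_def M_def by blast
  have b1: "[(int b)\<^sup>2 = 1] (mod M)" by (simp add: M_def cong_iff_dvd_diff)
  have beven: "[int b ^ e = 1] (mod M)" if "even e" for e
  proof -
    obtain f where "e = 2 * f" using \<open>even e\<close> by (elim evenE)
    then have "int b ^ e = ((int b)\<^sup>2) ^ f" by (simp add: power_mult)
    then show ?thesis using cong_pow[OF b1, of f] by simp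
  qed
  \<comment> \<open>The residue that the two adjustable digits have to represent; its base-b digits are \<open>a1\<close> and \<open>a2\<close>.\<close>
  define t where "t = nat ((- (1 + int b * x)) mod M)"
  have t: "int t = (- (1 + int b * x)) mod M" using M by (simp add: t_def)
  have "int t < (int b)\<^sup>2" using pos_mod_bound[OF M, of "- (1 + int b * x)"] unfolding t by (simp add: M_def)
  then have "t < b * b" by (simp flip: of_nat_mult add: power2_eq_square)
  define a1 a2 where "a1 = t div b" and "a2 = t mod b"
  have a: "a1 < b" "a2 < b" using \<open>t < b * b\<close> b2 by (simp_all add: a1_def a2_def less_mult_imp_div_less)
  have ta: "int t = int b * int a1 + int a2" unfolding a1_def a2_def
    by (metis mult_div_mod_eq of_nat_add of_nat_mult)
  define n where "n = 1 * (1 + b ^ (2 * (k - 1) + 2)) + b * (a1 * (1 + b ^ (2 * (k - 2) + 2)) + b * (a2 * (1 + b ^ (2 * (k - 3) + 2)) + b * p))"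
  have p: "p \<in> pal b (k - 3)" unfolding p_def by (rule middle_one_palindrome[OF z])
  have step: "c * (1 + b ^ (2 * j + 2)) + b * q \<in> pal b (Suc j)" if "c < b" "q \<in> pal b j" for c q j
    using that by (auto intro!: image_eqI[of _ _ "(c, q)"])
  have "n \<in> pal b (Suc (k - 1))" unfolding n_def
  proof (rule step)
    have "a1 * (1 + b ^ (2 * (k - 2) + 2)) + b * (a2 * (1 + b ^ (2 * (k - 3) + 2)) + b * p) \<in> pal b (Suc (k - 2))"
    proof (rule step)
      have "a2 * (1 + b ^ (2 * (k - 3) + 2)) + b * p \<in> pal b (Suc (k - 3))" by (rule step[OF a(2) p])
      moreover have "Suc (k - 3) = k - 2" using k by simp
      ultimately show "a2 * (1 + b ^ (2 * (k - 3) + 2)) + b * p \<in> pal b (k - 2)" by simp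
    qed (rule a(1))
    moreover have "Suc (k - 2) = k - 1" using k by simp
    ultimately show "a1 * (1 + b ^ (2 * (k - 2) + 2)) + b * (a2 * (1 + b ^ (2 * (k - 3) + 2)) + b * p) \<in> pal b (k - 1)" by simp
  qed (use b2 in simp)
  then have npal: "n \<in> pal b k" using k by simp
  have n1: "[int n = 1] (mod M)"
  proof -
    have "int n = 1 + int b ^ (2 * (k - 1) + 2) + (int b * int a1) * (1 + int b ^ (2 * (k - 2) + 2))
        + (int b)\<^sup>2 * int a2 * (1 + int b ^ (2 * (k - 3) + 2)) + (int b)\<^sup>2 * int b * int p"
      by (simp add: n_def algebra_simps power2_eq_square)
    also have "[\<dots> = 1 + 1 + (int b * int a1) * (1 + 1) + 1 * int a2 * (1 + 1) + 1 * int b * (2 * x + int b ^ (k - 3))] (mod M)"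
      by (intro cong_add cong_mult cong_refl b1 beven x) auto
    also have "1 + 1 + (int b * int a1) * (1 + 1) + 1 * int a2 * (1 + 1) + 1 * int b * (2 * x + int b ^ (k - 3))
      = 2 * (int t + (1 + int b * x)) + int b * int b ^ (k - 3)" by (simp add: ta algebra_simps)
    also have "int b * int b ^ (k - 3) = int b ^ (k - 2)"
    proof -
      have "k - 2 = Suc (k - 3)" using k by simp
      then show ?thesis by simp
    qed
    also have "[2 * (int t + (1 + int b * x)) + int b ^ (k - 2) = 2 * 0 + 1] (mod M)"
    proof (intro cong_add cong_mult cong_refl beven)
      have "[int t = - (1 + int b * x)] (mod M)" by (simp add: t cong_def)
      then have "[int t + (1 + int b * x) = - (1 + int b * x) + (1 + int b * x)] (mod M)"
        by (intro cong_add cong_refl)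
      then show "[int t + (1 + int b * x) = 0] (mod M)" by simp
    qed (use k in simp)
    finally show ?thesis by simp
  qed
  have copM: "coprime (int n) M"
    using n1 by (metis cong_imp_coprime cong_sym coprime_1_left)
  have "coprime (int n) (int b)"
  proof -
    have "n = 1 + b * (b ^ (2 * (k - 1) + 1) + (a1 * (1 + b ^ (2 * (k - 2) + 2)) + b * (a2 * (1 + b ^ (2 * (k - 3) + 2)) + b * p)))"
      by (simp add: n_def algebra_simps)
    then have "[n = 1] (mod b)" by (metis cong_add_lcancel_0_nat cong_mult_self_left)
    then have "coprime n b" by (metis cong_imp_coprime cong_sym coprime_1_left)
    then show ?thesis by simp
  qed
  then have "coprime (int n) (int b * M)" using copM by simp
  moreover have "int b * M = int (b ^ 3 - b)"
  proof -
    have "b \<le> b ^ 3" using b2 by (simp add: self_le_power)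
    then show ?thesis by (simp add: M_def of_nat_diff algebra_simps power2_eq_square power3_eq_cube)
  qed
  ultimately have "coprime n (b ^ 3 - b)" by (simp only: coprime_int_iff)
  then show ?thesis using a npal n_def by blast
qed

lemma card_coprime_palindromes_ge:
  assumes k: "even k" "k \<ge> 3"
  shows "b ^ (k - 3) \<le> card {n \<in> pal b k. coprime n (b ^ 3 - b)}"
proof -
  define P where "P z = z + b ^ (k - 3) + b ^ (k - 3 + 1) * rev_digits b (k - 3) z" for z
  have "\<forall>z\<in>{..<b ^ (k - 3)}. \<exists>n a1 a2. a1 < b \<and> a2 < b \<and> n \<in> pal b k \<and> coprime n (b ^ 3 - b) \<and>
     n = 1 * (1 + b ^ (2 * (k - 1) + 2)) + b * (a1 * (1 + b ^ (2 * (k - 2) + 2)) + b * (a2 * (1 + b ^ (2 * (k - 3) + 2)) + b * P z))"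
    using exists_palindrome_cong_1[OF k] unfolding P_def by blast
  then obtain f where f: "\<forall>z\<in>{..<b ^ (k - 3)}. \<exists>a1 a2. a1 < b \<and> a2 < b \<and> f z \<in> pal b k \<and> coprime (f z) (b ^ 3 - b) \<and>
     f z = 1 * (1 + b ^ (2 * (k - 1) + 2)) + b * (a1 * (1 + b ^ (2 * (k - 2) + 2)) + b * (a2 * (1 + b ^ (2 * (k - 3) + 2)) + b * P z))"
    by (rule bchoice[THEN exE])
  have "inj_on f {..<b ^ (k - 3)}"
  proof (rule inj_onI)
    fix z z' assume z: "z \<in> {..<b ^ (k - 3)}" "z' \<in> {..<b ^ (k - 3)}" and eq: "f z = f z'"
    obtain a1 a2 where a: "a1 < b" "a2 < b" "f z = 1 * (1 + b ^ (2 * (k - 1) + 2)) + b * (a1 * (1 + b ^ (2 * (k - 2) + 2)) + b * (a2 * (1 + b ^ (2 * (k - 3) + 2)) + b * P z))"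
      using f z(1) by blast
    obtain c1 c2 where c: "c1 < b" "c2 < b" "f z' = 1 * (1 + b ^ (2 * (k - 1) + 2)) + b * (c1 * (1 + b ^ (2 * (k - 2) + 2)) + b * (c2 * (1 + b ^ (2 * (k - 3) + 2)) + b * P z'))"
      using f z(2) by blast
    have "1 < b" using b2 by simp
    from eq[unfolded a(3) c(3)] have "P z = P z'"
      using digit_shell_inject[OF b2 \<open>1 < b\<close> \<open>1 < b\<close>] digit_shell_inject[OF b2 a(1) c(1)] digit_shell_inject[OF b2 a(2) c(2)] by metis
    moreover have "P z mod b ^ (k - 3) = z" if "z < b ^ (k - 3)" for z
    proof -
      have "P z = z + b ^ (k - 3) * (1 + b * rev_digits b (k - 3) z)" by (simp add: P_def algebra_simps)
      then show ?thesis using that by (metis mod_less mod_mult_self2)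
    qed
    ultimately show "z = z'" using z by (metis lessThan_iff)
  qed
  moreover have "f ` {..<b ^ (k - 3)} \<subseteq> {n \<in> pal b k. coprime n (b ^ 3 - b)}" using f by blast
  ultimately have "card {..<b ^ (k - 3)} \<le> card {n \<in> pal b k. coprime n (b ^ 3 - b)}"
    using b2 by (intro card_inj_on_le[of f]) auto
  then show ?thesis by simp
qed

end

section \<open>Exponentials and detection of near integers\<close>

lemma sqrt_cong_dvd:
  fixes x y :: int and b s :: nat
  assumes "coprime x (int b)" "2 * int b dvd x - y" "int b ^ s dvd x\<^sup>2 - y\<^sup>2"
  shows "int b ^ s dvd 2 * (x - y)"
proof -
  obtain j where j: "x - y = 2 * int b * j" using assms(2) by (elim dvdE)
  have e: "x\<^sup>2 - y\<^sup>2 = 2 * (x - y) * (x - int b * j)"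
  proof -
    have "x + y = 2 * (x - int b * j)" using j by algebra
    then have "(x - y) * (x + y) = 2 * (x - y) * (x - int b * j)" by simp
    then show ?thesis by (simp add: power2_eq_square square_diff_square_factored mult.commute)
  qed
  have "coprime (x - int b * j) (int b)"
  proof (rule coprimeI)
    fix c assume c: "c dvd x - int b * j" "c dvd int b"
    then have "c dvd (x - int b * j) + int b * j" by (intro dvd_add) auto
    then show "is_unit c" using c(2) assms(1) coprime_common_divisor[of x "int b" c] by simp
  qed
  then have "coprime (int b ^ s) (x - int b * j)" by (simp add: coprime_commute)
  then show ?thesis using assms(3) unfolding e by (simp add: coprime_dvd_mult_left_iff)
qed

lemma abs_diff_less_of_same_half:
  fixes x y \<mu> B :: int
  assumes "\<mu> \<le> x" "x < \<mu> + B" "\<mu> \<le> y" "y < \<mu> + B"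
    and "2 * (x - \<mu>) < B \<longleftrightarrow> 2 * (y - \<mu>) < B"
  shows "\<bar>2 * (x - y)\<bar> < B"
proof (cases "2 * (x - \<mu>) < B")
  case True
  then have "2 * (y - \<mu>) < B" using assms(5) by blast
  then show ?thesis using True assms(1-4) unfolding abs_less_iff right_diff_distrib
    by (intro conjI; linarith)
next
  case False
  then have "\<not> 2 * (y - \<mu>) < B" using assms(5) by blast
  then show ?thesis using False assms(1-4) unfolding abs_less_iff right_diff_distrib
    by (intro conjI; linarith)
qed

text \<open>
  Boundedly many square roots of a unit modulo \<open>b^s\<close>, by an argument that treats all prime factors of
  \<open>b\<close>, including 2, at once: if \<open>x \<equiv> y\<close> modulo \<open>2 b\<close>, then \<open>(x + y) / 2\<close> is coprime to \<open>b\<close>, so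
  \<open>x^2 \<equiv> y^2\<close> already forces \<open>b^s\<close> to divide \<open>2 (x - y)\<close>. Each class modulo \<open>2 b\<close>
  thus contains at most one root in each half of the interval.
\<close>
lemma card_square_roots_le:
  fixes b s :: nat and \<mu> :: int and X :: "int set"
  assumes b: "b > 0" and X: "X \<subseteq> {\<mu>..<\<mu> + int b ^ s}"
    and cop: "\<And>x. x \<in> X \<Longrightarrow> coprime x (int b)"
    and sq: "\<And>x y. x \<in> X \<Longrightarrow> y \<in> X \<Longrightarrow> int b ^ s dvd x\<^sup>2 - y\<^sup>2"
  shows "card X \<le> 4 * b"
proof -
  define f where "f = (\<lambda>x. (x mod (2 * int b), 2 * (x - \<mu>) < int b ^ s))"
  have "inj_on f X"
  proof (rule inj_onI)
    fix x y assume xy: "x \<in> X" "y \<in> X" "f x = f y"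
    then have "2 * int b dvd x - y" by (auto simp: f_def mod_eq_dvd_iff)
    then have d: "int b ^ s dvd 2 * (x - y)" using sqrt_cong_dvd[OF cop[OF xy(1)]] sq[OF xy(1,2)] by blast
    have "\<mu> \<le> x" "x < \<mu> + int b ^ s" "\<mu> \<le> y" "y < \<mu> + int b ^ s"
      and iff: "2 * (x - \<mu>) < int b ^ s \<longleftrightarrow> 2 * (y - \<mu>) < int b ^ s"
      using xy X unfolding f_def by auto
    then have "\<bar>2 * (x - y)\<bar> < int b ^ s" by (rule abs_diff_less_of_same_half)
    then have "2 * (x - y) = 0" using dvd_imp_le_int[OF _ d] by linarith
    then show "x = y" by simp
  qed
  moreover have "f ` X \<subseteq> {0..<2 * int b} \<times> UNIV" using b by (auto simp: f_def)
  ultimately have "card X \<le> card ({0..<2 * int b} \<times> (UNIV :: bool set))"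
    by (intro card_inj_on_le[of f]) simp_all
  then show ?thesis by (simp add: card_cartesian_product)
qed

definition unit_exp :: "real \<Rightarrow> complex" where "unit_exp t = cis (2 * pi * t)"

lemma unit_exp_add: "unit_exp (s + t) = unit_exp s * unit_exp t"
  by (simp add: unit_exp_def cis_mult distrib_left)

lemma unit_exp_diff: "unit_exp (s - t) = unit_exp s * cnj (unit_exp t)"
  by (simp add: unit_exp_def cis_mult cis_cnj right_diff_distrib)

lemma norm_unit_exp [simp]: "norm (unit_exp t) = 1" by (simp add: unit_exp_def)

lemma unit_exp_0 [simp]: "unit_exp 0 = 1" by (simp add: unit_exp_def)

lemma unit_exp_int: "t \<in> \<int> \<Longrightarrow> unit_exp t = 1"
  by (auto simp: unit_exp_def elim!: Ints_cases intro: cis_multiple_2pi)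

lemma unit_exp_of_nat_mult: "unit_exp (real n * t) = unit_exp t ^ n"
  by (simp add: unit_exp_def Complex.DeMoivre mult_ac)

lemma unit_exp_eq_1: 
  assumes "unit_exp t = 1" shows "t \<in> \<int>"
proof -
  have "cos (2 * pi * t) = 1" using assms by (auto simp: unit_exp_def complex_eq_iff)
  then obtain n :: int where "2 * pi * t = n * 2 * pi" using cos_one_2pi_int by auto
  then have "t = n" by simp
  then show ?thesis by simp
qed

lemma sum_unit_exp:
  fixes a :: int and q :: nat
  assumes "q > 0"
  shows "(\<Sum>r<q. unit_exp (real r * (real_of_int a / real q))) = (if int q dvd a then of_nat q else 0)"
proof -
  define w where "w = unit_exp (real_of_int a / real q)"
  have 1: "w ^ q = 1" using assms unfolding w_def
    by (simp flip: unit_exp_of_nat_mult add: unit_exp_int)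
  have e: "(\<Sum>r<q. unit_exp (real r * (real_of_int a / real q))) = (\<Sum>r<q. w ^ r)"
    by (simp add: w_def unit_exp_of_nat_mult del: times_divide_eq_right)
  show ?thesis
  proof (cases "w = 1")
    case True
    then have "real_of_int a / real q \<in> \<int>" using unit_exp_eq_1 unfolding w_def by blast
    then obtain j :: int where "real_of_int a / real q = j" by (elim Ints_cases)
    then have "real_of_int a = real_of_int (int q * j)" using assms by (simp add: field_simps)
    then have "int q dvd a" by (metis dvd_triv_left of_int_eq_iff)
    then show ?thesis using e True by simp
  next
    case False
    have "\<not> int q dvd a"
    proof
      assume "int q dvd a"
      then obtain j where "a = int q * j" by (elim dvdE)
      then have "real_of_int a / real q = real_of_int j" using assms by simp
      then show False using False unfolding w_def by (simp add: unit_exp_int)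
    qed
    moreover have "(\<Sum>r<q. w ^ r) = 0" using geometric_sum[OF False, of q] 1 by simp
    ultimately show ?thesis using e by simp
  qed
qed

text \<open>
  Detection by the Fejer kernel, as an upper bound. If \<open>t z + \<xi>\<close> is within \<open>1 / (6 K)\<close> of an integer, then all \<open>K\<close>
  exponentials \<open>e(j (t z + \<xi>))\<close> have real part at least one half, and the square of their sum is at
  least \<open>K^2 / 4\<close>. Expanding the squares and taking absolute values removes the shift \<open>\<xi>\<close>, which
  may therefore depend on parameters that are averaged later.
\<close>
lemma detect_near_integer:
  fixes t :: "'a \<Rightarrow> real"
  assumes Z: "finite Z" and K: "K > (0::nat)"
    and near: "\<And>z. z \<in> W \<Longrightarrow> \<exists>n::int. \<bar>t z + \<xi> - n\<bar> * K \<le> 1 / 6" and WZ: "W \<subseteq> Z"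
  shows "real (card W) \<le> 4 / real K ^ 2 * (\<Sum>i<K. \<Sum>j<K. norm (\<Sum>z\<in>Z. unit_exp ((real i - real j) * t z)))"
proof -
  define v where "v z = (\<Sum>j<K. unit_exp (real j * (t z + \<xi>)))" for z
  have big: "real K / 2 \<le> norm (v z)" if z: "z \<in> W" for z
  proof -
    obtain n :: int where n: "\<bar>t z + \<xi> - n\<bar> * K \<le> 1 / 6" using near[OF z] by blast
    define \<eta> where "\<eta> = t z + \<xi> - n"
    have "real K / 2 = (\<Sum>j<K. 1 / 2)" by simp
    also have "\<dots> \<le> (\<Sum>j<K. Re (unit_exp (real j * (t z + \<xi>))))"
    proof (rule sum_mono)
      fix j assume j: "j \<in> {..<K}"
      have "unit_exp (real j * (t z + \<xi>)) = unit_exp (real j * \<eta> + real_of_int (int j * n))"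
        by (simp add: \<eta>_def algebra_simps)
      also have "\<dots> = unit_exp (real j * \<eta>)" by (subst unit_exp_add) (simp add: unit_exp_int del: of_int_mult)
      finally have e: "Re (unit_exp (real j * (t z + \<xi>))) = cos (2 * pi * \<bar>real j * \<eta>\<bar>)"
        using cos_abs_real[of "2 * pi * (real j * \<eta>)"] by (simp add: unit_exp_def abs_mult)
      have "\<bar>real j * \<eta>\<bar> \<le> real K * \<bar>\<eta>\<bar>" using j by (simp add: abs_mult mult_right_mono)
      then have "\<bar>real j * \<eta>\<bar> \<le> 1 / 6" using n by (simp add: \<eta>_def mult.commute)
      then have "2 * pi * \<bar>real j * \<eta>\<bar> \<le> 2 * pi * (1 / 6)" by (intro mult_left_mono) auto
      then have "2 * pi * \<bar>real j * \<eta>\<bar> \<le> pi / 3" by simp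
      then have "cos (pi / 3) \<le> cos (2 * pi * \<bar>real j * \<eta>\<bar>)"
        by (intro cos_monotone_0_pi_le) auto
      then show "1 / 2 \<le> Re (unit_exp (real j * (t z + \<xi>)))" using e by (simp add: cos_60)
    qed
    also have "\<dots> = Re (v z)" by (simp add: v_def)
    also have "\<dots> \<le> norm (v z)" by (rule complex_Re_le_cmod)
    finally show ?thesis .
  qed
  have "real (card W) * (real K / 2)\<^sup>2 = (\<Sum>z\<in>W. (real K / 2)\<^sup>2)" by simp
  also have "\<dots> \<le> (\<Sum>z\<in>W. (norm (v z))\<^sup>2)" using big by (intro sum_mono power_mono) auto
  also have "\<dots> \<le> (\<Sum>z\<in>Z. (norm (v z))\<^sup>2)" using WZ Z by (intro sum_mono2) auto
  also have "\<dots> = norm (of_real (\<Sum>z\<in>Z. (norm (v z))\<^sup>2) :: complex)"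
    by (simp only: norm_of_real) (simp add: sum_nonneg)
  also have "of_real (\<Sum>z\<in>Z. (norm (v z))\<^sup>2) = (\<Sum>z\<in>Z. v z * cnj (v z))"
    by (simp only: of_real_sum complex_norm_square)
  also have "\<dots> = (\<Sum>z\<in>Z. \<Sum>i<K. \<Sum>j<K. unit_exp ((real i - real j) * \<xi>) * unit_exp ((real i - real j) * t z))"
  proof (rule sum.cong[OF refl])
    fix z
    have "unit_exp (real i * (t z + \<xi>)) * cnj (unit_exp (real j * (t z + \<xi>))) =
        unit_exp ((real i - real j) * \<xi>) * unit_exp ((real i - real j) * t z)" for i j :: nat
      unfolding unit_exp_diff[symmetric] unit_exp_add[symmetric] by (simp add: algebra_simps)
    then show "v z * cnj (v z) = (\<Sum>i<K. \<Sum>j<K. unit_exp ((real i - real j) * \<xi>) * unit_exp ((real i - real j) * t z))"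
      unfolding v_def cnj_sum sum_product by simp
  qed
  also have "\<dots> = (\<Sum>i<K. \<Sum>j<K. unit_exp ((real i - real j) * \<xi>) * (\<Sum>z\<in>Z. unit_exp ((real i - real j) * t z)))"
  proof -
    have "(\<Sum>z\<in>Z. \<Sum>i<K. \<Sum>j<K. f i j * g i j z) = (\<Sum>i<K. \<Sum>j<K. f i j * (\<Sum>z\<in>Z. g i j z))"
      for f :: "nat \<Rightarrow> nat \<Rightarrow> complex" and g
      by (simp add: sum_distrib_left sum.swap[of _ Z])
    then show ?thesis .
  qed
  also have "norm \<dots> \<le> (\<Sum>i<K. \<Sum>j<K. norm (unit_exp ((real i - real j) * \<xi>) * (\<Sum>z\<in>Z. unit_exp ((real i - real j) * t z))))"
    by (intro order.trans[OF norm_sum] sum_mono norm_sum)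
  finally have "real (card W) * (real K / 2)\<^sup>2 \<le> (\<Sum>i<K. \<Sum>j<K. norm (\<Sum>z\<in>Z. unit_exp ((real i - real j) * t z)))"
    by (simp add: norm_mult)
  moreover have "4 / real K ^ 2 * (real (card W) * (real K / 2)\<^sup>2) = real (card W)"
    using K by (simp add: power2_eq_square)
  ultimately show ?thesis by (metis divide_nonneg_nonneg mult_left_mono zero_le_numeral zero_le_power2)
qed

section \<open>Equidistribution of palindromes in residue classes\<close>

text \<open>
  Only the first two terms of the sum are played off against each other; by the parallelogram law,
  \<open>v\<close> being away from 1 makes \<open>1 + v\<close> shorter than 2.
\<close>
lemma norm_geometric_sum_le:
  fixes v :: complex and \<delta> :: real
  assumes b: "b \<ge> (2::nat)" and v: "norm v = 1" and \<delta>: "0 \<le> \<delta>" "\<delta> \<le> norm (v - 1)"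
  shows "norm (\<Sum>a<b. v ^ a) \<le> real b - \<delta>\<^sup>2 / 4"
proof -
  have "(norm (1 + v))\<^sup>2 + (norm (v - 1))\<^sup>2 = 2 + 2 * (norm v)\<^sup>2"
    unfolding cmod_power2 by (simp add: power2_eq_square algebra_simps)
  moreover have "\<delta>\<^sup>2 \<le> (norm (v - 1))\<^sup>2" using \<delta> by (intro power_mono) auto
  ultimately have 1: "(norm (1 + v))\<^sup>2 \<le> 4 - \<delta>\<^sup>2" using v by simp
  have "norm (v - 1) \<le> 2" using norm_triangle_ineq4[of v 1] v by simp
  then have "\<delta>\<^sup>2 \<le> 2\<^sup>2" using \<delta> by (intro power_mono) auto
  then have 2: "0 \<le> 2 - \<delta>\<^sup>2 / 4" by simp
  have "4 - \<delta>\<^sup>2 \<le> (2 - \<delta>\<^sup>2 / 4)\<^sup>2" by (simp add: power2_diff)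
  then have 3: "norm (1 + v) \<le> 2 - \<delta>\<^sup>2 / 4" using 1 2 by (intro power2_le_imp_le[OF _ 2]) linarith
  define c where "c = b - 2"
  have c: "b = Suc (Suc c)" using b by (simp add: c_def)
  have "(\<Sum>a<b. v ^ a) = (1 + v) + (\<Sum>a<c. v ^ (Suc (Suc a)))"
    unfolding c sum.lessThan_Suc_shift by simp
  also have "norm \<dots> \<le> norm (1 + v) + norm (\<Sum>a<c. v ^ (Suc (Suc a)))" by (rule norm_triangle_ineq)
  also have "norm (\<Sum>a<c. v ^ (Suc (Suc a))) \<le> (\<Sum>a<c. norm (v ^ (Suc (Suc a))))" by (rule norm_sum)
  also have "\<dots> = c" using v by (simp add: norm_power norm_mult)
  finally show ?thesis using 3 c by simp
qed

lemma norm_power_minus_1_le: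
  fixes u :: complex
  assumes "norm u = 1"
  shows "norm (u ^ n - 1) \<le> real n * norm (u - 1)"
  using norm_power_diff[of u 1 n] assms by simp

text \<open>
  The powers of \<open>w\<close> sum to 0, so \<open>q\<close> is the sum of the \<open>q\<close> differences \<open>1 - w^j\<close>, each at most
  \<open>q |w - 1|\<close>.
\<close>
lemma norm_root_of_unity_minus_1_ge:
  fixes w :: complex
  assumes "w ^ q = 1" "w \<noteq> 1" "norm w = 1" "q > 0"
  shows "1 / real q \<le> norm (w - 1)"
proof -
  have "real q = norm (\<Sum>j<q. w ^ j - 1)"
    using geometric_sum[of w q] assms by (simp add: sum_subtractf)
  also have "\<dots> \<le> (\<Sum>j<q. norm (w ^ j - 1))" by (rule norm_sum)
  also have "\<dots> \<le> (\<Sum>j<q. real q * norm (w - 1))"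
  proof (rule sum_mono)
    fix j assume "j \<in> {..<q}"
    then have "real j * norm (w - 1) \<le> real q * norm (w - 1)" by (intro mult_right_mono) auto
    then show "norm (w ^ j - 1) \<le> real q * norm (w - 1)"
      using norm_power_minus_1_le[OF assms(3), of j] by linarith
  qed
  also have "\<dots> = real q * (real q * norm (w - 1))" by simp
  finally have "1 \<le> real q * norm (w - 1)" using assms(4) by simp
  then show ?thesis using assms(4) by (simp add: field_simps)
qed

text \<open>
  Close to 1 the \<open>b\<close>-th power map is expanding. This is what moves a root of unity away from 1 after
  logarithmically many steps.
\<close>
lemma norm_power_minus_1_growth:
  fixes w :: complex
  assumes b: "b \<ge> (2::nat)" and w: "norm w = 1" "norm (w - 1) \<le> 1 / real b ^ 2"
  shows "3 / 2 * norm (w - 1) \<le> norm (w ^ b - 1)"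
proof -
  have "real b - norm (\<Sum>j<b. w ^ j) \<le> norm (of_nat b - (\<Sum>j<b. w ^ j))"
    using norm_triangle_ineq2[of "of_nat b :: complex" "\<Sum>j<b. w ^ j"] by simp
  also have "of_nat b - (\<Sum>j<b. w ^ j) = (\<Sum>j<b. 1 - w ^ j)" by (simp add: sum_subtractf)
  also have "norm \<dots> \<le> (\<Sum>j<b. norm (1 - w ^ j))" by (rule norm_sum)
  also have "\<dots> \<le> (\<Sum>j<b. real j * (1 / real b ^ 2))"
  proof (rule sum_mono)
    fix j
    have "norm (1 - w ^ j) \<le> real j * norm (w - 1)"
      using norm_power_minus_1_le[OF w(1), of j] by (simp add: norm_minus_commute)
    also have "\<dots> \<le> real j * (1 / real b ^ 2)" using w(2) by (intro mult_left_mono) auto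
    finally show "norm (1 - w ^ j) \<le> real j * (1 / real b ^ 2)" .
  qed
  also have "\<dots> = (\<Sum>j<b. real j) / real b ^ 2" by (simp add: sum_divide_distrib)
  also have "(\<Sum>j<b. real j) = real b * (real b - 1) / 2" by (induction b) (auto simp: field_simps)
  also have "real b * (real b - 1) / 2 / real b ^ 2 \<le> 1 / 2"
    using b by (simp add: field_simps power2_eq_square)
  finally have "real b - 1 / 2 \<le> norm (\<Sum>j<b. w ^ j)" by simp
  then have "3 / 2 \<le> norm (\<Sum>j<b. w ^ j)" using b by linarith
  then have "3 / 2 * norm (w - 1) \<le> norm (\<Sum>j<b. w ^ j) * norm (w - 1)" by (intro mult_right_mono) auto
  also have "\<dots> = norm (w ^ b - 1)" by (simp add: power_diff_1_eq norm_mult mult.commute)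
  finally show ?thesis .
qed

lemma power_eq_1_coprime:
  fixes w :: complex
  assumes "w ^ q = 1" "w ^ b = 1" "coprime q b"
  shows "w = 1"
proof -
  obtain x where x: "[b * x = 1] (mod q)" using cong_solve_coprime_nat[of b q] assms(3) by (auto simp: coprime_commute)
  have red: "w ^ n = w ^ (n mod q)" for n
  proof -
    have "w ^ n = w ^ (q * (n div q) + n mod q)" by simp
    also have "\<dots> = w ^ (n mod q)" unfolding power_add power_mult by (simp add: assms)
    finally show ?thesis .
  qed
  have "w = w ^ 1" by simp
  also have "\<dots> = w ^ (b * x)" using red[of 1] red[of "b * x"] x by (simp only: cong_def)
  also have "\<dots> = 1" by (simp add: power_mult assms)
  finally show ?thesis .
qed

definition pal_exp_sum :: "nat \<Rightarrow> nat \<Rightarrow> complex \<Rightarrow> complex" where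
  "pal_exp_sum b k \<zeta> = (\<Sum>n\<in>pal b k. \<zeta> ^ n)"

text \<open>
  The frequencies that occur when divisibility by \<open>q\<close> and coprimality to \<open>b^3 - b\<close> are both expanded
  into exponentials: \<open>h / q + r / (b^3 - b)\<close> with \<open>q\<close> not dividing \<open>h\<close>.
\<close>
definition oscillating :: "nat \<Rightarrow> nat \<Rightarrow> complex \<Rightarrow> bool" where
  "oscillating b q \<zeta> \<longleftrightarrow> norm \<zeta> = 1 \<and> \<zeta> ^ (b ^ 3 - b) \<noteq> 1 \<and> (\<zeta> ^ (b ^ 3 - b)) ^ q = 1"

text \<open>
  The factor gained from a pair of consecutive digits whose frequency satisfies
  \<open>|\<zeta>^(b^2 - 1) - 1| \<ge> 1 / b^2\<close>: it is \<open>1 - \<delta>^2 / (4 b)\<close> with \<open>\<delta> = 1 / (b^2 (b + 1))\<close>.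
\<close>
definition contraction :: "nat \<Rightarrow> real" where
  "contraction b = 1 - 1 / (4 * real b ^ 5 * (real b + 1)\<^sup>2)"

context
  fixes b :: nat
  assumes b2: "b \<ge> 2"
begin

lemma contraction_bounds: "1 / 2 \<le> contraction b" "contraction b < 1"
proof -
  have "1 \<le> real b ^ 5" "1 \<le> (real b + 1)\<^sup>2" using b2 by (auto intro!: one_le_power)
  then have "1 * 1 \<le> real b ^ 5 * (real b + 1)\<^sup>2" by (intro mult_mono) auto
  then have "2 \<le> 4 * real b ^ 5 * (real b + 1)\<^sup>2" by simp
  then show "1 / 2 \<le> contraction b" "contraction b < 1" unfolding contraction_def
    by (auto simp: field_simps)
qed

lemma pal_exp_sum_Suc:
  "pal_exp_sum b (Suc k) \<zeta> = (\<Sum>a<b. (\<zeta> ^ (1 + b ^ (2 * k + 2))) ^ a) * pal_exp_sum b k (\<zeta> ^ b)"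
proof -
  have "pal_exp_sum b (Suc k) \<zeta> = (\<Sum>a<b. \<Sum>p\<in>pal b k. \<zeta> ^ (a * (1 + b ^ (2 * k + 2)) + b * p))"
    unfolding pal_exp_sum_def sum_pal_Suc[OF b2] ..
  also have "\<dots> = (\<Sum>a<b. \<Sum>p\<in>pal b k. (\<zeta> ^ (1 + b ^ (2 * k + 2))) ^ a * (\<zeta> ^ b) ^ p)"
  proof -
    have "\<zeta> ^ (a * N + b * p) = (\<zeta> ^ N) ^ a * (\<zeta> ^ b) ^ p" for a N p
      by (simp add: power_add mult.commute[of a] flip: power_mult)
    then show ?thesis by (simp only:)
  qed
  also have "\<dots> = (\<Sum>a<b. (\<zeta> ^ (1 + b ^ (2 * k + 2))) ^ a) * (\<Sum>p\<in>pal b k. (\<zeta> ^ b) ^ p)"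
    by (rule sum_product[symmetric])
  finally show ?thesis unfolding pal_exp_sum_def .
qed

lemma norm_geometric_sum_trivial:
  "norm v = 1 \<Longrightarrow> norm (\<Sum>a<b. v ^ a :: complex) \<le> real b"
  using norm_geometric_sum_le[OF b2, of v 0] by simp

lemma norm_pal_exp_sum_drop:
  "norm \<zeta> = 1 \<Longrightarrow> norm (pal_exp_sum b (k + j) \<zeta>) \<le> real b ^ j * norm (pal_exp_sum b k (\<zeta> ^ b ^ j))"
proof (induction j arbitrary: \<zeta>)
  case (Suc j)
  have "norm (pal_exp_sum b (Suc (k + j)) \<zeta>) \<le> real b * norm (pal_exp_sum b (k + j) (\<zeta> ^ b))"
    unfolding pal_exp_sum_Suc norm_mult using Suc.prems
    by (intro mult_right_mono norm_geometric_sum_trivial) (auto simp: norm_power norm_mult)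
  also have "\<dots> \<le> real b * (real b ^ j * norm (pal_exp_sum b k ((\<zeta> ^ b) ^ b ^ j)))"
    using Suc.prems by (intro mult_left_mono Suc.IH) (auto simp: norm_power)
  finally show ?case by (simp add: power_mult mult.assoc)
qed simp

text \<open>
  The digits at distance 0 and 1 from the ends contribute geometric sums at \<open>u = \<zeta>^(1 + b^(2k + 4))\<close> and
  \<open>v = \<zeta>^(b + b^(2k + 3))\<close>. Since \<open>v^b = \<zeta>^(b^2 - 1) u\<close>, the high power of \<open>b\<close> cancels, and \<open>u\<close> and \<open>v\<close>
  cannot both be near 1.
\<close>
lemma norm_pal_exp_sum_two_steps:
  assumes \<zeta>: "norm \<zeta> = 1" and big: "1 / real b ^ 2 \<le> norm (\<zeta> ^ (b\<^sup>2 - 1) - 1)"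
  shows "norm (pal_exp_sum b (k + 2) \<zeta>) \<le> real b ^ 2 * contraction b * norm (pal_exp_sum b k (\<zeta> ^ b ^ 2))"
proof -
  define u v where "u = \<zeta> ^ (1 + b ^ (2 * k + 4))" and "v = (\<zeta> ^ b) ^ (1 + b ^ (2 * k + 2))"
  have n: "norm u = 1" "norm v = 1" using \<zeta> by (auto simp: u_def v_def norm_power norm_mult)
  have "v ^ b = \<zeta> ^ (b\<^sup>2 - 1) * u"
  proof -
    have "1 \<le> b\<^sup>2" using b2 by simp
    then have "b * (1 + b ^ (2 * k + 2)) * b = (b\<^sup>2 - 1) + (1 + b ^ (2 * k + 4))"
      by (simp add: algebra_simps power2_eq_square eval_nat_numeral)
    then show ?thesis unfolding u_def v_def by (simp only: power_mult[symmetric] power_add[symmetric])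
  qed
  then have "\<zeta> ^ (b\<^sup>2 - 1) * u - u = (v ^ b - 1) - (u - 1)" by simp
  then have "norm (\<zeta> ^ (b\<^sup>2 - 1) - 1) * norm u = norm ((v ^ b - 1) - (u - 1))"
    by (metis left_diff_distrib mult_1 norm_mult)
  also have "\<dots> \<le> norm (v ^ b - 1) + norm (u - 1)" by (rule norm_triangle_ineq4)
  also have "\<dots> \<le> real b * norm (v - 1) + norm (u - 1)" using norm_power_minus_1_le[OF n(2)] by simp
  finally have 1: "1 / real b ^ 2 \<le> real b * norm (v - 1) + norm (u - 1)" using big n by simp
  define \<delta> where "\<delta> = 1 / (real b ^ 2 * (real b + 1))"
  have \<delta>0: "\<delta> \<ge> 0" by (simp add: \<delta>_def)
  have "real b * \<delta> + \<delta> = \<delta> * (real b + 1)" by (simp add: distrib_left mult.commute)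
  also have "\<dots> = 1 / real b ^ 2" using b2 by (simp add: \<delta>_def)
  finally have \<delta>e: "real b * \<delta> + \<delta> = 1 / real b ^ 2" .
  have c: "real b - \<delta>\<^sup>2 / 4 = real b * contraction b"
  proof -
    define y where "y = (real b + 1)\<^sup>2"
    have y: "y > 0" by (simp add: y_def)
    have "\<delta>\<^sup>2 = 1 / (real b ^ 4 * y)"
      by (simp add: \<delta>_def y_def power_divide power_mult_distrib flip: power_mult)
    moreover have "contraction b = 1 - 1 / (4 * (real b * real b ^ 4) * y)"
      by (simp add: contraction_def y_def eval_nat_numeral)
    ultimately show ?thesis using b2 y by (simp add: right_diff_distrib)
  qed
  let ?G = "\<lambda>v :: complex. norm (\<Sum>a<b. v ^ a)"
  have 2: "?G u * ?G v \<le> real b ^ 2 * contraction b"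
  proof (cases "\<delta> \<le> norm (u - 1)")
    case True
    then have "?G u * ?G v \<le> (real b * contraction b) * real b"
      using norm_geometric_sum_le[OF b2 n(1) \<delta>0 True] norm_geometric_sum_trivial[OF n(2)] c contraction_bounds
      by (intro mult_mono) auto
    then show ?thesis by (simp add: power2_eq_square mult_ac)
  next
    case False
    have "\<delta> \<le> norm (v - 1)"
    proof (rule ccontr)
      assume "\<not> \<delta> \<le> norm (v - 1)"
      then have "real b * norm (v - 1) \<le> real b * \<delta>" by (intro mult_left_mono) auto
      then show False using 1 False \<delta>e by linarith
    qed
    then have "?G u * ?G v \<le> real b * (real b * contraction b)"
      using norm_geometric_sum_le[OF b2 n(2) \<delta>0] norm_geometric_sum_trivial[OF n(1)] c
      by (intro mult_mono) auto
    then show ?thesis by (simp add: power2_eq_square mult_ac)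
  qed
  have "pal_exp_sum b (k + 2) \<zeta> = (\<Sum>a<b. u ^ a) * ((\<Sum>a<b. v ^ a) * pal_exp_sum b k (\<zeta> ^ b ^ 2))"
  proof -
    have e: "2 * Suc k + 2 = 2 * k + 4" "Suc (Suc k) = k + 2" by simp_all
    have "pal_exp_sum b (k + 2) \<zeta> = (\<Sum>a<b. u ^ a) * pal_exp_sum b (Suc k) (\<zeta> ^ b)"
      using pal_exp_sum_Suc[of "Suc k" \<zeta>] unfolding e u_def .
    also have "pal_exp_sum b (Suc k) (\<zeta> ^ b) = (\<Sum>a<b. v ^ a) * pal_exp_sum b k ((\<zeta> ^ b) ^ b)"
      unfolding v_def by (rule pal_exp_sum_Suc)
    also have "(\<zeta> ^ b) ^ b = \<zeta> ^ b ^ 2" by (simp add: power2_eq_square power_mult)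
    finally show ?thesis .
  qed
  then have "norm (pal_exp_sum b (k + 2) \<zeta>) = (?G u * ?G v) * norm (pal_exp_sum b k (\<zeta> ^ b ^ 2))"
    by (simp add: norm_mult)
  also have "\<dots> \<le> real b ^ 2 * contraction b * norm (pal_exp_sum b k (\<zeta> ^ b ^ 2))"
    using 2 by (intro mult_right_mono) auto
  finally show ?thesis .
qed

lemma oscillating_power:
  assumes "oscillating b q \<zeta>" "coprime q b"
  shows "oscillating b q (\<zeta> ^ b ^ j)"
proof -
  define \<omega> where "\<omega> = \<zeta> ^ (b ^ 3 - b)"
  have e: "(\<zeta> ^ b ^ j) ^ (b ^ 3 - b) = \<omega> ^ b ^ j"
    by (simp add: \<omega>_def mult.commute flip: power_mult)
  have w: "\<omega> \<noteq> 1" "\<omega> ^ q = 1" using assms(1) by (simp_all add: oscillating_def \<omega>_def)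
  have "coprime q (b ^ j)" using assms(2) by simp
  then have "\<omega> ^ b ^ j \<noteq> 1" using power_eq_1_coprime w by blast
  moreover have "(\<omega> ^ b ^ j) ^ q = (\<omega> ^ q) ^ b ^ j" by (simp add: mult.commute flip: power_mult)
  moreover have "norm (\<zeta> ^ b ^ j) = 1" using assms(1) by (simp add: oscillating_def norm_power)
  ultimately show ?thesis unfolding oscillating_def e using w by simp
qed

text \<open>
  The power \<open>\<omega> = \<zeta>^(b^3 - b)\<close> is a \<open>q\<close>-th root of unity at distance at least \<open>1 / q\<close> from 1, and the
  distance grows by the factor \<open>3 / 2\<close> at every step as long as it is below \<open>1 / b^2\<close>.
\<close>
lemma oscillating_imp_large_difference:
  assumes osc: "oscillating b q \<zeta>" and q: "q > 0" and w: "real q \<le> (3 / 2) ^ w"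
  shows "\<exists>i\<le>w + 1. 1 / real b ^ 2 \<le> norm ((\<zeta> ^ b ^ i) ^ (b\<^sup>2 - 1) - 1)"
proof (rule ccontr)
  assume "\<not> ?thesis"
  then have small: "norm ((\<zeta> ^ b ^ i) ^ (b\<^sup>2 - 1) - 1) < 1 / real b ^ 2" if "i \<le> w + 1" for i
    using that by (meson not_le)
  define \<omega> where "\<omega> = \<zeta> ^ (b ^ 3 - b)"
  have n: "norm \<zeta> = 1" "norm \<omega> = 1" using osc by (auto simp: oscillating_def \<omega>_def norm_power)
  have e: "(\<zeta> ^ b ^ (i + 1)) ^ (b\<^sup>2 - 1) = \<omega> ^ b ^ i" for i
  proof -
    have "b ^ 3 - b = b * (b\<^sup>2 - 1)" by (simp add: eval_nat_numeral diff_mult_distrib2)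
    then show ?thesis by (simp add: \<omega>_def mult_ac flip: power_mult)
  qed
  have grow: "(3 / 2) ^ i * norm (\<omega> - 1) \<le> norm (\<omega> ^ b ^ i - 1)" if "i \<le> w" for i
    using that
  proof (induction i)
    case (Suc i)
    have "norm (\<omega> ^ b ^ i - 1) < 1 / real b ^ 2" using small[of "i + 1"] e[of i] Suc.prems by simp
    then have "3 / 2 * norm (\<omega> ^ b ^ i - 1) \<le> norm ((\<omega> ^ b ^ i) ^ b - 1)"
      using n by (intro norm_power_minus_1_growth[OF b2]) (auto simp: norm_power)
    moreover have "(3 / 2) * ((3 / 2) ^ i * norm (\<omega> - 1)) \<le> 3 / 2 * norm (\<omega> ^ b ^ i - 1)"
      using Suc by (intro mult_left_mono) auto
    ultimately have "(3 / 2) * ((3 / 2) ^ i * norm (\<omega> - 1)) \<le> norm ((\<omega> ^ b ^ i) ^ b - 1)"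
      by (rule order.trans[rotated])
    moreover have "(\<omega> ^ b ^ i) ^ b = \<omega> ^ b ^ Suc i" by (simp add: mult.commute[of b] flip: power_mult)
    ultimately show ?case by (simp only: power_Suc mult.assoc)
  qed simp
  have "1 / real q \<le> norm (\<omega> - 1)"
    using osc q n by (intro norm_root_of_unity_minus_1_ge) (auto simp: oscillating_def \<omega>_def)
  then have "1 \<le> real q * norm (\<omega> - 1)" using q by (simp add: field_simps)
  also have "\<dots> \<le> (3 / 2) ^ w * norm (\<omega> - 1)" using w by (intro mult_right_mono) auto
  also have "\<dots> \<le> norm (\<omega> ^ b ^ w - 1)" using grow by simp
  also have "\<dots> < 1 / real b ^ 2" using small[of "w + 1"] e[of w] by simp
  also have "\<dots> \<le> 1" using b2 by (simp add: one_le_power)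
  finally show False by simp
qed

lemma norm_pal_exp_sum_window:
  assumes osc: "oscillating b q \<zeta>" and q: "q > 0" and w: "real q \<le> (3 / 2) ^ w"
  shows "norm (pal_exp_sum b (k + (w + 3)) \<zeta>)
    \<le> real b ^ (w + 3) * contraction b * norm (pal_exp_sum b k (\<zeta> ^ b ^ (w + 3)))"
proof -
  obtain i where i: "i \<le> w + 1" "1 / real b ^ 2 \<le> norm ((\<zeta> ^ b ^ i) ^ (b\<^sup>2 - 1) - 1)"
    using oscillating_imp_large_difference[OF assms] by blast
  define j where "j = w + 1 - i"
  have w3: "k + (w + 3) = (k + j + 2) + i" "w + 3 = i + 2 + j" using i by (auto simp: j_def)
  have n: "norm \<zeta> = 1" using osc by (simp add: oscillating_def)
  have p: "((\<zeta> ^ b ^ i) ^ b ^ 2) ^ b ^ j = \<zeta> ^ b ^ (w + 3)"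
    unfolding w3(2) by (simp only: power_add power_mult)
  have "norm (pal_exp_sum b (k + (w + 3)) \<zeta>) \<le> real b ^ i * norm (pal_exp_sum b (k + j + 2) (\<zeta> ^ b ^ i))"
    unfolding w3(1) by (rule norm_pal_exp_sum_drop[OF n])
  also have "\<dots> \<le> real b ^ i * (real b ^ 2 * contraction b * norm (pal_exp_sum b (k + j) ((\<zeta> ^ b ^ i) ^ b ^ 2)))"
    using n i by (intro mult_left_mono norm_pal_exp_sum_two_steps) (auto simp: norm_power)
  also have "\<dots> \<le> real b ^ i * (real b ^ 2 * contraction b * (real b ^ j * norm (pal_exp_sum b k (((\<zeta> ^ b ^ i) ^ b ^ 2) ^ b ^ j))))"
    using n contraction_bounds by (intro mult_left_mono norm_pal_exp_sum_drop) (auto simp: norm_power)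
  also have "\<dots> = real b ^ (w + 3) * contraction b * norm (pal_exp_sum b k (\<zeta> ^ b ^ (w + 3)))"
    unfolding p unfolding w3(2) by (simp only: power_add mult_ac)
  finally show ?thesis .
qed

lemma norm_pal_exp_sum_le:
  assumes osc: "oscillating b q \<zeta>" and q: "q > 0" "coprime q b" and w: "real q \<le> (3 / 2) ^ w"
  shows "norm (pal_exp_sum b k \<zeta>) \<le> real b ^ (k + 1) * contraction b ^ (k div (w + 3))"
  using osc
proof (induction k arbitrary: \<zeta> rule: less_induct)
  case (less k)
  have n: "norm \<zeta> = 1" using less.prems by (simp add: oscillating_def)
  show ?case
  proof (cases "k < w + 3")
    case True
    have "norm (pal_exp_sum b k \<zeta>) \<le> (\<Sum>p\<in>pal b k. norm (\<zeta> ^ p))" unfolding pal_exp_sum_def by (rule norm_sum)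
    also have "\<dots> = real b ^ (k + 1)" using n by (simp add: norm_power card_pal[OF b2])
    finally show ?thesis using True by simp
  next
    case False
    define k' where "k' = k - (w + 3)"
    have k: "k = k' + (w + 3)" using False by (simp add: k'_def)
    have "norm (pal_exp_sum b k \<zeta>) \<le> real b ^ (w + 3) * contraction b * norm (pal_exp_sum b k' (\<zeta> ^ b ^ (w + 3)))"
      unfolding k by (rule norm_pal_exp_sum_window[OF less.prems q(1) w])
    also have "\<dots> \<le> real b ^ (w + 3) * contraction b * (real b ^ (k' + 1) * contraction b ^ (k' div (w + 3)))"
      using contraction_bounds k oscillating_power[OF less.prems q(2)]
      by (intro mult_left_mono less.IH) auto
    also have "\<dots> = real b ^ (k + 1) * contraction b ^ (k div (w + 3))"
    proof -
      have "k + 1 = (w + 3) + (k' + 1)" "k div (w + 3) = Suc (k' div (w + 3))" using k by simp_all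
      then show ?thesis by (simp only: power_add power_Suc mult_ac)
    qed
    finally show ?thesis .
  qed
qed

text \<open>
  From \<open>i\<close> to \<open>i + 1\<close> the first factor grows at least by 2, and the second shrinks at most by 1/2.
\<close>
lemma power_times_contraction_mono:
  "i \<le> k \<Longrightarrow> real b ^ i * contraction b ^ (i div W) \<le> real b ^ k * contraction b ^ (k div W)"
proof (induction k)
  case (Suc k)
  have "real b ^ k * contraction b ^ (k div W) \<le> real b ^ Suc k * contraction b ^ (Suc k div W)"
  proof -
    have c: "1 / 2 \<le> contraction b" "contraction b < 1" by (rule contraction_bounds)+
    have "Suc k div W \<le> k div W + 1" by (simp add: div_Suc)
    then have "contraction b ^ (k div W + 1) \<le> contraction b ^ (Suc k div W)"
      using c by (intro power_decreasing) auto
    moreover have "1 / 2 * contraction b ^ (k div W) \<le> contraction b * contraction b ^ (k div W)"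
      using c by (intro mult_right_mono) auto
    ultimately have "1 / 2 * contraction b ^ (k div W) \<le> contraction b ^ (Suc k div W)" by simp
    then have "real b ^ Suc k * (1 / 2 * contraction b ^ (k div W)) \<le> real b ^ Suc k * contraction b ^ (Suc k div W)"
      by (intro mult_left_mono) auto
    moreover have "2 * (real b ^ k * contraction b ^ (k div W)) \<le> real b * (real b ^ k * contraction b ^ (k div W))"
      using b2 c by (intro mult_right_mono) auto
    ultimately show ?thesis by simp
  qed
  then show ?case using Suc by (cases "i = Suc k") auto
qed simp

text \<open>
  The condition \<open>n \<le> X\<close> is resolved digit by digit from the top. For all values of the leading digit
  but one, the inner palindrome is unrestricted or excluded; the remaining value leads to a
  condition of the same kind on the inner palindrome.
\<close>
lemma norm_truncated_pal_exp_sum_le_aux: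
  assumes q: "q > 0" "coprime q b" and w: "real q \<le> (3 / 2) ^ w" and osc: "oscillating b q \<zeta>"
  shows "norm (\<Sum>n\<in>{n \<in> pal b k. n \<le> X}. \<zeta> ^ n)
    \<le> real b + (\<Sum>i<k. real b * (real b ^ (i + 1) * contraction b ^ (i div (w + 3))))"
  using osc
proof (induction k arbitrary: \<zeta> X)
  case 0
  then have n: "norm \<zeta> = 1" by (simp add: oscillating_def)
  have "norm (\<Sum>n\<in>{n \<in> pal b 0. n \<le> X}. \<zeta> ^ n) \<le> (\<Sum>n\<in>{n \<in> pal b 0. n \<le> X}. norm (\<zeta> ^ n))"
    by (rule norm_sum)
  also have "\<dots> = real (card {n \<in> pal b 0. n \<le> X})" using n by (simp add: norm_power)
  also have "card {n \<in> pal b 0. n \<le> X} \<le> card {..<b}" by (intro card_mono) auto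
  finally show ?case by simp
next
  case (Suc k)
  have n: "norm \<zeta> = 1" using Suc.prems by (simp add: oscillating_def)
  have osc: "oscillating b q (\<zeta> ^ b)" using oscillating_power[OF Suc.prems q(2), of 1] by simp
  define T where "T = real b + (\<Sum>i<k. real b * (real b ^ (i + 1) * contraction b ^ (i div (w + 3))))"
  define B where "B = real b ^ (k + 1) * contraction b ^ (k div (w + 3))"
  have c0: "contraction b \<ge> 0" using contraction_bounds by linarith
  have T0: "T \<ge> 0" "B \<ge> 0" unfolding T_def B_def using c0 by (auto intro!: add_nonneg_nonneg sum_nonneg)
  define N where "N = b ^ (2 * k + 2)"
  have less: "a + b * p < N" if "a < b" "p \<in> pal b k" for a p
    using add_mult_less[OF that(1) pal_less[OF b2 that(2)]] by (simp add: N_def)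
  have N0: "N > 0" using b2 by (simp add: N_def)
  define c where "c a = (\<Sum>p\<in>{p \<in> pal b k. a * (1 + N) + b * p \<le> X}. (\<zeta> ^ b) ^ p)" for a
  have c_le: "norm (c a) \<le> B + (if a = X div N then T else 0)" if a: "a < b" for a
  proof -
    \<comment> \<open>All inner palindromes are admitted, none is, or the condition passes to the inner palindrome.\<close>
    consider "a < X div N" | "a > X div N" | "a = X div N" by linarith
    then show ?thesis
    proof cases
      case 1
      have "{p \<in> pal b k. a * (1 + N) + b * p \<le> X} = pal b k"
      proof -
        have "a * (1 + N) + b * p \<le> X" if "p \<in> pal b k" for p
        proof -
          have "a * (1 + N) + b * p \<le> (a + 1) * N" using less[OF a that] by simp
          also have "\<dots> \<le> (X div N) * N" using 1 by (intro mult_right_mono) auto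
          also have "\<dots> \<le> X" by simp
          finally show ?thesis .
        qed
        then show ?thesis by auto
      qed
      then have "c a = pal_exp_sum b k (\<zeta> ^ b)" by (simp add: c_def pal_exp_sum_def)
      then show ?thesis using norm_pal_exp_sum_le[OF osc q w, of k] T0 1 by (simp add: B_def)
    next
      case 2
      have "X < (X div N + 1) * N" using dividend_less_div_times[OF N0, of X] by simp
      also have "\<dots> \<le> a * N" using 2 by (intro mult_right_mono) auto
      finally have "{p \<in> pal b k. a * (1 + N) + b * p \<le> X} = {}" by auto
      then have "c a = 0" unfolding c_def by (simp only: sum.empty)
      then show ?thesis using T0 by simp
    next
      case 3
      have iff: "a * (1 + N) + b * p \<le> X \<longleftrightarrow> a + b * p \<le> X mod N" for p
      proof -
        have "X = a * N + X mod N" using 3 by simp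
        moreover have "a * (1 + N) + b * p = a * N + (a + b * p)" by simp
        ultimately show ?thesis by linarith
      qed
      have "norm (c a) \<le> T"
      proof (cases "a \<le> X mod N")
        case True
        then have "{p \<in> pal b k. a * (1 + N) + b * p \<le> X} = {p \<in> pal b k. p \<le> (X mod N - a) div b}"
          unfolding iff using b2 by (auto simp: less_eq_div_iff_mult_less_eq mult.commute)
        then show ?thesis unfolding c_def T_def using Suc.IH[OF osc] by simp
      next
        case False
        then have "{p \<in> pal b k. a * (1 + N) + b * p \<le> X} = {}" unfolding iff by auto
        then have "c a = 0" unfolding c_def by (simp only: sum.empty)
        then show ?thesis using T0 by simp
      qed
      then show ?thesis using 3 T0 by simp
    qed
  qed
  have "(\<Sum>n\<in>{n \<in> pal b (Suc k). n \<le> X}. \<zeta> ^ n) = (\<Sum>n\<in>pal b (Suc k). if n \<le> X then \<zeta> ^ n else 0)"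
    using b2 by (intro sum.inter_filter) simp
  also have "\<dots> = (\<Sum>a<b. \<Sum>p\<in>pal b k. if a * (1 + N) + b * p \<le> X then \<zeta> ^ (a * (1 + N) + b * p) else 0)"
    unfolding sum_pal_Suc[OF b2] N_def ..
  also have "\<dots> = (\<Sum>a<b. \<zeta> ^ (a * (1 + N)) * c a)"
    using b2 by (intro sum.cong refl)
      (simp add: c_def sum.inter_filter sum_distrib_left power_add power_mult if_distrib cong: if_cong)
  finally have "norm (\<Sum>n\<in>{n \<in> pal b (Suc k). n \<le> X}. \<zeta> ^ n) = norm (\<Sum>a<b. \<zeta> ^ (a * (1 + N)) * c a)" by simp
  also have "\<dots> \<le> (\<Sum>a<b. norm (c a))"
    using n by (intro order.trans[OF norm_sum] sum_mono) (simp add: norm_mult norm_power)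
  also have "\<dots> \<le> (\<Sum>a<b. B + (if a = X div N then T else 0))" using c_le by (intro sum_mono) auto
  also have "\<dots> \<le> real b * B + T" using T0 by (simp add: sum.distrib)
  also have "\<dots> = real b + (\<Sum>i<Suc k. real b * (real b ^ (i + 1) * contraction b ^ (i div (w + 3))))"
    by (simp add: T_def B_def)
  finally show ?case .
qed

lemma norm_truncated_pal_exp_sum_le:
  assumes q: "q > 0" "coprime q b" and w: "real q \<le> (3 / 2) ^ w" and osc: "oscillating b q \<zeta>"
  shows "norm (\<Sum>n\<in>{n \<in> pal b k. n \<le> X}. \<zeta> ^ n)
    \<le> real (k + 1) * (real b ^ (k + 2) * contraction b ^ (k div (w + 3)))"
proof -
  define Y where "Y = real b ^ k * contraction b ^ (k div (w + 3))"
  have "real b + (\<Sum>i<k. real b * (real b ^ (i + 1) * contraction b ^ (i div (w + 3))))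
      \<le> real b * real b * Y + (\<Sum>i<k. real b * real b * Y)"
  proof (rule add_mono)
    have "1 \<le> Y" using power_times_contraction_mono[of 0 k "w + 3"] by (simp add: Y_def)
    then have "real b * 1 \<le> real b * Y" by (intro mult_left_mono) auto
    also have "\<dots> \<le> real b * (real b * Y)" using b2 \<open>1 \<le> Y\<close> by (intro mult_left_mono) auto
    finally show "real b \<le> real b * real b * Y" by simp
    show "(\<Sum>i<k. real b * (real b ^ (i + 1) * contraction b ^ (i div (w + 3)))) \<le> (\<Sum>i<k. real b * real b * Y)"
    proof (rule sum_mono)
      fix i assume "i \<in> {..<k}"
      then have "real b ^ i * contraction b ^ (i div (w + 3)) \<le> Y"
        unfolding Y_def by (intro power_times_contraction_mono) auto
      then have "real b * real b * (real b ^ i * contraction b ^ (i div (w + 3))) \<le> real b * real b * Y"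
        by (intro mult_left_mono) auto
      then show "real b * (real b ^ (i + 1) * contraction b ^ (i div (w + 3))) \<le> real b * real b * Y"
        by (simp add: mult_ac)
    qed
  qed
  also have "\<dots> = real (k + 1) * (real b ^ (k + 2) * contraction b ^ (k div (w + 3)))"
    by (simp add: Y_def algebra_simps)
  finally show ?thesis using norm_truncated_pal_exp_sum_le_aux[OF assms, of k X] by linarith
qed

lemma coprime_indicator_fourier:
  fixes n m :: nat
  assumes m: "m > 0"
  shows "(if coprime n m then 1 else 0 :: complex) =
    (\<Sum>v\<in>{v. v < m \<and> coprime v m}. 1 / of_nat m * (\<Sum>r<m. unit_exp (real r * (real_of_int (int n - int v) / real m))))"
proof -
  have "(\<Sum>v\<in>{v. v < m \<and> coprime v m}. 1 / of_nat m * (\<Sum>r<m. unit_exp (real r * (real_of_int (int n - int v) / real m))))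
    = (\<Sum>v\<in>{v. v < m \<and> coprime v m}. if n mod m = v then 1 else 0 :: complex)"
  proof (rule sum.cong[OF refl])
    fix v assume v: "v \<in> {v. v < m \<and> coprime v m}"
    have "int m dvd int n - int v \<longleftrightarrow> int n mod int m = int v mod int m" by (rule mod_eq_dvd_iff[symmetric])
    also have "\<dots> \<longleftrightarrow> n mod m = v" using v by (simp flip: of_nat_mod)
    finally show "1 / of_nat m * (\<Sum>r<m. unit_exp (real r * (real_of_int (int n - int v) / real m))) = (if n mod m = v then 1 else 0)"
      unfolding sum_unit_exp[OF m] using m by simp
  qed
  also have "\<dots> = (if coprime n m then 1 else 0)"
    using m by (simp add: sum.delta)
  finally show ?thesis by simp
qed

text \<open>
  The condition of being coprime to \<open>m = b^3 - b\<close> is periodic modulo \<open>m\<close>, and \<open>q\<close> is coprime to \<open>m\<close>, so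
  expanding both conditions into exponentials leaves, beyond the main term, oscillating
  frequencies only.
\<close>
lemma equidistribution_mod:
  assumes q: "q > 0" "coprime q (b ^ 3 - b)" and w: "real q \<le> (3 / 2) ^ w"
  shows "\<bar>real (card {n \<in> pal b k. coprime n (b ^ 3 - b) \<and> n \<le> X \<and> q dvd n})
       - real (card {n \<in> pal b k. coprime n (b ^ 3 - b) \<and> n \<le> X}) / real q\<bar>
    \<le> real (b ^ 3 - b) * (real (k + 1) * (real b ^ (k + 2) * contraction b ^ (k div (w + 3))))"
proof -
  define m where "m = b ^ 3 - b"
  have m0: "m > 0" unfolding m_def by (rule dvd_cube_minus(3)[OF b2])
  have bm: "b dvd m" unfolding m_def by (rule dvd_cube_minus(1)[OF b2])
  have qb: "coprime q b" using q(2) bm unfolding m_def[symmetric] by (meson coprime_divisors dvd_refl)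
  define A where "A = {n \<in> pal b k. n \<le> X}"
  have finA: "finite A" using b2 by (simp add: A_def)
  define V where "V = {v. v < m \<and> coprime v m}"
  have V: "finite V" "card V \<le> m"
  proof -
    have "V \<subseteq> {..<m}" by (auto simp: V_def)
    then show "finite V" "card V \<le> m" using finite_subset card_mono[of "{..<m}" V] by auto
  qed
  define T where "T = real (k + 1) * (real b ^ (k + 2) * contraction b ^ (k div (w + 3)))"
  define S where "S h r = (\<Sum>n\<in>A. unit_exp (real h / real q + real r / real m) ^ n)" for h r :: nat
  have S_le: "norm (S h r) \<le> T" if h: "0 < h" "h < q" for h r
  proof -
    define \<zeta> where "\<zeta> = unit_exp (real h / real q + real r / real m)"
    have zm: "\<zeta> ^ m = unit_exp (real (h * m) / real q)"
    proof -
      have "\<zeta> ^ m = unit_exp (real m * (real h / real q + real r / real m))"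
        unfolding \<zeta>_def by (rule unit_exp_of_nat_mult[symmetric])
      also have "real m * (real h / real q + real r / real m) = real (h * m) / real q + real r"
        using m0 by (simp add: distrib_left mult.commute)
      also have "unit_exp \<dots> = unit_exp (real (h * m) / real q)"
        unfolding unit_exp_add by (simp add: unit_exp_int)
      finally show ?thesis .
    qed
    have "\<zeta> ^ m \<noteq> 1"
    proof
      assume "\<zeta> ^ m = 1"
      then have "real (h * m) / real q \<in> \<int>" unfolding zm by (rule unit_exp_eq_1)
      then obtain j :: int where "real (h * m) / real q = real_of_int j" by (elim Ints_cases)
      then have "real_of_int (int (h * m)) = real_of_int (int q * j)" using q(1) by (simp add: field_simps)
      then have "int (h * m) = int q * j" by (simp only: of_int_eq_iff)
      then have "int q dvd int (h * m)" by simp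
      then have "q dvd h * m" by (simp only: int_dvd_int_iff)
      then have "q dvd h" using q(2) by (simp add: m_def coprime_dvd_mult_left_iff)
      then show False using h by (simp add: nat_dvd_not_less)
    qed
    moreover have "(\<zeta> ^ m) ^ q = 1"
    proof -
      have "(\<zeta> ^ m) ^ q = unit_exp (real q * (real (h * m) / real q))"
        unfolding zm by (rule unit_exp_of_nat_mult[symmetric])
      also have "real q * (real (h * m) / real q) = real (h * m)" using q(1) by simp
      finally show ?thesis by (simp add: unit_exp_int del: of_nat_mult)
    qed
    ultimately have "oscillating b q \<zeta>" by (simp add: oscillating_def m_def \<zeta>_def)
    then have "norm (\<Sum>n\<in>{n \<in> pal b k. n \<le> X}. \<zeta> ^ n) \<le> T" unfolding T_def
      by (rule norm_truncated_pal_exp_sum_le[OF q(1) qb w])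
    then show ?thesis unfolding S_def A_def \<zeta>_def .
  qed
  have T0: "T \<ge> 0" unfolding T_def using contraction_bounds by simp
  define co where "co n = (if coprime n m then 1 else 0 :: complex)" for n
  have q_ind: "(if q dvd n then 1 else 0 :: complex) - 1 / of_nat q =
      1 / of_nat q * (\<Sum>h\<in>{1..<q}. unit_exp (real h / real q) ^ n)" for n
  proof -
    have "(\<Sum>h<q. unit_exp (real h * (real_of_int (int n) / real q))) = (if q dvd n then of_nat q else 0)"
      unfolding sum_unit_exp[OF q(1)] by (simp only: int_dvd_int_iff)
    moreover have "unit_exp (real h * (real_of_int (int n) / real q)) = unit_exp (real h / real q) ^ n" for h
      unfolding unit_exp_of_nat_mult[symmetric] by (simp add: mult.commute)
    moreover have "{..<q} = insert 0 {1..<q}" using q(1) by auto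
    ultimately have "1 + (\<Sum>h\<in>{1..<q}. unit_exp (real h / real q) ^ n) = (if q dvd n then of_nat q else 0)"
      by simp
    then have "(\<Sum>h\<in>{1..<q}. unit_exp (real h / real q) ^ n) = (if q dvd n then of_nat q else 0) - 1"
      by (simp add: algebra_simps)
    then show ?thesis using q(1) by (simp add: diff_divide_distrib)
  qed
  have inner: "(\<Sum>n\<in>A. co n * unit_exp (real h / real q) ^ n) =
      (\<Sum>v\<in>V. 1 / of_nat m * (\<Sum>r<m. unit_exp (- (real r * real v / real m)) * S h r))" for h
  proof -
    have pt: "unit_exp (real r * (real_of_int (int n - int v) / real m)) * unit_exp (real h / real q) ^ n =
      unit_exp (- (real r * real v / real m)) * unit_exp (real h / real q + real r / real m) ^ n" for n r v
      unfolding unit_exp_of_nat_mult[symmetric] unit_exp_add[symmetric]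
      by (rule arg_cong[of _ _ unit_exp]) (simp add: diff_divide_distrib right_diff_distrib distrib_left mult_ac)
    have swap: "(\<Sum>n\<in>A. \<Sum>v\<in>V. c * (\<Sum>r<m. X n v r)) = (\<Sum>v\<in>V. c * (\<Sum>r<m. \<Sum>n\<in>A. X n v r))"
      for c :: complex and X
    proof -
      have "(\<Sum>n\<in>A. \<Sum>v\<in>V. c * (\<Sum>r<m. X n v r)) = (\<Sum>v\<in>V. \<Sum>n\<in>A. c * (\<Sum>r<m. X n v r))"
        by (rule sum.swap)
      also have "\<dots> = (\<Sum>v\<in>V. c * (\<Sum>n\<in>A. \<Sum>r<m. X n v r))" by (simp add: sum_distrib_left)
      also have "\<dots> = (\<Sum>v\<in>V. c * (\<Sum>r<m. \<Sum>n\<in>A. X n v r))"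
        by (intro sum.cong refl arg_cong2[of _ _ _ _ "(*)"] sum.swap)
      finally show ?thesis .
    qed
    have "(\<Sum>n\<in>A. co n * unit_exp (real h / real q) ^ n) =
      (\<Sum>n\<in>A. \<Sum>v\<in>V. 1 / of_nat m * (\<Sum>r<m. unit_exp (real r * (real_of_int (int n - int v) / real m)) * unit_exp (real h / real q) ^ n))"
      unfolding co_def coprime_indicator_fourier[OF m0] V_def[symmetric] sum_distrib_right mult.assoc ..
    also have "\<dots> = (\<Sum>v\<in>V. 1 / of_nat m * (\<Sum>r<m. \<Sum>n\<in>A. unit_exp (- (real r * real v / real m)) * unit_exp (real h / real q + real r / real m) ^ n))"
      unfolding pt by (rule swap)
    finally show ?thesis unfolding S_def by (simp only: sum_distrib_left)
  qed
  have inner_le: "norm (\<Sum>n\<in>A. co n * unit_exp (real h / real q) ^ n) \<le> real m * T" if h: "h \<in> {1..<q}" for h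
  proof -
    have "norm (\<Sum>n\<in>A. co n * unit_exp (real h / real q) ^ n) \<le> (\<Sum>v\<in>V. T)"
      unfolding inner
    proof (rule order.trans[OF norm_sum], rule sum_mono)
      fix v
      have "norm (\<Sum>r<m. unit_exp (- (real r * real v / real m)) * S h r) \<le> (\<Sum>r<m. T)"
        using S_le h by (intro order.trans[OF norm_sum] sum_mono) (simp add: norm_mult)
      then show "norm (1 / of_nat m * (\<Sum>r<m. unit_exp (- (real r * real v / real m)) * S h r)) \<le> T"
        using m0 by (simp add: norm_mult norm_divide field_simps)
    qed
    also have "\<dots> = real (card V) * T" by simp
    also have "\<dots> \<le> real m * T" using V(2) T0 by (intro mult_right_mono) auto
    finally show ?thesis .
  qed
  have "(of_nat (card {n \<in> pal b k. coprime n m \<and> n \<le> X \<and> q dvd n}) :: complex)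
      - of_nat (card {n \<in> pal b k. coprime n m \<and> n \<le> X}) / of_nat q
    = (\<Sum>n\<in>A. co n * ((if q dvd n then 1 else 0) - 1 / of_nat q))"
  proof -
    have 1: "of_nat (card {n \<in> A. P n}) = (\<Sum>n\<in>A. if P n then 1 else 0 :: complex)" for P
      using finA by (simp add: sum.If_cases Int_def)
    have 2: "{n \<in> pal b k. coprime n m \<and> n \<le> X \<and> q dvd n} = {n \<in> A. coprime n m \<and> q dvd n}"
      "{n \<in> pal b k. coprime n m \<and> n \<le> X} = {n \<in> A. coprime n m}" by (auto simp: A_def)
    show ?thesis unfolding 2 1 sum_divide_distrib sum_subtractf[symmetric]
      by (intro sum.cong refl) (simp add: co_def)
  qed
  also have "\<dots> = 1 / of_nat q * (\<Sum>h\<in>{1..<q}. \<Sum>n\<in>A. co n * unit_exp (real h / real q) ^ n)"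
    unfolding q_ind by (simp only: sum_distrib_left mult.left_commute[of "co _"]) (rule sum.swap)
  finally have eq: "(of_nat (card {n \<in> pal b k. coprime n m \<and> n \<le> X \<and> q dvd n}) :: complex)
      - of_nat (card {n \<in> pal b k. coprime n m \<and> n \<le> X}) / of_nat q
    = 1 / of_nat q * (\<Sum>h\<in>{1..<q}. \<Sum>n\<in>A. co n * unit_exp (real h / real q) ^ n)" .
  have "\<bar>real (card {n \<in> pal b k. coprime n m \<and> n \<le> X \<and> q dvd n})
       - real (card {n \<in> pal b k. coprime n m \<and> n \<le> X}) / real q\<bar>
    = norm (complex_of_real (real (card {n \<in> pal b k. coprime n m \<and> n \<le> X \<and> q dvd n})
       - real (card {n \<in> pal b k. coprime n m \<and> n \<le> X}) / real q))" by (simp only: norm_of_real)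
  also have "\<dots> = norm (1 / of_nat q * (\<Sum>h\<in>{1..<q}. \<Sum>n\<in>A. co n * unit_exp (real h / real q) ^ n))"
    unfolding eq[symmetric] by simp
  also have "\<dots> = 1 / real q * norm (\<Sum>h\<in>{1..<q}. \<Sum>n\<in>A. co n * unit_exp (real h / real q) ^ n)"
    by (simp add: norm_divide norm_mult)
  also have "\<dots> \<le> 1 / real q * (\<Sum>h\<in>{1..<q}. real m * T)"
    by (intro mult_left_mono order.trans[OF norm_sum] sum_mono[OF inner_le]) auto
  also have "\<dots> \<le> 1 / real q * (real q * (real m * T))"
    using T0 by (intro mult_left_mono) (auto intro!: mult_right_mono)
  also have "\<dots> = real m * T" using q(1) by simp
  finally show ?thesis unfolding m_def T_def .
qed

end

section \<open>Palindromes divisible by a square: average over a window\<close>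

text \<open>
  The \<open>z'\<close> in question have products \<open>k z'\<close> in one residue class modulo \<open>B\<close>, and these lie below
  \<open>k B\<close>.
\<close>
lemma card_multiples_le:
  fixes B k z :: nat and k' :: int
  assumes "B > 0" "k > 0"
  shows "card {z'. z' < B \<and> int B dvd int k * (int z - int z')} \<le> k"
proof -
  have "inj_on (\<lambda>z'. k * z' div B) {z'. z' < B \<and> int B dvd int k * (int z - int z')}"
  proof (rule inj_onI)
    fix x y
    assume x: "x \<in> {z'. z' < B \<and> int B dvd int k * (int z - int z')}"
      and y: "y \<in> {z'. z' < B \<and> int B dvd int k * (int z - int z')}"
      and e: "k * x div B = k * y div B"
    have "int B dvd int k * (int z - int x) - int k * (int z - int y)"
      using x y by (intro dvd_diff) auto
    then have "int B dvd int (k * y) - int (k * x)" by (simp add: right_diff_distrib)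
    then have "int (k * y) mod int B = int (k * x) mod int B" by (simp add: mod_eq_dvd_iff)
    then have "k * y mod B = k * x mod B" by (metis of_nat_eq_iff of_nat_mod)
    with e have "k * x = k * y" by (metis mult_div_mod_eq)
    then show "x = y" using assms by simp
  qed
  moreover have "(\<lambda>z'. k * z' div B) ` {z'. z' < B \<and> int B dvd int k * (int z - int z')} \<subseteq> {..<k}"
    using assms by (auto simp: less_mult_imp_div_less)
  ultimately have "card {z'. z' < B \<and> int B dvd int k * (int z - int z')} \<le> card {..<k}"
    by (intro card_inj_on_le[of "\<lambda>z'. k * z' div B"]) simp_all
  then show ?thesis by simp
qed

text \<open>
  Parseval's identity in \<open>r\<close>, with the weights \<open>w\<close> bounded trivially. The loss of a factor \<open>|k|\<close> comes
  from the possible common factor of \<open>k\<close> and \<open>B\<close>.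
\<close>
lemma sum_norm_square_exp_le:
  fixes B :: nat and k :: int and w :: "nat \<Rightarrow> complex"
  assumes B: "B > 0" and k: "k \<noteq> 0" and w: "\<And>z. norm (w z) = 1"
  shows "(\<Sum>r<B. (norm (\<Sum>z<B. w z * unit_exp (real_of_int k * (real r * real z / real B))))\<^sup>2)
           \<le> (real B)\<^sup>2 * \<bar>real_of_int k\<bar>"
proof -
  define S where "S r = (\<Sum>z<B. w z * unit_exp (real_of_int k * (real r * real z / real B)))" for r
  have S2: "S r * cnj (S r) = (\<Sum>z<B. \<Sum>z'<B. w z * cnj (w z') *
        unit_exp (real r * (real_of_int (k * (int z - int z')) / real B)))" for r
  proof -
    have "unit_exp (real_of_int k * (real r * real z / real B)) *
        cnj (unit_exp (real_of_int k * (real r * real z' / real B))) =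
        unit_exp (real r * (real_of_int (k * (int z - int z')) / real B))" for z z'
      unfolding unit_exp_diff[symmetric] by (simp add: diff_divide_distrib right_diff_distrib left_diff_distrib mult_ac)
    note this[symmetric]
    then have "w z * unit_exp (real_of_int k * (real r * real z / real B)) *
        cnj (w z' * unit_exp (real_of_int k * (real r * real z' / real B))) =
        w z * cnj (w z') * unit_exp (real r * (real_of_int (k * (int z - int z')) / real B))" for z z'
      unfolding complex_cnj_mult by (simp only: mult_ac)
    then show ?thesis unfolding S_def cnj_sum sum_product by (intro sum.cong refl) simp
  qed
  have "(\<Sum>r<B. (norm (S r))\<^sup>2) = norm (of_real (\<Sum>r<B. (norm (S r))\<^sup>2) :: complex)"
    by (simp only: norm_of_real) (simp add: sum_nonneg)
  also have "of_real (\<Sum>r<B. (norm (S r))\<^sup>2) = (\<Sum>r<B. S r * cnj (S r))"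
    by (simp only: of_real_sum complex_norm_square)
  also have "\<dots> = (\<Sum>z<B. \<Sum>z'<B. w z * cnj (w z') *
        (\<Sum>r<B. unit_exp (real r * (real_of_int (k * (int z - int z')) / real B))))"
    unfolding S2 sum_distrib_left
    by (subst sum.swap, rule sum.cong[OF refl], rule sum.swap)
  also have "norm \<dots> \<le> (\<Sum>z<B. \<Sum>z'<B. norm (w z * cnj (w z') *
        (\<Sum>r<B. unit_exp (real r * (real_of_int (k * (int z - int z')) / real B)))))"
    by (intro order.trans[OF norm_sum] sum_mono norm_sum)
  also have "\<dots> = (\<Sum>z<B. \<Sum>z'<B. if int B dvd k * (int z - int z') then real B else 0)"
    unfolding sum_unit_exp[OF B] by (intro sum.cong refl) (simp add: norm_mult w)
  also have "\<dots> = (\<Sum>z<B. real B * real (card {z'. z' < B \<and> int B dvd k * (int z - int z')}))"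
    by (simp add: sum.If_cases lessThan_def Collect_conj_eq mult.commute)
  also have "\<dots> \<le> (\<Sum>z<B. real B * \<bar>real_of_int k\<bar>)"
  proof (intro sum_mono mult_left_mono)
    fix z
    have "(int B dvd k * (int z - int z')) \<longleftrightarrow> int B dvd int (nat \<bar>k\<bar>) * (int z - int z')" for z'
      by (cases "k \<ge> 0") auto
    then have "card {z'. z' < B \<and> int B dvd k * (int z - int z')} \<le> nat \<bar>k\<bar>"
      using card_multiples_le[OF B, of "nat \<bar>k\<bar>" z] k by simp
    then show "real (card {z'. z' < B \<and> int B dvd k * (int z - int z')}) \<le> \<bar>real_of_int k\<bar>"
      by linarith
  qed simp
  finally show ?thesis unfolding S_def by (simp add: power2_eq_square mult_ac)
qed

lemma cauchy_schwarz_sum_le: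
  fixes f :: "'a \<Rightarrow> real"
  assumes "\<And>x. x \<in> A \<Longrightarrow> f x \<ge> 0" "(\<Sum>x\<in>A. (f x)\<^sup>2) \<le> M" "real (card A) \<le> N"
  shows "sum f A \<le> sqrt (N * M)"
proof -
  have "(\<Sum>x\<in>A. 1 * f x)\<^sup>2 \<le> (\<Sum>x\<in>A. 1\<^sup>2) * (\<Sum>x\<in>A. (f x)\<^sup>2)"
    by (rule Cauchy_Schwarz_ineq_sum)
  also have "\<dots> \<le> N * M" using assms(2,3) by (intro mult_mono) (auto intro: sum_nonneg order.trans)
  finally show ?thesis by (simp add: real_le_rsqrt)
qed

context
  fixes b :: nat
  assumes b2: "b \<ge> 2"
begin

lemma sum_over_inverse_squares_le:
  fixes s :: nat and D0 :: int and \<rho> :: "int \<Rightarrow> nat" and F :: "nat \<Rightarrow> real"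
  defines "D \<equiv> {d \<in> {D0..<D0 + int b ^ s}. coprime d (int b)}"
  assumes \<rho>: "\<And>d. d \<in> D \<Longrightarrow> \<rho> d < b ^ s \<and> int b ^ s dvd int (\<rho> d) * d\<^sup>2 - 1"
    and F: "\<And>r. F r \<ge> 0"
  shows "(\<Sum>d\<in>D. F (\<rho> d)) \<le> 4 * real b * (\<Sum>r<b ^ s. F r)"
proof -
  have fin: "finite D" unfolding D_def by (rule finite_subset[of _ "{D0..<D0 + int b ^ s}"]) auto
  have fiber: "card {d \<in> D. \<rho> d = r} \<le> 4 * b" for r
  proof (rule card_square_roots_le[of b _ D0 s])
    fix x y assume x: "x \<in> {d \<in> D. \<rho> d = r}" and y: "y \<in> {d \<in> D. \<rho> d = r}"
    have 1: "int b ^ s dvd int r * x\<^sup>2 - 1" "int b ^ s dvd int r * y\<^sup>2 - 1" using \<rho>[of x] \<rho>[of y] x y by simp_all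
    have "x\<^sup>2 - y\<^sup>2 = y\<^sup>2 * (int r * x\<^sup>2 - 1) - x\<^sup>2 * (int r * y\<^sup>2 - 1)"
      by (simp add: right_diff_distrib)
    moreover have "int b ^ s dvd y\<^sup>2 * (int r * x\<^sup>2 - 1) - x\<^sup>2 * (int r * y\<^sup>2 - 1)"
      by (intro dvd_diff dvd_mult 1)
    ultimately show "int b ^ s dvd x\<^sup>2 - y\<^sup>2" by simp
  qed (use b2 in \<open>auto simp: D_def\<close>)
  have "(\<Sum>d\<in>D. F (\<rho> d)) = (\<Sum>r<b ^ s. \<Sum>d\<in>{d \<in> D. \<rho> d = r}. F (\<rho> d))"
    using \<rho> fin by (intro sum.group[symmetric]) auto
  also have "\<dots> = (\<Sum>r<b ^ s. real (card {d \<in> D. \<rho> d = r}) * F r)" by simp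
  also have "\<dots> \<le> (\<Sum>r<b ^ s. real (4 * b) * F r)"
    using fiber F by (intro sum_mono mult_right_mono) (auto simp only: of_nat_le_iff)
  finally show ?thesis by (simp add: sum_distrib_left)
qed

lemma exists_inverse_square:
  assumes "coprime d (int b)"
  shows "\<exists>r. r < b ^ s \<and> int b ^ s dvd int r * d\<^sup>2 - 1"
proof -
  have "coprime (d\<^sup>2) (int b ^ s)" using assms by simp
  then obtain x where x: "[d\<^sup>2 * x = 1] (mod int b ^ s)" using cong_solve_coprime_int by blast
  define r where "r = nat (x mod int b ^ s)"
  have "int r = x mod int b ^ s" using b2 by (simp add: r_def)
  then have "[int r = x] (mod int b ^ s)" by (simp add: cong_def)
  then have "[int r * d\<^sup>2 = 1] (mod int b ^ s)"
    using x cong_scalar_right[of "int r" x "int b ^ s" "d\<^sup>2"] by (simp add: mult.commute cong_def)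
  moreover have "r < b ^ s" 
  proof -
    have "int r < int b ^ s" unfolding \<open>int r = x mod int b ^ s\<close> using b2 by (intro pos_mod_bound) simp
    then show ?thesis by (simp flip: of_nat_power)
  qed
  ultimately show ?thesis by (auto simp: cong_iff_dvd_diff)
qed

text \<open>
  Let \<open>e\<close> be the quotient in the divisibility assumption. Modulo \<open>B\<close> it is congruent to \<open>\<rho> (c + z)\<close>, so
  \<open>\<rho> (c + z) / B\<close> agrees with \<open>e / B\<close> up to an integer, while the size of \<open>e / B\<close> is known up to
  \<open>b^L / d^2\<close> from \<open>c\<close>, \<open>z\<close> and \<open>r\<close>. Replacing \<open>d\<close> by \<open>D0\<close> in the coefficient of \<open>r\<close> costs no more than
  that, since \<open>d\<close> and \<open>D0\<close> differ by less than \<open>B\<close>.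
\<close>
lemma near_integer_of_square_dvd:
  fixes D0 d c :: int and s L z y K \<rho> r :: nat
  defines "B \<equiv> b ^ s"
  assumes D0: "2 * int B ^ 2 \<le> D0" and K: "6 * K * int b ^ L \<le> D0\<^sup>2"
    and d: "D0 \<le> d" "d < D0 + int B" and \<rho>: "int B dvd int \<rho> * d\<^sup>2 - 1"
    and z: "z < B" and y: "y < b ^ L" and r: "r < B"
    and dvd: "d\<^sup>2 dvd c + int (z + B * y + B * b ^ L * r)"
  shows "\<exists>n::int. \<bar>real \<rho> * real z / real B - real (b ^ L) / real_of_int (D0\<^sup>2) * real r
    + (real \<rho> * real_of_int c / real B - real_of_int c / (real B * real_of_int (d\<^sup>2))) - n\<bar> * K \<le> 1 / 6"
proof -
  have B0: "B > 0" using b2 by (simp add: B_def)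
  have "1 \<le> int B ^ 2" using B0 by simp
  then have D0p: "D0 > 0" "d > 0" using D0 d by linarith+
  obtain e where e: "c + int (z + B * y + B * b ^ L * r) = d\<^sup>2 * e" using dvd by (elim dvdE)
  have "int B dvd int \<rho> * (c + int z) - e"
  proof -
    have "int \<rho> * (c + int z) - e = int \<rho> * (d\<^sup>2 * e) - e - int \<rho> * int B * (int y + int (b ^ L * r))"
      unfolding e[symmetric] by (simp add: algebra_simps)
    also have "\<dots> = e * (int \<rho> * d\<^sup>2 - 1) - int B * (int \<rho> * (int y + int (b ^ L * r)))"
      by (simp add: right_diff_distrib mult_ac)
    finally show ?thesis using \<rho> by simp
  qed
  then obtain n where n: "int \<rho> * (c + int z) - e = int B * n" by (elim dvdE)
  define d' D' where "d' = real_of_int d" and "D' = real_of_int D0"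
  have pos: "d' > 0" "D' > 0" "real B > 0" using D0p B0 by (auto simp: d'_def D'_def)
  have e': "real_of_int c + (real z + real B * real y + real B * real b ^ L * real r) = d' ^ 2 * real_of_int e"
    using arg_cong[OF e, of real_of_int] by (simp add: d'_def)
  have n': "real \<rho> * (real_of_int c + real z) - real_of_int e = real B * real_of_int n"
    using arg_cong[OF n, of real_of_int] by simp
  have ee: "real_of_int e = (real_of_int c + (real z + real B * real y + real B * real b ^ L * real r)) / d' ^ 2"
    unfolding e' using pos by simp
  have nn: "real_of_int n = (real \<rho> * (real_of_int c + real z) - real_of_int e) / real B"
    unfolding n' using pos by simp
  define lam where "lam = real (b ^ L) / D' ^ 2"
  define u v where "u = (real z + real B * real y) / (real B * d' ^ 2)"
    and "v = real b ^ L * real r * (1 / D' ^ 2 - 1 / d' ^ 2)"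
  \<comment> \<open>The contributions of \<open>c\<close> cancel; \<open>u\<close> and \<open>v\<close> are both between 0 and \<open>lam\<close>.\<close>
  have eq: "real \<rho> * real z / real B - real (b ^ L) / real_of_int (D0\<^sup>2) * real r
    + (real \<rho> * real_of_int c / real B - real_of_int c / (real B * real_of_int (d\<^sup>2))) - n = u - v"
    unfolding nn ee u_def v_def using pos
    by (simp add: D'_def[symmetric] d'_def[symmetric] add_divide_distrib diff_divide_distrib) (simp add: field_simps)
  have Dd: "D' \<le> d'" "d' < D' + real B" using d unfolding d'_def D'_def by linarith+
  have D2: "D' ^ 2 \<le> d' ^ 2" using Dd pos by (intro power_mono) auto
  have "u \<le> lam"
  proof -
    have "z + B * y < B * b ^ L" using add_mult_less[OF z y] .
    then have "real z + real B * real y \<le> real B * real (b ^ L)"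
      by (metis less_imp_le of_nat_add of_nat_le_iff of_nat_mult)
    then have "u \<le> real B * real (b ^ L) / (real B * d' ^ 2)"
      unfolding u_def using pos by (intro divide_right_mono) auto
    also have "\<dots> = real (b ^ L) / d' ^ 2" using pos by simp
    also have "\<dots> \<le> lam" unfolding lam_def using D2 pos by (intro divide_left_mono) auto
    finally show ?thesis .
  qed
  moreover have "v \<le> lam"
  proof -
    have "1 / D' ^ 2 - 1 / d' ^ 2 = (d' - D') * (d' + D') / (D' ^ 2 * d' ^ 2)"
      using pos by (simp add: field_simps power2_eq_square)
    also have "\<dots> \<le> real B * (2 * d') / (D' ^ 2 * d' ^ 2)"
      using Dd pos by (intro divide_right_mono mult_mono) auto
    also have "\<dots> = 2 * real B / d' * (1 / D' ^ 2)" using pos by (simp add: field_simps power2_eq_square)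
    finally have 1: "1 / D' ^ 2 - 1 / d' ^ 2 \<le> 2 * real B / d' * (1 / D' ^ 2)" .
    have "v \<le> real b ^ L * real B * (2 * real B / d' * (1 / D' ^ 2))"
      unfolding v_def using r 1 D2 pos by (intro mult_mono) (auto simp: frac_le)
    also have "\<dots> = lam * (2 * (real B)\<^sup>2 / d')" unfolding lam_def by (simp add: power2_eq_square field_simps)
    also have "\<dots> \<le> lam * 1"
    proof (rule mult_left_mono)
      have "real_of_int (2 * int B ^ 2) \<le> D'" using D0 unfolding D'_def by linarith
      then have "2 * (real B)\<^sup>2 \<le> d'" using Dd by simp
      then show "2 * (real B)\<^sup>2 / d' \<le> 1" using pos by simp
    qed (auto simp: lam_def)
    finally show ?thesis by simp
  qed
  moreover have "u \<ge> 0" "v \<ge> 0" unfolding u_def v_def using D2 pos by (auto simp: frac_le)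
  ultimately have "\<bar>u - v\<bar> * K \<le> lam * K" by (intro mult_right_mono) auto
  also have "\<dots> \<le> 1 / 6"
  proof -
    have "real_of_int (6 * K * int b ^ L) \<le> real_of_int (D0\<^sup>2)" using K by (simp only: of_int_le_iff)
    then have "6 * real K * real (b ^ L) \<le> D' ^ 2" by (simp add: D'_def)
    then show ?thesis unfolding lam_def using pos by (simp add: field_simps)
  qed
  finally show ?thesis using eq by metis
qed

text \<open>
  The heart of the argument. The left-hand side counts pairs of a modulus \<open>d\<close> in a window of length
  \<open>B\<close> and an outer part \<open>z\<close> that can be completed to a multiple of \<open>d^2\<close>. There are \<open>B^2\<close> pairs,
  and the right-hand side saves the factor \<open>K\<close> of the expected density, provided that \<open>K^3\<close> does not
  exceed \<open>B\<close>. Earlier digits enter only through \<open>c\<close>, in which the bound is uniform.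
\<close>
lemma sum_window_le:
  fixes D0 :: int and s L K :: nat and c :: "int \<Rightarrow> int"
  defines "B \<equiv> b ^ s"
  defines "D \<equiv> {d \<in> {D0..<D0 + int B}. coprime d (int b)}"
  assumes D0: "2 * int B ^ 2 \<le> D0" and K: "6 * K * int b ^ L \<le> D0\<^sup>2" and K0: "K > 0"
  shows "(\<Sum>d\<in>D. real (card {z. z < B \<and> (\<exists>y<b ^ L. d\<^sup>2 dvd c d + int (z + B * y + B * b ^ L * rev_digits b s z))}))
    \<le> 4 * (real B ^ 2 / K + sqrt (4 * real b * real B ^ 3 * K))"
proof -
  have B0: "B > 0" using b2 by (simp add: B_def)
  define W where "W d = {z. z < B \<and> (\<exists>y<b ^ L. d\<^sup>2 dvd c d + int (z + B * y + B * b ^ L * rev_digits b s z))}" for d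
  have "\<forall>d\<in>D. \<exists>r. r < B \<and> int B dvd int r * d\<^sup>2 - 1"
    using exists_inverse_square unfolding D_def B_def by simp
  then obtain \<rho> where \<rho>: "\<And>d. d \<in> D \<Longrightarrow> \<rho> d < B \<and> int B dvd int (\<rho> d) * d\<^sup>2 - 1" by metis
  \<comment> \<open>The reference coefficient of the reversed digits, taken at the left end of the window.\<close>
  define \<tau> where "\<tau> = real (b ^ L) / real_of_int (D0\<^sup>2)"
  define t where "t r z = real r * real z / real B - \<tau> * real (rev_digits b s z)" for r z :: nat
  define S where "S k r = norm (\<Sum>z<B. unit_exp (k * t r z))" for k :: real and r
  have finD: "finite D" unfolding D_def by (rule finite_subset[of _ "{D0..<D0 + int B}"]) auto
  have cardD: "real (card D) \<le> real B"
  proof -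
    have "card D \<le> card {D0..<D0 + int B}" unfolding D_def by (intro card_mono) auto
    then show ?thesis by simp
  qed
  have Wle: "real (card (W d)) \<le> 4 / real K ^ 2 * (\<Sum>i<K. \<Sum>j<K. S (real i - real j) (\<rho> d))" if d: "d \<in> D" for d
    unfolding S_def
  proof (rule detect_near_integer[where \<xi> = "real (\<rho> d) * real_of_int (c d) / real B - real_of_int (c d) / (real B * real_of_int (d\<^sup>2))"])
    fix z assume "z \<in> W d"
    then obtain y where zy: "z < B" "y < b ^ L" "d\<^sup>2 dvd c d + int (z + B * y + B * b ^ L * rev_digits b s z)"
      unfolding W_def by blast
    have "D0 \<le> d" "d < D0 + int B" using d by (auto simp: D_def)
    then show "\<exists>n::int. \<bar>t (\<rho> d) z + (real (\<rho> d) * real_of_int (c d) / real B - real_of_int (c d) / (real B * real_of_int (d\<^sup>2))) - n\<bar> * K \<le> 1 / 6"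
      unfolding t_def \<tau>_def
      using D0 K \<rho>[OF d] zy rev_digits_less[OF b2, of s z] unfolding B_def
      by (intro near_integer_of_square_dvd[of s D0 K L d "\<rho> d" z y "rev_digits b s z" "c d"]) simp_all
  qed (use K0 in \<open>auto simp: W_def\<close>)
  \<comment> \<open>Cauchy-Schwarz over the window, then the bounded multiplicity of \<open>\<rho>\<close>, then Parseval.\<close>
  have offdiag: "(\<Sum>d\<in>D. S (real i - real j) (\<rho> d)) \<le> sqrt (4 * real b * real B ^ 3 * K)"
    if ij: "i < K" "j < K" "i \<noteq> j" for i j
  proof -
    define k where "k = int i - int j"
    have k: "k \<noteq> 0" "\<bar>real_of_int k\<bar> \<le> real K" "real i - real j = real_of_int k" using ij by (auto simp: k_def)
    have "S (real i - real j) r = norm (\<Sum>z<B. unit_exp (- (real_of_int k * (\<tau> * real (rev_digits b s z)))) *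
        unit_exp (real_of_int k * (real r * real z / real B)))" for r
      unfolding S_def t_def k(3) unit_exp_add[symmetric] by (simp add: right_diff_distrib)
    then have "(\<Sum>r<B. (S (real i - real j) r)\<^sup>2) \<le> (real B)\<^sup>2 * \<bar>real_of_int k\<bar>"
      using sum_norm_square_exp_le[OF B0 k(1)] by simp
    also have "\<dots> \<le> (real B)\<^sup>2 * K" using k by (intro mult_left_mono) auto
    finally have 1: "(\<Sum>r<B. (S (real i - real j) r)\<^sup>2) \<le> (real B)\<^sup>2 * K" .
    have "(\<Sum>d\<in>D. (S (real i - real j) (\<rho> d))\<^sup>2) \<le> 4 * real b * (\<Sum>r<B. (S (real i - real j) r)\<^sup>2)"
      using sum_over_inverse_squares_le[of D0 s \<rho> "\<lambda>r. (S (real i - real j) r)\<^sup>2"] \<rho> unfolding D_def B_def by simp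
    also have "\<dots> \<le> 4 * real b * ((real B)\<^sup>2 * K)" using 1 by (intro mult_left_mono) auto
    finally have "(\<Sum>d\<in>D. S (real i - real j) (\<rho> d)) \<le> sqrt (real B * (4 * real b * ((real B)\<^sup>2 * K)))"
      using cardD by (intro cauchy_schwarz_sum_le) (auto simp: S_def)
    also have "real B * (4 * real b * ((real B)\<^sup>2 * K)) = 4 * real b * real B ^ 3 * K"
      by (simp add: power2_eq_square power3_eq_cube)
    finally show ?thesis .
  qed
  have pair: "(\<Sum>d\<in>D. S (real i - real j) (\<rho> d)) \<le> (if j = i then real B ^ 2 else 0) + sqrt (4 * real b * real B ^ 3 * K)"
    if "i < K" "j < K" for i j
  proof (cases "i = j")
    case True
    have "(\<Sum>d\<in>D. S (real i - real j) (\<rho> d)) = real (card D) * real B" using True by (simp add: S_def)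
    also have "\<dots> \<le> real B * real B" using cardD by (intro mult_right_mono) auto
    also have "\<dots> \<le> real B * real B + sqrt (4 * real b * real B ^ 3 * K)" by simp
    finally show ?thesis using True by (simp add: power2_eq_square)
  qed (use offdiag that in auto)
  have "(\<Sum>d\<in>D. real (card (W d))) \<le> (\<Sum>d\<in>D. 4 / real K ^ 2 * (\<Sum>i<K. \<Sum>j<K. S (real i - real j) (\<rho> d)))"
    by (intro sum_mono Wle)
  also have "\<dots> = 4 / real K ^ 2 * (\<Sum>i<K. \<Sum>j<K. \<Sum>d\<in>D. S (real i - real j) (\<rho> d))"
    unfolding sum_distrib_left[symmetric] by (simp add: sum.swap[of _ D])
  also have "\<dots> \<le> 4 / real K ^ 2 * (\<Sum>i<K. \<Sum>j<K. (if j = i then real B ^ 2 else 0) + sqrt (4 * real b * real B ^ 3 * K))"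
    using pair by (intro mult_left_mono sum_mono) auto
  also have "\<dots> = 4 / real K ^ 2 * (K * real B ^ 2 + K * K * sqrt (4 * real b * real B ^ 3 * K))"
    by (simp add: sum.distrib) (simp add: distrib_left)
  also have "\<dots> = 4 * (real B ^ 2 / K + sqrt (4 * real b * real B ^ 3 * K))"
  proof -
    have "4 / real K ^ 2 * (K * X + real (K * K) * Y) = 4 * (X / K + Y)" for X Y :: real
      using K0 by (simp add: field_simps power2_eq_square)
    then show ?thesis by simp
  qed
  finally show ?thesis unfolding W_def .
qed

end

section \<open>Palindromes divisible by squares of medium size\<close>

context
  fixes b :: nat
  assumes b2: "b \<ge> 2"
begin

text \<open>
  Once \<open>z\<close> is chosen, the block \<open>y < b^(2l + 1)\<close> is determined, since \<open>d^2\<close> exceeds that bound.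
\<close>
lemma card_inner_le:
  fixes d c :: int and s l :: nat
  assumes cop: "coprime d (int b)" and dL: "int b ^ (2 * l + 1) \<le> d\<^sup>2"
  shows "card {p \<in> pal b (s + l). d\<^sup>2 dvd c + int p}
    \<le> card {z. z < b ^ s \<and> (\<exists>y<b ^ (2 * l + 1).
          d\<^sup>2 dvd c + int (z + b ^ s * y + b ^ s * b ^ (2 * l + 1) * rev_digits b s z))}"
    (is "card ?P \<le> card ?W")
proof -
  have split: "\<exists>y<b ^ (2 * l + 1). p mod b ^ s < b ^ s \<and>
      p = p mod b ^ s + b ^ s * y + b ^ s * b ^ (2 * l + 1) * rev_digits b s (p mod b ^ s)"
    if p: "p \<in> pal b (s + l)" for p
  proof -
    obtain z y where zy: "z < b ^ s" "y \<in> pal b (s + l - s)"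
      "p = z + b ^ (2 * (s + l) + 1 - s) * rev_digits b s z + b ^ s * y"
      using pal_split[OF b2 p, of s] by auto
    have "2 * (s + l) + 1 - s = s + (2 * l + 1)" by simp
    then have p: "p = z + b ^ s * (b ^ (2 * l + 1) * rev_digits b s z + y)"
      unfolding zy(3) by (simp only: power_add distrib_left mult.assoc add.assoc)
    then have "p mod b ^ s = z" using zy(1) by simp
    moreover have "y < b ^ (2 * l + 1)" using pal_less[OF b2, of y l] zy(2) by simp
    ultimately show ?thesis using p zy(1) by (intro exI[of _ y]) (simp add: distrib_left)
  qed
  have "inj_on (\<lambda>p. p mod b ^ s) ?P"
  proof (rule inj_onI)
    fix p q assume p: "p \<in> ?P" and q: "q \<in> ?P" and e: "p mod b ^ s = q mod b ^ s"
    obtain y where y: "y < b ^ (2 * l + 1)"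
      "p = p mod b ^ s + b ^ s * y + b ^ s * b ^ (2 * l + 1) * rev_digits b s (p mod b ^ s)"
      using split p by blast
    obtain y' where y': "y' < b ^ (2 * l + 1)"
      "q = q mod b ^ s + b ^ s * y' + b ^ s * b ^ (2 * l + 1) * rev_digits b s (q mod b ^ s)"
      using split q by blast
    have "int p - int q = int b ^ s * (int y - int y')"
      by (subst y(2), subst y'(2)) (simp add: e right_diff_distrib)
    moreover have "d\<^sup>2 dvd (c + int p) - (c + int q)" using p q by (intro dvd_diff) auto
    ultimately have "d\<^sup>2 dvd int b ^ s * (int y - int y')" by simp
    moreover have "coprime (d\<^sup>2) (int b ^ s)" using cop by simp
    ultimately have "d\<^sup>2 dvd int y - int y'" by (simp add: coprime_dvd_mult_right_iff)
    moreover have "\<bar>int y - int y'\<bar> < d\<^sup>2"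
    proof -
      have "int y < int b ^ (2 * l + 1)" "int y' < int b ^ (2 * l + 1)"
        using y(1) y'(1) by (simp_all only: of_nat_less_iff flip: of_nat_power)
      then show ?thesis using dL by linarith
    qed
    ultimately have "int y - int y' = 0" using dvd_imp_le_int[of "int y - int y'" "d\<^sup>2"] by force
    then show "p = q" using y(2) y'(2) e by simp
  qed
  moreover have "(\<lambda>p. p mod b ^ s) ` ?P \<subseteq> ?W"
  proof (rule image_subsetI)
    fix p assume p: "p \<in> ?P"
    then obtain y where y: "y < b ^ (2 * l + 1)" "p mod b ^ s < b ^ s"
      and eq: "p = p mod b ^ s + b ^ s * y + b ^ s * b ^ (2 * l + 1) * rev_digits b s (p mod b ^ s)"
      using split by blast
    have "d\<^sup>2 dvd c + int (p mod b ^ s + b ^ s * y + b ^ s * b ^ (2 * l + 1) * rev_digits b s (p mod b ^ s))"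
      unfolding eq[symmetric] using p by simp
    then show "p mod b ^ s \<in> ?W" using y by blast
  qed
  moreover have "finite ?W" by simp
  ultimately show ?thesis by (rule card_inj_on_le)
qed

text \<open>
  The parameters: the window has length \<open>b^s\<close> with \<open>s = 6 u\<close>, the kernel has \<open>b^(2u)\<close> terms, the
  cube root of the window length, and the central block has \<open>2 l + 1 = 94 u - 3\<close> digits, so that
  \<open>6 b^(2u) b^(2l + 1) \<le> b^(96 u) \<le> d^2\<close>. The remaining \<open>m = k - 53 u + 2\<close> outer digits are
  summed trivially.
\<close>
lemma window_sum_le:
  fixes D0 :: int and u k :: nat
  assumes u: "u \<ge> 1" "53 * u \<le> k" and D0: "int b ^ (48 * u) \<le> D0"
  defines "D \<equiv> {d \<in> {D0..<D0 + int (b ^ (6 * u))}. coprime d (int b)}"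
  shows "(\<Sum>d\<in>D. real (card {n \<in> pal b k. d\<^sup>2 dvd int n})) \<le> 12 * real b ^ (k - 43 * u + 3)"
proof -
  define s l m where "s = 6 * u" and "l = 47 * u - 2" and "m = k - 53 * u + 2"
  have k: "k = m + (s + l)" using u by (simp add: s_def l_def m_def)
  define ou where "ou a = a + b ^ (2 * k + 1 - m) * rev_digits b m a" for a
  have Dge: "D0 \<le> d" "coprime d (int b)" if "d \<in> D" for d using that by (auto simp: D_def)
  have L: "2 * l + 1 = 94 * u - 3" using u by (simp add: l_def)
  have bpos: "int b \<ge> 2" using b2 by simp
  have D0sq: "int b ^ (96 * u) \<le> D0\<^sup>2"
  proof -
    have "(int b ^ (48 * u))\<^sup>2 \<le> D0\<^sup>2" using D0 by (intro power_mono) auto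
    then show ?thesis by (simp flip: power_mult)
  qed
  have D0pos: "D0 > 0"
  proof -
    have "0 < int b ^ (48 * u)" using b2 by simp
    then show ?thesis using D0 by linarith
  qed
  have c1: "2 * int (b ^ s) ^ 2 \<le> D0"
  proof -
    have "2 * int (b ^ s) ^ 2 \<le> int b * int b ^ (12 * u)"
      using bpos by (intro mult_mono) (simp_all add: s_def flip: power_mult)
    also have "\<dots> = int b ^ (12 * u + 1)" by simp
    also have "\<dots> \<le> int b ^ (48 * u)" using bpos u by (intro power_increasing) auto
    finally show ?thesis using D0 by linarith
  qed
  have c2: "int (6 * b ^ (2 * u)) * int b ^ (2 * l + 1) \<le> D0\<^sup>2"
  proof -
    have "int (6 * b ^ (2 * u)) * int b ^ (2 * l + 1) = 6 * int b ^ (96 * u - 3)"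
      unfolding L using u by (simp flip: power_add)
    also have "\<dots> \<le> int b ^ 3 * int b ^ (96 * u - 3)"
    proof (rule mult_right_mono)
      have "2 ^ 3 \<le> int b ^ 3" using bpos by (intro power_mono) auto
      then show "6 \<le> int b ^ 3" by simp
    qed simp
    also have "\<dots> = int b ^ (96 * u)" using u by (simp flip: power_add)
    finally show ?thesis using D0sq by linarith
  qed
  have dL: "int b ^ (2 * l + 1) \<le> d\<^sup>2" if "d \<in> D" for d
  proof -
    have "int b ^ (2 * l + 1) \<le> int b ^ (96 * u)" unfolding L using bpos by (intro power_increasing) auto
    also have "\<dots> \<le> D0\<^sup>2" by (rule D0sq)
    also have "\<dots> \<le> d\<^sup>2" using Dge[OF that] D0pos by (intro power_mono) auto
    finally show ?thesis .
  qed
  have "\<exists>c. d\<^sup>2 dvd int b ^ m * c - int (ou a)" if "d \<in> D" for d a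
  proof -
    have "coprime (int b ^ m) (d\<^sup>2)" using Dge(2)[OF that] by (simp add: coprime_commute)
    then obtain x where x: "[int b ^ m * x = 1] (mod d\<^sup>2)" using cong_solve_coprime_int by blast
    then have "[int b ^ m * x * int (ou a) = 1 * int (ou a)] (mod d\<^sup>2)" by (rule cong_scalar_right)
    then show ?thesis by (intro exI[of _ "x * int (ou a)"]) (simp add: cong_iff_dvd_diff mult.assoc)
  qed
  \<comment> \<open>\<open>c d a\<close> is the fixed outer part divided by \<open>b^m\<close> modulo \<open>d^2\<close>.\<close>
  then obtain c where c: "\<And>d a. d \<in> D \<Longrightarrow> d\<^sup>2 dvd int b ^ m * c d a - int (ou a)" by metis
  define W where "W a d = {z. z < b ^ s \<and> (\<exists>y<b ^ (2 * l + 1).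
          d\<^sup>2 dvd c d a + int (z + b ^ s * y + b ^ s * b ^ (2 * l + 1) * rev_digits b s z))}" for a d
  have 1: "card {n \<in> pal b k. d\<^sup>2 dvd int n} \<le> (\<Sum>a<b ^ m. card (W a d))" if d: "d \<in> D" for d
  proof -
    have "{n \<in> pal b k. d\<^sup>2 dvd int n} \<subseteq>
      (\<Union>a<b ^ m. (\<lambda>p. ou a + b ^ m * p) ` {p \<in> pal b (s + l). d\<^sup>2 dvd c d a + int p})"
    proof
      fix n assume n: "n \<in> {n \<in> pal b k. d\<^sup>2 dvd int n}"
      then obtain a p where ap: "a < b ^ m" "p \<in> pal b (s + l)" "n = ou a + b ^ m * p"
        using pal_split[OF b2, of n k m] k unfolding ou_def by auto
      have "d\<^sup>2 dvd int n + (int b ^ m * c d a - int (ou a))" using n c[OF d] by (intro dvd_add) auto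
      also have "int n + (int b ^ m * c d a - int (ou a)) = int b ^ m * (c d a + int p)"
        by (simp add: ap(3) distrib_left)
      finally have "d\<^sup>2 dvd c d a + int p"
        using Dge(2)[OF d] by (simp add: coprime_dvd_mult_right_iff)
      then show "n \<in> (\<Union>a<b ^ m. (\<lambda>p. ou a + b ^ m * p) ` {p \<in> pal b (s + l). d\<^sup>2 dvd c d a + int p})"
        using ap by auto
    qed
    then have "card {n \<in> pal b k. d\<^sup>2 dvd int n} \<le>
        card (\<Union>a<b ^ m. (\<lambda>p. ou a + b ^ m * p) ` {p \<in> pal b (s + l). d\<^sup>2 dvd c d a + int p})"
      using b2 by (intro card_mono) auto
    also have "\<dots> \<le> (\<Sum>a<b ^ m. card ((\<lambda>p. ou a + b ^ m * p) ` {p \<in> pal b (s + l). d\<^sup>2 dvd c d a + int p}))"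
      by (intro card_UN_le) simp
    also have "\<dots> \<le> (\<Sum>a<b ^ m. card (W a d))"
    proof (rule sum_mono)
      fix a
      have "card ((\<lambda>p. ou a + b ^ m * p) ` {p \<in> pal b (s + l). d\<^sup>2 dvd c d a + int p})
          \<le> card {p \<in> pal b (s + l). d\<^sup>2 dvd c d a + int p}" using b2 by (intro card_image_le) simp
      also have "\<dots> \<le> card (W a d)" unfolding W_def by (rule card_inner_le[OF Dge(2)[OF d] dL[OF d]])
      finally show "card ((\<lambda>p. ou a + b ^ m * p) ` {p \<in> pal b (s + l). d\<^sup>2 dvd c d a + int p}) \<le> card (W a d)" .
    qed
    finally show ?thesis .
  qed
  have 2: "(\<Sum>d\<in>D. real (card (W a d))) \<le> 12 * real b ^ (10 * u + 1)" for a
  proof -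
    have "(\<Sum>d\<in>D. real (card (W a d))) \<le> 4 * (real (b ^ s) ^ 2 / real (b ^ (2 * u)) + sqrt (4 * real b * real (b ^ s) ^ 3 * real (b ^ (2 * u))))"
      unfolding W_def D_def s_def[symmetric]
      by (rule sum_window_le[OF b2 c1 c2]) (use b2 in simp)
    also have "real (b ^ s) ^ 2 / real (b ^ (2 * u)) = real b ^ (10 * u)"
    proof -
      have "real (b ^ s) ^ 2 = real b ^ (10 * u) * real (b ^ (2 * u))"
        by (simp add: s_def flip: power_add power_mult)
      then show ?thesis using b2 by simp
    qed
    also have "4 * real b * real (b ^ s) ^ 3 * real (b ^ (2 * u)) = 4 * real b * (real b ^ (10 * u))\<^sup>2"
      by (simp add: s_def flip: power_add power_mult)
    also have "sqrt \<dots> = 2 * sqrt (real b) * real b ^ (10 * u)"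
      by (simp add: real_sqrt_mult)
    also have "4 * (real b ^ (10 * u) + 2 * sqrt (real b) * real b ^ (10 * u)) = 4 * (1 + 2 * sqrt (real b)) * real b ^ (10 * u)"
      by (simp add: distrib_right distrib_left)
    also have "\<dots> \<le> 12 * real b * real b ^ (10 * u)"
    proof (rule mult_right_mono)
      have "sqrt (real b) \<le> sqrt ((real b)\<^sup>2)" using b2 by (intro real_sqrt_le_mono) (simp add: power2_eq_square)
      then have "sqrt (real b) \<le> real b" by simp
      moreover have "1 \<le> real b" using b2 by simp
      ultimately show "4 * (1 + 2 * sqrt (real b)) \<le> 12 * real b" by argo
    qed simp
    finally show ?thesis by simp
  qed
  have "(\<Sum>d\<in>D. real (card {n \<in> pal b k. d\<^sup>2 dvd int n})) \<le> (\<Sum>d\<in>D. \<Sum>a<b ^ m. real (card (W a d)))"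
    using 1 by (intro sum_mono) (simp flip: of_nat_sum)
  also have "\<dots> = (\<Sum>a<b ^ m. \<Sum>d\<in>D. real (card (W a d)))" by (rule sum.swap)
  also have "\<dots> \<le> (\<Sum>a<b ^ m. 12 * real b ^ (10 * u + 1))" by (intro sum_mono 2)
  also have "\<dots> = 12 * real b ^ (m + (10 * u + 1))" by (simp add: power_add)
  also have "m + (10 * u + 1) = k - 43 * u + 3" using u by (simp add: m_def)
  finally show ?thesis .
qed

text \<open>
  The range is cut into windows of length \<open>b^(6u)\<close>. The bound saves \<open>b^u\<close>, about the power
  \<open>1 / 48\<close> of \<open>d\<close>, over the trivial bound.
\<close>
lemma middle_range_le:
  fixes u k :: nat
  assumes u: "u \<ge> 1" "53 * u \<le> k"
  shows "(\<Sum>d\<in>{b ^ (48 * u)..<b ^ (48 * (u + 1))}. real (card {n \<in> pal b k. coprime n b \<and> d\<^sup>2 dvd n}))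
    \<le> 12 * real b ^ 51 * (real b ^ k / real b ^ u)"
proof -
  let ?R = "{b ^ (48 * u)..<b ^ (48 * (u + 1))}"
  define f where "f d = real (card {n \<in> pal b k. coprime n b \<and> d\<^sup>2 dvd n})" for d
  define w where "w = b ^ (6 * u)"
  have w0: "w > 0" using b2 by (simp add: w_def)
  define g where "g d = (d - b ^ (48 * u)) div w" for d
  define J where "J = b ^ (42 * u + 48)"
  have wJ: "w * J = b ^ (48 * (u + 1))" unfolding w_def J_def by (simp add: add.commute flip: power_add)
  have "g ` ?R \<subseteq> {..<J}"
    using wJ w0 by (auto simp: g_def less_mult_imp_div_less mult.commute)
  then have "(\<Sum>d\<in>?R. f d) = (\<Sum>j<J. \<Sum>d\<in>{d \<in> ?R. g d = j}. f d)"
    by (intro sum.group[symmetric]) auto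
  also have "\<dots> \<le> (\<Sum>j<J. 12 * real b ^ (k - 43 * u + 3))"
  proof (rule sum_mono)
    fix j assume "j \<in> {..<J}"
    define D0 where "D0 = int (b ^ (48 * u) + j * w)"
    define D where "D = {d \<in> {D0..<D0 + int w}. coprime d (int b)}"
    define A where "A = {d \<in> ?R. g d = j \<and> coprime d b}"
    have finD: "finite D" unfolding D_def by (rule finite_subset[of _ "{D0..<D0 + int w}"]) auto
    have sub: "int ` A \<subseteq> D"
    proof (rule image_subsetI)
      fix d assume d: "d \<in> A"
      then have ge: "d \<ge> b ^ (48 * u)" and gj: "(d - b ^ (48 * u)) div w = j" and "coprime d b"
        by (auto simp: A_def g_def)
      have "d - b ^ (48 * u) = w * j + (d - b ^ (48 * u)) mod w" using gj by (metis mult_div_mod_eq)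
      moreover have "(d - b ^ (48 * u)) mod w < w" using w0 by simp
      ultimately have "b ^ (48 * u) + j * w \<le> d \<and> d < b ^ (48 * u) + j * w + w"
        using ge le_add_diff_inverse[OF ge] unfolding mult.commute[of w j] by linarith
      then have "D0 \<le> int d \<and> int d < D0 + int w" unfolding D0_def by linarith
      then show "int d \<in> D" using \<open>coprime d b\<close> by (simp add: D_def)
    qed
    have "(\<Sum>d\<in>{d \<in> ?R. g d = j}. f d) = (\<Sum>d\<in>A. f d)"
    proof (rule sum.mono_neutral_right)
      show "\<forall>i\<in>{d \<in> ?R. g d = j} - A. f i = 0"
      proof
        fix d assume "d \<in> {d \<in> ?R. g d = j} - A"
        then have nc: "\<not> coprime d b" by (auto simp: A_def)
        have "{n \<in> pal b k. coprime n b \<and> d\<^sup>2 dvd n} = {}"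
        proof (rule ccontr)
          assume "{n \<in> pal b k. coprime n b \<and> d\<^sup>2 dvd n} \<noteq> {}"
          then obtain n where "coprime n b" "d\<^sup>2 dvd n" by auto
          then have "coprime (d\<^sup>2) b" by (meson coprime_divisors dvd_refl)
          then show False using nc by simp
        qed
        then show "f d = 0" unfolding f_def by (simp only: card.empty of_nat_0)
      qed
    qed (auto simp: A_def)
    also have "\<dots> \<le> (\<Sum>d\<in>A. real (card {n \<in> pal b k. (int d)\<^sup>2 dvd int n}))"
    proof (rule sum_mono)
      fix d
      have "{n \<in> pal b k. coprime n b \<and> d\<^sup>2 dvd n} \<subseteq> {n \<in> pal b k. (int d)\<^sup>2 dvd int n}"
        by (auto simp flip: of_nat_power)
      then show "f d \<le> real (card {n \<in> pal b k. (int d)\<^sup>2 dvd int n})"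
        unfolding f_def using b2 by (intro of_nat_mono card_mono) auto
    qed
    also have "\<dots> = (\<Sum>d\<in>int ` A. real (card {n \<in> pal b k. d\<^sup>2 dvd int n}))"
      by (subst sum.reindex) auto
    also have "\<dots> \<le> (\<Sum>d\<in>D. real (card {n \<in> pal b k. d\<^sup>2 dvd int n}))"
      using sub finD by (intro sum_mono2) auto
    also have "\<dots> \<le> 12 * real b ^ (k - 43 * u + 3)"
      unfolding D_def w_def by (rule window_sum_le[OF u]) (simp add: D0_def)
    finally show "(\<Sum>d\<in>{d \<in> ?R. g d = j}. f d) \<le> 12 * real b ^ (k - 43 * u + 3)" .
  qed
  also have "\<dots> = 12 * real b ^ (42 * u + 48 + (k - 43 * u + 3))"
    by (simp add: J_def power_add)
  also have "42 * u + 48 + (k - 43 * u + 3) = 51 + (k - u)" using u by simp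
  also have "real b ^ (51 + (k - u)) = real b ^ 51 * (real b ^ k / real b ^ u)"
    using u b2 by (simp add: power_add power_diff)
  finally show ?thesis unfolding f_def by simp
qed

end

section \<open>Palindromes divisible by large squares\<close>

context
  fixes b :: nat
  assumes b2: "b \<ge> 2"
begin

text \<open>
  Numbers in \<open>pal b k\<close> with the same last \<open>m\<close> digits also share the first \<open>m\<close>. Hence the values
  \<open>d^2 e\<close> lie in an interval of length \<open>b^(2k + 1 - m)\<close>, which confines \<open>d\<close> to an interval of length
  \<open>b^m\<close> because \<open>2 m \<ge> k + 2\<close>, and \<open>d^2\<close> is fixed modulo \<open>b^m\<close>.
\<close>
lemma card_large_fiber_le:
  fixes e a k m :: nat
  assumes m: "m \<le> k" "k + 2 \<le> 2 * m" and e: "coprime e b"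
  shows "card {d. d < b ^ (k + 1) \<and> d\<^sup>2 * e \<in> pal b k \<and> coprime (d\<^sup>2 * e) b \<and> d\<^sup>2 * e mod b ^ m = a} \<le> 4 * b"
    (is "card ?X \<le> _")
proof (cases "?X = {}")
  case False
  have fin: "finite ?X" by (rule finite_subset[of _ "{..<b ^ (k + 1)}"]) auto
  define \<mu> where "\<mu> = Min ?X"
  have \<mu>X: "\<mu> \<in> ?X" unfolding \<mu>_def using fin False by (rule Min_in)
  have \<mu>le: "\<mu> \<le> d" if "d \<in> ?X" for d unfolding \<mu>_def using fin that by (rule Min_le)
  have low: "\<not> b dvd d\<^sup>2 * e" if "d \<in> ?X" for d
  proof
    assume "b dvd d\<^sup>2 * e"
    moreover have "coprime (d\<^sup>2 * e) b" using that by simp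
    ultimately have "is_unit b" by (metis coprime_common_divisor dvd_refl)
    then show False using b2 by simp
  qed
  have near: "d\<^sup>2 * e < \<mu>\<^sup>2 * e + b ^ (2 * k + 1 - m)" if d: "d \<in> ?X" for d
  proof -
    have *: "\<exists>p<b ^ (2 * (k - m) + 1). n = a + b ^ (2 * k + 1 - m) * rev_digits b m a + b ^ m * p"
      if np: "n \<in> pal b k" "n mod b ^ m = a" for n
    proof -
      obtain z p where zp: "z < b ^ m" "p \<in> pal b (k - m)"
        "n = z + b ^ (2 * k + 1 - m) * rev_digits b m z + b ^ m * p"
        using pal_split[OF b2 np(1) m(1)] by blast
      have "2 * k + 1 - m = m + (2 * k + 1 - 2 * m)" using m by simp
      then have "n = z + b ^ m * (b ^ (2 * k + 1 - 2 * m) * rev_digits b m z + p)"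
        unfolding zp(3) by (simp only: power_add distrib_left mult.assoc add.assoc)
      then have "z = a" using np(2) zp(1) by simp
      then show ?thesis using zp pal_less[OF b2 zp(2)] by auto
    qed
    obtain p where p: "p < b ^ (2 * (k - m) + 1)" "d\<^sup>2 * e = a + b ^ (2 * k + 1 - m) * rev_digits b m a + b ^ m * p"
      using * d by blast
    obtain q where q: "\<mu>\<^sup>2 * e = a + b ^ (2 * k + 1 - m) * rev_digits b m a + b ^ m * q"
      using * \<mu>X by blast
    have "b ^ m * p < b ^ m * b ^ (2 * (k - m) + 1)" using p(1) b2 by simp
    also have "\<dots> = b ^ (m + (2 * (k - m) + 1))" by (rule power_add[symmetric])
    also have "m + (2 * (k - m) + 1) = 2 * k + 1 - m" using m by simp
    finally show ?thesis using p(2) q by linarith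
  qed
  have width: "d < \<mu> + b ^ m" if d: "d \<in> ?X" for d
  proof (rule ccontr)
    assume "\<not> d < \<mu> + b ^ m"
    then have ge: "\<mu> + b ^ m \<le> d" by simp
    \<comment> \<open>This uses that the leading digit is nonzero: \<open>\<mu>^2 e \<ge> b^(2k)\<close> while \<open>\<mu> < b^(k + 1)\<close>.\<close>
    have big: "b ^ (k - 1) \<le> \<mu> * e"
    proof (rule ccontr)
      assume "\<not> b ^ (k - 1) \<le> \<mu> * e"
      then have "\<mu> * (\<mu> * e) \<le> b ^ (k + 1) * (b ^ (k - 1) - 1)"
        using \<mu>X by (intro mult_mono) auto
      also have "\<dots> < b ^ (k + 1) * b ^ (k - 1)" using b2 by simp
      also have "\<dots> = b ^ (k + 1 + (k - 1))" by (rule power_add[symmetric])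
      also have "k + 1 + (k - 1) = 2 * k" using m by simp
      finally have "\<mu>\<^sup>2 * e < b ^ (2 * k)" by (simp add: power2_eq_square mult.assoc)
      moreover have "b ^ (2 * k) \<le> \<mu>\<^sup>2 * e" using pal_lower[OF b2 _ low[OF \<mu>X]] \<mu>X by blast
      ultimately show False by simp
    qed
    have "\<mu>\<^sup>2 * e + b ^ (2 * k + 1 - m) \<le> \<mu>\<^sup>2 * e + b ^ m * (2 * b ^ (k - 1))"
    proof -
      have "b ^ (2 * k + 1 - m) \<le> b ^ (m + (k - 1))" using b2 m by (intro power_increasing) auto
      also have "\<dots> \<le> b ^ m * (2 * b ^ (k - 1))" by (simp add: power_add)
      finally show ?thesis by simp
    qed
    also have "\<dots> \<le> \<mu>\<^sup>2 * e + b ^ m * (2 * (\<mu> * e))" using big by simp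
    also have "\<dots> \<le> (\<mu> + b ^ m)\<^sup>2 * e" by (simp add: power2_eq_square algebra_simps)
    also have "\<dots> \<le> d\<^sup>2 * e" using ge by (intro mult_right_mono power_mono) auto
    finally show False using near[OF d] by simp
  qed
  have "card (int ` ?X) \<le> 4 * b"
  proof (rule card_square_roots_le[of b _ "int \<mu>" m])
    show "int ` ?X \<subseteq> {int \<mu>..<int \<mu> + int b ^ m}"
    proof (rule image_subsetI)
      fix d assume d: "d \<in> ?X"
      have "int d < int (\<mu> + b ^ m)" using width[OF d] by (simp only: of_nat_less_iff)
      then show "int d \<in> {int \<mu>..<int \<mu> + int b ^ m}" using \<mu>le[OF d] by simp
    qed
    show "coprime x (int b)" if "x \<in> int ` ?X" for x using that by (auto simp: coprime_mult_left_iff)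
    fix x y assume "x \<in> int ` ?X" "y \<in> int ` ?X"
    then obtain d d' where d: "x = int d" "y = int d'" "d \<in> ?X" "d' \<in> ?X" by blast
    then have "d\<^sup>2 * e mod b ^ m = d'\<^sup>2 * e mod b ^ m" by simp
    then have "int (d\<^sup>2 * e) mod int (b ^ m) = int (d'\<^sup>2 * e) mod int (b ^ m)"
      by (metis of_nat_mod)
    then have "int (b ^ m) dvd int (d\<^sup>2 * e) - int (d'\<^sup>2 * e)" by (simp only: mod_eq_dvd_iff)
    then have "int b ^ m dvd (x\<^sup>2 - y\<^sup>2) * int e" unfolding d(1,2) by (simp add: left_diff_distrib)
    moreover have "coprime (int b ^ m) (int e)" using e by (simp add: coprime_commute)
    ultimately show "int b ^ m dvd x\<^sup>2 - y\<^sup>2" by (simp add: coprime_dvd_mult_left_iff)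
  qed (use b2 in simp)
  then show ?thesis by (simp add: card_image)
next
  case True
  then show ?thesis by (simp only: card.empty le0)
qed

text \<open>
  A pair \<open>(d, n)\<close> is determined up to \<open>4 b\<close> choices by the cofactor \<open>n / d^2\<close>, which takes about
  \<open>b^(k / 5)\<close> values, and the last quarter of the digits of \<open>n\<close>.
\<close>
lemma large_range_le:
  fixes h k :: nat
  assumes h: "9 * k \<le> 10 * h"
  shows "(\<Sum>d\<in>{b ^ h..<b ^ (k + 1)}. real (card {n \<in> pal b k. coprime n b \<and> d\<^sup>2 dvd n}))
    \<le> real b ^ (3 * k div 4 + 8)"
proof -
  let ?R = "{b ^ h..<b ^ (k + 1)}"
  define P where "P = (SIGMA d:?R. {n \<in> pal b k. coprime n b \<and> d\<^sup>2 dvd n})"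
  have finP: "finite P" unfolding P_def using b2 by (intro finite_SigmaI) auto
  have cP: "card P = (\<Sum>d\<in>?R. card {n \<in> pal b k. coprime n b \<and> d\<^sup>2 dvd n})"
    unfolding P_def using b2 by (subst card_SigmaI) auto
  have "card P \<le> b ^ (3 * k div 4 + 8)"
  proof (cases "k < 4")
    case True
    have "P \<subseteq> {..<b ^ (k + 1)} \<times> pal b k" by (auto simp: P_def)
    then have "card P \<le> card ({..<b ^ (k + 1)} \<times> pal b k)" using b2 by (intro card_mono) auto
    also have "\<dots> = b ^ (k + 1 + (k + 1))"
      by (simp only: card_cartesian_product card_pal[OF b2] card_lessThan power_add)
    also have "\<dots> \<le> b ^ (3 * k div 4 + 8)" using True b2 by (intro power_increasing) auto
    finally show ?thesis .
  next
    case False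
    define m where "m = k div 2 + 2"
    have m: "m \<le> k" "k + 2 \<le> 2 * m" using False by (auto simp: m_def)
    define E where "E = b ^ (2 * k + 1 - 2 * h)"
    define g where "g = (\<lambda>(d, n). (n div d\<^sup>2, n mod b ^ m))"
    have g: "g ` P \<subseteq> {..<E} \<times> {..<b ^ m}"
    proof (rule image_subsetI)
      fix x assume "x \<in> P"
      then obtain d n where x: "x = (d, n)" and dn: "b ^ h \<le> d" "n \<in> pal b k" "coprime n b" "d\<^sup>2 dvd n"
        by (auto simp: P_def)
      from dn(4) obtain e where e: "n = d\<^sup>2 * e" by (elim dvdE)
      have "n > 0" using dn(3) b2 by (intro gr0I) auto
      then have ed: "d > 0" "e > 0" using e by auto
      have "b ^ (2 * h) \<le> d\<^sup>2" using dn(1) power_mono[of "b ^ h" d 2] by (simp flip: power_mult add: mult.commute)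
      then have "b ^ (2 * h) * e \<le> n" using e by simp
      then have lt: "b ^ (2 * h) * e < b ^ (2 * k + 1)" using pal_less[OF b2 dn(2)] by simp
      have "b ^ (2 * h) * 1 \<le> b ^ (2 * h) * e" using ed by (intro mult_le_mono) auto
      then have "b ^ (2 * h) * 1 < b ^ (2 * k + 1)" using lt by (rule le_less_trans)
      then have "2 * h < 2 * k + 1" using b2 by (simp only: mult_1_right power_strict_increasing_iff)
      then have "b ^ (2 * k + 1) = b ^ (2 * h) * E" unfolding E_def by (simp flip: power_add)
      then have "e < E" using lt by simp
      then show "g x \<in> {..<E} \<times> {..<b ^ m}" using e ed b2 by (simp add: g_def x)
    qed
    have fib: "card {x \<in> P. g x = y} \<le> 4 * b" for y
    proof (cases "{x \<in> P. g x = y} = {}")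
      case False
      obtain e a where y: "y = (e, a)" by (cases y)
      let ?X = "{d. d < b ^ (k + 1) \<and> d\<^sup>2 * e \<in> pal b k \<and> coprime (d\<^sup>2 * e) b \<and> d\<^sup>2 * e mod b ^ m = a}"
      have sub: "{x \<in> P. g x = y} \<subseteq> (\<lambda>d. (d, d\<^sup>2 * e)) ` ?X"
      proof
        fix x assume "x \<in> {x \<in> P. g x = y}"
        then obtain d n where x: "x = (d, n)" and dn: "d < b ^ (k + 1)" "n \<in> pal b k" "coprime n b" "d\<^sup>2 dvd n"
          "n div d\<^sup>2 = e" "n mod b ^ m = a"
          by (auto simp: P_def g_def y)
        then have "n = d\<^sup>2 * e" by auto
        then show "x \<in> (\<lambda>d. (d, d\<^sup>2 * e)) ` ?X" using x dn by auto
      qed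
      then have "?X \<noteq> {}" using False by auto
      then have "coprime e b" by (auto simp: coprime_mult_left_iff)
      have "finite ?X" by (rule finite_subset[of _ "{..<b ^ (k + 1)}"]) auto
      then have "card {x \<in> P. g x = y} \<le> card ?X" using sub by (rule surj_card_le)
      also have "\<dots> \<le> 4 * b" by (rule card_large_fiber_le[OF m \<open>coprime e b\<close>])
      finally show ?thesis .
    qed (simp del: Collect_empty_eq)
    have "card P = (\<Sum>y\<in>{..<E} \<times> {..<b ^ m}. card {x \<in> P. g x = y})"
      using sum.group[OF finP _ g, of "\<lambda>_. 1::nat"] by simp
    also have "\<dots> \<le> (\<Sum>y\<in>{..<E} \<times> {..<b ^ m}. 4 * b)" by (intro sum_mono fib)
    also have "\<dots> = 4 * (E * b ^ m * b)" by (simp add: card_cartesian_product)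
    also have "\<dots> \<le> b ^ 2 * (E * b ^ m * b)"
    proof (rule mult_right_mono)
      have "2 ^ 2 \<le> b ^ 2" using b2 by (intro power_mono) auto
      then show "4 \<le> b ^ 2" by simp
    qed simp
    also have "\<dots> = b ^ (2 + (2 * k + 1 - 2 * h + m + 1))" unfolding E_def by (simp only: power_add power_one_right)
    also have "\<dots> \<le> b ^ (3 * k div 4 + 8)"
    proof (rule power_increasing)
      show "2 + (2 * k + 1 - 2 * h + m + 1) \<le> 3 * k div 4 + 8" unfolding m_def using h by linarith
    qed (use b2 in simp)
    finally show ?thesis .
  qed
  then have "real (card P) \<le> real (b ^ (3 * k div 4 + 8))" by (simp only: of_nat_le_iff)
  then show ?thesis unfolding cP by simp
qed

text \<open>
  The medium ranges are available as long as \<open>53 u \<le> k\<close>, and the last of them ends beyond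
  \<open>b^(48 k / 53)\<close>. As \<open>48 / 53 > 9 / 10\<close>, the large range takes over from there.
\<close>
lemma sum_tail_square_divisors_le:
  fixes u0 k :: nat
  assumes u0: "u0 \<ge> 1"
  shows "(\<Sum>d\<in>{b ^ (48 * u0)..<b ^ (k + 1)}. real (card {n \<in> pal b k. coprime n b \<and> d\<^sup>2 dvd n}))
    \<le> 24 * real b ^ 51 * (real b ^ k / real b ^ u0) + real b ^ (3 * k div 4 + 8)"
proof -
  define f where "f d = real (card {n \<in> pal b k. coprime n b \<and> d\<^sup>2 dvd n})" for d
  have f0: "f d \<ge> 0" for d by (simp add: f_def)
  have b1: "real b \<ge> 2" using b2 by simp
  \<comment> \<open>The subtracted term makes the induction telescope like a geometric series.\<close>
  have geo: "sum f {b ^ (48 * u0)..<b ^ (48 * (u0 + j))}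
      \<le> 12 * real b ^ 51 * real b ^ k * (2 / real b ^ u0 - 2 / real b ^ (u0 + j))"
    if "u0 + j \<le> k div 53 + 1" for j
    using that
  proof (induction j)
    case 0
    then show ?case by simp
  next
    case (Suc j)
    have "sum f {b ^ (48 * u0)..<b ^ (48 * (u0 + Suc j))} =
        sum f {b ^ (48 * u0)..<b ^ (48 * (u0 + j))} + sum f {b ^ (48 * (u0 + j))..<b ^ (48 * (u0 + j + 1))}"
      using b2 by (subst sum.atLeastLessThan_concat) (auto intro!: power_increasing)
    also have "sum f {b ^ (48 * (u0 + j))..<b ^ (48 * (u0 + j + 1))} \<le> 12 * real b ^ 51 * (real b ^ k / real b ^ (u0 + j))"
      unfolding f_def using Suc.prems u0 by (intro middle_range_le[OF b2]) auto
    also have "sum f {b ^ (48 * u0)..<b ^ (48 * (u0 + j))} \<le> 12 * real b ^ 51 * real b ^ k * (2 / real b ^ u0 - 2 / real b ^ (u0 + j))"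
      using Suc by simp
    also have "12 * real b ^ 51 * real b ^ k * (2 / real b ^ u0 - 2 / real b ^ (u0 + j)) + 12 * real b ^ 51 * (real b ^ k / real b ^ (u0 + j))
      = 12 * real b ^ 51 * real b ^ k * (2 / real b ^ u0 - 1 / real b ^ (u0 + j))" by (simp add: right_diff_distrib)
    also have "\<dots> \<le> 12 * real b ^ 51 * real b ^ k * (2 / real b ^ u0 - 2 / real b ^ (u0 + Suc j))"
      using b1 by (intro mult_left_mono diff_left_mono) (auto simp: field_simps)
    finally show ?case by simp
  qed
  define h where "h = 48 * (k div 53 + 1)"
  have h: "9 * k \<le> 10 * h" 
  proof -
    have "k = 53 * (k div 53) + k mod 53" "k mod 53 < 53" by simp_all
    then show ?thesis unfolding h_def distrib_left by linarith
  qed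
  have large: "sum f {b ^ h..<b ^ (k + 1)} \<le> real b ^ (3 * k div 4 + 8)"
    unfolding f_def by (rule large_range_le[OF h])
  show ?thesis
  proof (cases "u0 \<le> k div 53 + 1")
    case True
    have "sum f {b ^ (48 * u0)..<b ^ (k + 1)} \<le> sum f ({b ^ (48 * u0)..<b ^ h} \<union> {b ^ h..<b ^ (k + 1)})"
      using f0 by (intro sum_mono2) auto
    also have "\<dots> \<le> sum f {b ^ (48 * u0)..<b ^ h} + sum f {b ^ h..<b ^ (k + 1)}"
      using f0 by (subst sum.union_disjoint) auto
    also have "sum f {b ^ (48 * u0)..<b ^ h} \<le> 12 * real b ^ 51 * real b ^ k * (2 / real b ^ u0 - 2 / real b ^ (k div 53 + 1))"
      using geo[of "k div 53 + 1 - u0"] True by (simp add: h_def)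
    also have "\<dots> \<le> 12 * real b ^ 51 * real b ^ k * (2 / real b ^ u0)"
      by (intro mult_left_mono) auto
    finally show ?thesis using large unfolding f_def by simp
  next
    case False
    have "sum f {b ^ (48 * u0)..<b ^ (k + 1)} \<le> sum f {b ^ h..<b ^ (k + 1)}"
    proof (rule sum_mono2)
      have "b ^ h \<le> b ^ (48 * u0)" using False b2 unfolding h_def by (intro power_increasing) auto
      then show "{b ^ (48 * u0)..<b ^ (k + 1)} \<subseteq> {b ^ h..<b ^ (k + 1)}" by auto
    qed (use f0 in auto)
    also have "\<dots> \<le> real b ^ (3 * k div 4 + 8)" by (rule large)
    also have "\<dots> \<le> 24 * real b ^ 51 * (real b ^ k / real b ^ u0) + real b ^ (3 * k div 4 + 8)" by simp
    finally show ?thesis unfolding f_def .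
  qed
qed

end

section \<open>Moebius sums\<close>

definition moebius_fun :: "nat \<Rightarrow> real" where
  "moebius_fun n = (if squarefree n then (-1) ^ card (prime_factors n) else 0)"

lemma abs_moebius_fun_le: "\<bar>moebius_fun n\<bar> \<le> 1"
  by (simp add: moebius_fun_def power_abs)

lemma prod_primes_squarefree:
  assumes "finite P" "\<And>p. p \<in> P \<Longrightarrow> prime (p::nat)"
  shows "squarefree (\<Prod>P)" "prime_factors (\<Prod>P) = P"
proof -
  show "squarefree (\<Prod>P)"
    using assms by (intro squarefree_prod_coprime) (auto intro: primes_coprime squarefree_prime)
  have "prime_factorization (\<Prod>P) = (\<Sum>p\<in>P. prime_factorization p)"
    using assms by (subst prime_factorization_prod) (auto simp: prime_gt_0_nat intro: ccontr)
  also have "\<dots> = (\<Sum>p\<in>P. {#p#})" using assms by (intro sum.cong refl) (simp add: prime_factorization_prime)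
  finally have "prime_factors (\<Prod>P) = set_mset (\<Sum>p\<in>P. {#p#})" by simp
  then show "prime_factors (\<Prod>P) = P" using assms(1) by (simp add: set_mset_sum)
qed

text \<open>
  The squarefree divisors correspond to the sets of prime factors, so the sum is the expanded product of
  the factors \<open>1 - 1\<close>.
\<close>
lemma sum_moebius_fun_divisors:
  assumes "n > 0"
  shows "(\<Sum>d | d dvd n. moebius_fun d) = (if n = 1 then 1 else 0)"
proof -
  let ?P = "prime_factors n"
  have fin: "finite {d. d dvd n}" using assms by simp
  have sqfree_eq: "\<Prod>(prime_factors d) = d" if "squarefree d" for d :: nat
  proof -
    have "d \<noteq> 0" using that by (metis not_squarefree_0)
    then have "d = (\<Prod>p\<in>prime_factors d. p ^ multiplicity p d)"
      by (simp add: prod_prime_factors)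
    also have "\<dots> = (\<Prod>p\<in>prime_factors d. p)"
    proof (rule prod.cong[OF refl])
      fix p assume p: "p \<in> prime_factors d"
      then have "multiplicity p d = 1"
        using that \<open>d \<noteq> 0\<close> squarefree_factorial_semiring'[of d] by auto
      then show "p ^ multiplicity p d = p" by simp
    qed
    finally show ?thesis by simp
  qed
  have bij: "bij_betw (\<lambda>Q. \<Prod>Q) (Pow ?P) {d. d dvd n \<and> squarefree d}"
  proof (rule bij_betwI[where g = prime_factors])
    show "(\<lambda>Q. \<Prod>Q) \<in> Pow ?P \<rightarrow> {d. d dvd n \<and> squarefree d}"
    proof
      fix Q assume Q: "Q \<in> Pow ?P"
      then have fQ: "finite Q" and pr: "\<And>p. p \<in> Q \<Longrightarrow> prime p" by (auto intro: finite_subset)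
      have "\<Prod>Q dvd n"
      proof -
        have "\<Prod>Q dvd \<Prod>?P" using Q by (intro prod_dvd_prod_subset) auto
        also have "\<dots> dvd (\<Prod>p\<in>?P. p ^ multiplicity p n)"
          by (intro prod_dvd_prod) (auto simp: prime_factors_multiplicity intro: dvd_power)
        also have "\<dots> = n" using assms by (simp add: prod_prime_factors)
        finally show ?thesis .
      qed
      then show "\<Prod>Q \<in> {d. d dvd n \<and> squarefree d}" using prod_primes_squarefree(1)[OF fQ pr] by simp
    qed
    show "prime_factors \<in> {d. d dvd n \<and> squarefree d} \<rightarrow> Pow ?P"
      using assms by (auto dest: dvd_prime_factors[rotated])
    show "prime_factors (\<Prod>Q) = Q" if "Q \<in> Pow ?P" for Q
      using that by (intro prod_primes_squarefree(2)) (auto intro: finite_subset)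
    show "\<Prod>(prime_factors d) = d" if "d \<in> {d. d dvd n \<and> squarefree d}" for d
      using that sqfree_eq by simp
  qed
  have "(\<Sum>d | d dvd n. moebius_fun d) = (\<Sum>d | d dvd n \<and> squarefree d. moebius_fun d)"
    using fin by (intro sum.mono_neutral_right) (auto simp: moebius_fun_def)
  also have "\<dots> = (\<Sum>Q\<in>Pow ?P. moebius_fun (\<Prod>Q))"
    by (rule sum.reindex_bij_betw[OF bij, symmetric])
  also have "\<dots> = (\<Sum>Q\<in>Pow ?P. (-1) ^ card Q)"
  proof (rule sum.cong[OF refl])
    fix Q assume "Q \<in> Pow ?P"
    then have fQ: "finite Q" and pr: "\<And>p. p \<in> Q \<Longrightarrow> prime p" by (auto intro: finite_subset)
    show "moebius_fun (\<Prod>Q) = (-1) ^ card Q"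
      using prod_primes_squarefree[OF fQ pr] by (simp add: moebius_fun_def)
  qed
  also have "\<dots> = (\<Prod>p\<in>?P. 1 - (1::real))"
    by (subst prod_diff_conv_sum) auto
  also have "\<dots> = (if n = 1 then 1 else 0)"
  proof (cases "n = 1")
    case False
    then obtain p where "prime p" "p dvd n" using prime_factor_nat by blast
    then have "p \<in> ?P" using assms by (simp add: prime_factors_dvd)
    then have "(\<Prod>p\<in>?P. 1 - (1::real)) = 0" by (intro prod_zero) auto
    then show ?thesis using False by simp
  qed simp
  finally show ?thesis .
qed

lemma sum_moebius_fun_square_divisors:
  assumes "n > 0"
  shows "(\<Sum>d | d\<^sup>2 dvd n. moebius_fun d) = (if squarefree n then 1 else 0)"
proof -
  have "square_part n > 0" using assms by (intro gr0I) simp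
  then have "(\<Sum>d | d\<^sup>2 dvd n. moebius_fun d) = (if square_part n = 1 then 1 else 0)"
    using sum_moebius_fun_divisors by (simp add: dvd_square_part_iff[symmetric])
  moreover have "square_part n = 1 \<longleftrightarrow> squarefree n"
  proof
    assume "square_part n = 1"
    then show "squarefree n"
      by (intro squarefreeI) (simp flip: dvd_square_part_iff)
  next
    assume "squarefree n"
    then have "square_part n dvd 1" by (rule squarefreeD[OF _ square_part_square_dvd])
    then show "square_part n = 1" by simp
  qed
  ultimately show ?thesis by simp
qed

definition inv_square :: "nat \<Rightarrow> real" where "inv_square n = 1 / (real n)\<^sup>2"

lemma inv_square_nonneg: "0 \<le> inv_square n" by (simp add: inv_square_def)

lemma inv_square_mult: "inv_square (d * e) = inv_square d * inv_square e"
  by (simp add: inv_square_def power_mult_distrib)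

lemma sum_inv_square_le:
  assumes M: "M \<ge> 1" and F: "finite F" "F \<subseteq> {M..}"
  shows "sum inv_square F \<le> 2 / real M"
proof -
  have *: "sum inv_square {M..<M + j} \<le> 2 / real M - 2 / real (M + j)" for j
  proof (induction j)
    case (Suc j)
    have "inv_square (M + j) \<le> 2 / real (M + j) - 2 / real (M + Suc j)"
    proof -
      define x where "x = real (M + j)"
      have x: "x \<ge> 1" using M by (simp add: x_def)
      have "1 / x\<^sup>2 = 2 / (2 * x\<^sup>2)" by simp
      also have "\<dots> \<le> 2 / (x * (x + 1))"
      proof (rule divide_left_mono)
        have "x * 1 \<le> x * x" using x by (intro mult_left_mono) auto
        then show "x * (x + 1) \<le> 2 * x\<^sup>2" by (simp add: power2_eq_square distrib_left)
      qed (use x in auto)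
      also have "\<dots> = 2 / x - 2 / (x + 1)" using x by (simp add: field_simps)
      finally show ?thesis by (simp add: inv_square_def x_def add_ac)
    qed
    then show ?case using Suc by simp
  qed simp
  obtain N where N: "\<forall>x\<in>F. x < N" using F(1) finite_nat_set_iff_bounded by blast
  have "F \<subseteq> {M..<M + N}" using F(2) N by (force intro: trans_less_add2)
  then have "sum inv_square F \<le> sum inv_square {M..<M + N}"
    by (intro sum_mono2) (auto simp: inv_square_nonneg)
  also have "\<dots> \<le> 2 / real M" using *[of N] by (rule order.trans) simp
  finally show ?thesis .
qed

lemma inv_square_summable: "S \<subseteq> {1..} \<Longrightarrow> inv_square summable_on S"
proof (rule summable_on_subset_banach)
  show "inv_square summable_on {1..}"
  proof (rule nonneg_bdd_above_summable_on)
    show "bdd_above (sum inv_square ` {F. F \<subseteq> {1..} \<and> finite F})"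
      by (rule bdd_aboveI[of _ 2]) (use sum_inv_square_le[of 1] in auto)
  qed (rule inv_square_nonneg)
qed

lemma infsum_inv_square_tail_le:
  assumes M: "M \<ge> 1" and S: "S \<subseteq> {M..}"
  shows "infsum inv_square S \<le> 2 / real M"
proof (rule infsum_le_finite_sums)
  show "inv_square summable_on S" using M S by (intro inv_square_summable) auto
  show "sum inv_square F \<le> 2 / real M" if "finite F" "F \<subseteq> S" for F
    using that S by (intro sum_inv_square_le[OF M]) auto
qed

lemma zeta_2_eq: "zeta 2 = infsum inv_square {1..}"
proof -
  have s: "{1..} = Suc ` UNIV"
  proof (rule set_eqI)
    fix x show "x \<in> {1..} \<longleftrightarrow> x \<in> range Suc" by (cases x) auto
  qed
  have "(inv_square \<circ> Suc) summable_on UNIV"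
    using inv_square_summable[of "{1..}"] summable_on_reindex[of Suc UNIV inv_square] unfolding s by simp
  then have "((inv_square \<circ> Suc) has_sum infsum (inv_square \<circ> Suc) UNIV) UNIV" by (rule has_sum_infsum)
  then have "(inv_square \<circ> Suc) sums infsum (inv_square \<circ> Suc) UNIV" by (rule has_sum_imp_sums)
  then have "(\<Sum>n. inv_square (Suc n)) = infsum (inv_square \<circ> Suc) UNIV" by (simp add: sums_iff o_def)
  also have "\<dots> = infsum inv_square {1..}" unfolding s by (rule infsum_reindex[symmetric]) simp
  finally show ?thesis by (simp add: zeta_def inv_square_def)
qed

text \<open>
  One Euler factor at a time: removing the multiples of \<open>p\<close> from a set that is invariant under
  multiplication by \<open>p\<close> removes the proportion \<open>1 / p^2\<close> of the sum.
\<close>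
lemma infsum_inv_square_coprime_primes:
  assumes "finite P" "\<And>p. p \<in> P \<Longrightarrow> prime (p::nat)"
  shows "infsum inv_square {n. n \<ge> 1 \<and> (\<forall>p\<in>P. \<not> p dvd n)} = zeta 2 * (\<Prod>p\<in>P. 1 - 1 / real p ^ 2)"
  using assms
proof (induction P rule: finite_induct)
  case empty
  have "{n. n \<ge> (1::nat)} = {1..}" by auto
  then show ?case by (simp add: zeta_2_eq)
next
  case (insert p P)
  define S where "S = {n. n \<ge> 1 \<and> (\<forall>p\<in>P. \<not> p dvd n)}"
  define S' where "S' = {n. n \<ge> 1 \<and> (\<forall>p\<in>insert p P. \<not> p dvd n)}"
  have p: "prime p" using insert.prems by simp
  have p0: "p > 0" using p by (rule prime_gt_0_nat)
  have ndvd: "q dvd p * n \<longleftrightarrow> q dvd n" if "q \<in> P" for q n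
  proof -
    have q: "prime q" using insert.prems that by simp
    have "\<not> q dvd p"
    proof
      assume "q dvd p"
      then have "q = p" by (rule primes_dvd_imp_eq[OF q p])
      then show False using insert.hyps(2) that by simp
    qed
    then show ?thesis using q by (simp add: prime_dvd_mult_iff)
  qed
  have split: "S = S' \<union> (\<lambda>n. p * n) ` S"
  proof (intro equalityI subsetI)
    fix n assume n: "n \<in> S"
    show "n \<in> S' \<union> (\<lambda>n. p * n) ` S"
    proof (cases "p dvd n")
      case True
      then obtain k where k: "n = p * k" by (elim dvdE)
      have "k \<noteq> 0" using n k by (auto simp: S_def)
      moreover have "\<not> q dvd k" if "q \<in> P" for q
        using n that ndvd[OF that, of k] unfolding k S_def by simp
      ultimately have "k \<in> S" by (simp add: S_def Suc_le_eq)
      then have "p * k \<in> (\<lambda>n. p * n) ` S" by (rule imageI)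
      then show ?thesis unfolding k by (rule UnI2)
    next
      case False
      then show ?thesis using n by (auto simp: S_def S'_def)
    qed
  next
    fix n assume "n \<in> S' \<union> (\<lambda>n. p * n) ` S"
    then show "n \<in> S"
    proof
      assume "n \<in> (\<lambda>n. p * n) ` S"
      then obtain k where k: "n = p * k" "k \<in> S" by (elim imageE)
      then have "\<not> q dvd n" if "q \<in> P" for q using that ndvd[OF that, of k] by (simp add: S_def)
      then show ?thesis using k p0 by (simp add: S_def Suc_le_eq)
    qed (simp add: S_def S'_def)
  qed
  have "infsum inv_square S = infsum inv_square S' + infsum inv_square ((\<lambda>n. p * n) ` S)"
  proof (subst split, rule infsum_Un_disjoint)
    show "inv_square summable_on S'" by (rule inv_square_summable) (simp add: S'_def subset_iff)
    have "(\<lambda>n. p * n) ` S \<subseteq> S" using split by blast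
    then show "inv_square summable_on (\<lambda>n. p * n) ` S"
      by (intro inv_square_summable) (auto simp: S_def)
    show "S' \<inter> (\<lambda>n. p * n) ` S = {}" by (auto simp: S'_def)
  qed
  also have "infsum inv_square ((\<lambda>n. p * n) ` S) = infsum (inv_square \<circ> (\<lambda>n. p * n)) S"
    using p0 by (intro infsum_reindex) (auto intro: inj_onI)
  also have "\<dots> = inv_square p * infsum inv_square S"
    by (simp add: o_def inv_square_mult infsum_cmult_right')
  finally have "infsum inv_square S = infsum inv_square S' + inv_square p * infsum inv_square S" .
  then have "infsum inv_square S' = infsum inv_square S * (1 - inv_square p)"
    by (simp add: algebra_simps)
  then have "infsum inv_square S' = infsum inv_square S * (1 - 1 / real p ^ 2)"
    by (simp only: inv_square_def)
  also have "infsum inv_square S = zeta 2 * (\<Prod>p\<in>P. 1 - 1 / real p ^ 2)"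
    unfolding S_def using insert by simp
  finally show ?case unfolding S'_def using insert.hyps by (simp add: mult_ac)
qed

text \<open>
  The Dirichlet series of the principal character modulo \<open>m\<close>, at the point 2.
\<close>
definition coprime_zeta :: "nat \<Rightarrow> real" where
  "coprime_zeta m = infsum inv_square {n. n \<ge> 1 \<and> coprime n m}"

lemma coprime_zeta_eq:
  assumes "m > 0"
  shows "coprime_zeta m = zeta 2 * (\<Prod>p | prime p \<and> p dvd m. 1 - 1 / real p ^ 2)"
proof -
  have "finite {p. prime p \<and> p dvd m}" by (rule finite_subset[of _ "{d. d dvd m}"]) (use assms in auto)
  moreover have "{n. n \<ge> 1 \<and> coprime n m} = {n. n \<ge> 1 \<and> (\<forall>p\<in>{p. prime p \<and> p dvd m}. \<not> p dvd n)}"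
  proof -
    have iff: "coprime n m \<longleftrightarrow> (\<forall>p. prime p \<and> p dvd m \<longrightarrow> \<not> p dvd n)" for n
    proof (intro iffI allI impI notI)
      fix p assume p: "coprime n m" "prime p \<and> p dvd m" "p dvd n"
      then have "p dvd 1" using coprime_common_divisor[of n m p] by simp
      then show False using p by simp
    next
      assume *: "\<forall>p. prime p \<and> p dvd m \<longrightarrow> \<not> p dvd n"
      show "coprime n m"
      proof (rule ccontr)
        assume "\<not> coprime n m"
        then have "gcd n m \<noteq> 1" unfolding coprime_iff_gcd_eq_1 .
        from prime_factor_nat[OF this] obtain p where p: "prime p" "p dvd gcd n m" by (elim exE conjE)
        from p(2) have "p dvd n" "p dvd m" by (rule dvd_trans, simp)+
        then show False using * p(1) by (simp only: not_True_eq_False simp_thms)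
      qed
    qed
    show ?thesis unfolding iff by (simp add: Ball_def)
  qed
  ultimately show ?thesis unfolding coprime_zeta_def
    by (simp only:) (rule infsum_inv_square_coprime_primes, simp_all)
qed

lemma coprime_zeta_ge_1: "coprime_zeta m \<ge> 1"
proof -
  have "infsum inv_square {1} \<le> infsum inv_square {n. n \<ge> 1 \<and> coprime n m}"
    by (rule infsum_mono2) (simp_all add: inv_square_summable inv_square_nonneg subset_iff)
  then show ?thesis by (simp add: coprime_zeta_def inv_square_def)
qed

lemma sum_inverse_le: "(\<Sum>d\<in>{1..<Suc n}. 1 / real d) \<le> 2 * sqrt (real n)"
proof (induction n)
  case (Suc n)
  define x y where "x = sqrt (real n)" and "y = sqrt (real (Suc n))"
  have y: "y\<^sup>2 = real (Suc n)" "x\<^sup>2 = real n" "y \<ge> 1" "x \<ge> 0" by (auto simp: x_def y_def)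
  have "y \<ge> x" by (simp add: x_def y_def)
  have "1 = (y - x) * (y + x)" using y by (simp add: algebra_simps power2_eq_square)
  also have "\<dots> \<le> (y - x) * (2 * y)" using \<open>y \<ge> x\<close> by (intro mult_left_mono) auto
  finally have 1: "1 \<le> 2 * y * (y - x)" by (simp add: mult_ac)
  have "1 / real (Suc n) = 1 / y\<^sup>2" using y by simp
  also have "\<dots> \<le> 1 / y" using y(3) by (simp add: field_simps power2_eq_square)
  also have "\<dots> \<le> 2 * y - 2 * x" using 1 y(3) by (simp add: field_simps)
  finally have "1 / real (Suc n) \<le> 2 * y - 2 * x" .
  moreover have "(\<Sum>d\<in>{1..<Suc (Suc n)}. 1 / real d) = (\<Sum>d\<in>{1..<Suc n}. 1 / real d) + 1 / real (Suc n)"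
    by (subst sum.atLeastLessThan_Suc) auto
  ultimately show ?case using Suc unfolding x_def y_def by linarith
qed simp

text \<open>
  The partial sums of \<open>\<mu>(d) / d^2\<close> converge to \<open>1 / coprime_zeta m\<close>. Grouping
  \<open>N = d e\<close> in the sum of \<open>1 / N^2\<close> times the divisor sum of \<open>\<mu>\<close>, which equals 1, pairs each \<open>d\<close> with a
  partial sum over \<open>e\<close> that misses \<open>coprime_zeta m\<close> by at most \<open>2 d / Y\<close>.
\<close>
lemma moebius_partial_sum:
  assumes Y: "Y \<ge> 2"
  shows "\<bar>coprime_zeta m * (\<Sum>d\<in>{d\<in>{1..<Y}. coprime d m}. moebius_fun d / (real d)\<^sup>2) - 1\<bar> \<le> 4 / sqrt (real Y)"
proof -
  define A where "A = {d\<in>{1..<Y}. coprime d m}"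
  have finA: "finite A" by (simp add: A_def)
  define E where "E d = {e. e \<ge> 1 \<and> coprime e m \<and> d * e < Y}" for d
  have finE: "finite (E d)" if "d \<in> A" for d
  proof (rule finite_subset[of _ "{..<Y}"])
    show "E d \<subseteq> {..<Y}"
    proof
      fix e assume e: "e \<in> E d"
      have "e \<le> d * e" using that by (simp add: A_def)
      also have "\<dots> < Y" using e by (simp add: E_def)
      finally show "e \<in> {..<Y}" by simp
    qed
  qed simp
  have "1 = (\<Sum>N\<in>A. if N = 1 then 1 else 0 :: real)" using finA Y by (simp add: A_def)
  also have "\<dots> = (\<Sum>N\<in>A. inv_square N * (\<Sum>d | d dvd N. moebius_fun d))"
  proof (rule sum.cong[OF refl])
    fix N assume "N \<in> A"
    then have "N > 0" by (auto simp: A_def)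
    then show "(if N = 1 then 1 else 0) = inv_square N * (\<Sum>d | d dvd N. moebius_fun d)"
      using sum_moebius_fun_divisors by (simp add: inv_square_def)
  qed
  also have "\<dots> = (\<Sum>(N, d)\<in>(SIGMA N:A. {d. d dvd N}). inv_square N * moebius_fun d)"
    unfolding sum_distrib_left using finA by (intro sum.Sigma) (auto simp: A_def)
  also have "\<dots> = (\<Sum>(d, e)\<in>(SIGMA d:A. E d). inv_square (d * e) * moebius_fun d)"
  proof (rule sum.reindex_bij_witness[where i = "\<lambda>(d, e). (d * e, d)" and j = "\<lambda>(N, d). (d, N div d)"])
    fix x assume "x \<in> (SIGMA N:A. {d. d dvd N})"
    then obtain d e where x: "x = (d * e, d)" "d * e \<in> A" by (cases x) (auto elim: dvdE)
    then have pos: "d \<ge> 1" "e \<ge> 1" and cop: "coprime d m" "coprime e m" and less: "d * e < Y"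
      by (auto simp: A_def coprime_mult_left_iff)
    have "d \<le> d * e" using pos by simp
    then have "d < Y" using less by (rule le_less_trans)
    show "(case case x of (N, d) \<Rightarrow> (d, N div d) of (d, e) \<Rightarrow> (d * e, d)) = x" using x pos by simp
    show "(case x of (N, d) \<Rightarrow> (d, N div d)) \<in> (SIGMA d:A. E d)"
      using x pos cop less \<open>d < Y\<close> by (simp add: A_def E_def)
    show "(case case x of (N, d) \<Rightarrow> (d, N div d) of (d, e) \<Rightarrow> inv_square (d * e) * moebius_fun d)
        = (case x of (N, d) \<Rightarrow> inv_square N * moebius_fun d)" using x pos by simp
  next
    fix x assume "x \<in> (SIGMA d:A. E d)"
    then obtain d e where x: "x = (d, e)" "d \<in> A" "e \<in> E d" by blast
    then show "(case case x of (d, e) \<Rightarrow> (d * e, d) of (N, d) \<Rightarrow> (d, N div d)) = x"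
      by (simp add: A_def)
    have "1 * 1 \<le> d * e" using x by (intro mult_le_mono) (auto simp: A_def E_def)
    then show "(case x of (d, e) \<Rightarrow> (d * e, d)) \<in> (SIGMA N:A. {d. d dvd N})"
      using x by (simp add: A_def E_def)
  qed
  also have "\<dots> = (\<Sum>d\<in>A. \<Sum>e\<in>E d. inv_square (d * e) * moebius_fun d)"
    using finA finE by (intro sum.Sigma[symmetric]) auto
  also have "\<dots> = (\<Sum>d\<in>A. moebius_fun d * inv_square d * sum inv_square (E d))"
    by (simp add: inv_square_mult sum_distrib_left mult_ac)
  finally have one: "1 = (\<Sum>d\<in>A. moebius_fun d * inv_square d * sum inv_square (E d))" .
  have tail: "\<bar>coprime_zeta m - sum inv_square (E d)\<bar> \<le> 2 * real d / real Y" if d: "d \<in> A" for d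
  proof -
    have d0: "d \<ge> 1" using d by (simp add: A_def)
    define R where "R = {e. e \<ge> 1 \<and> coprime e m \<and> \<not> d * e < Y}"
    define M where "M = (Y - 1) div d + 1"
    have ER: "{n. n \<ge> 1 \<and> coprime n m} = E d \<union> R" by (auto simp: E_def R_def)
    have "coprime_zeta m = infsum inv_square (E d) + infsum inv_square R"
      unfolding coprime_zeta_def ER
    proof (rule infsum_Un_disjoint)
      show "inv_square summable_on E d" "inv_square summable_on R"
        by (rule inv_square_summable, simp add: E_def R_def subset_iff)+
      show "E d \<inter> R = {}" by (auto simp: E_def R_def)
    qed
    then have 1: "coprime_zeta m - sum inv_square (E d) = infsum inv_square R" using finE[OF d] by simp
    have "R \<subseteq> {M..}"
    proof
      fix e assume "e \<in> R"
      then have "Y \<le> e * d" by (simp add: R_def mult.commute not_less)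
      then have "Y - 1 < e * d" using Y by linarith
      then have "(Y - 1) div d < e" using d0 by (simp add: less_mult_imp_div_less)
      then show "e \<in> {M..}" by (simp add: M_def)
    qed
    then have 2: "infsum inv_square R \<le> 2 / real M" by (intro infsum_inv_square_tail_le) (auto simp: M_def)
    have "Y \<le> d * M"
      using dividend_less_times_div[of d "Y - 1"] d0 Y by (simp add: M_def)
    then have "real Y \<le> real d * real M" by (metis of_nat_le_iff of_nat_mult)
    then have "2 / real M \<le> 2 * real d / real Y" using Y by (simp add: M_def field_simps)
    moreover have "0 \<le> infsum inv_square R" by (intro infsum_nonneg inv_square_nonneg)
    ultimately show ?thesis using 1 2 by linarith
  qed
  have "coprime_zeta m * (\<Sum>d\<in>A. moebius_fun d / (real d)\<^sup>2) - 1
      = (\<Sum>d\<in>A. moebius_fun d * inv_square d * (coprime_zeta m - sum inv_square (E d)))"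
  proof -
    have "coprime_zeta m * (\<Sum>d\<in>A. moebius_fun d / (real d)\<^sup>2) - (\<Sum>d\<in>A. moebius_fun d * inv_square d * sum inv_square (E d))
      = (\<Sum>d\<in>A. moebius_fun d * inv_square d * (coprime_zeta m - sum inv_square (E d)))"
    proof -
      have "moebius_fun d / (real d)\<^sup>2 = moebius_fun d * inv_square d" for d by (simp add: inv_square_def)
      then show ?thesis
        by (simp only: sum_distrib_right[of _ _ "coprime_zeta m"] right_diff_distrib sum_subtractf mult.commute[of "coprime_zeta m"])
    qed
    then show ?thesis using one by (simp only:)
  qed
  also have "\<bar>\<dots>\<bar> \<le> (\<Sum>d\<in>A. \<bar>moebius_fun d * inv_square d * (coprime_zeta m - sum inv_square (E d))\<bar>)"
    by (rule sum_abs)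
  also have "\<dots> \<le> (\<Sum>d\<in>A. 2 / real Y * (1 / real d))"
  proof (rule sum_mono)
    fix d assume d: "d \<in> A"
    have "\<bar>moebius_fun d * inv_square d * (coprime_zeta m - sum inv_square (E d))\<bar>
        \<le> 1 * inv_square d * (2 * real d / real Y)"
      unfolding abs_mult using abs_moebius_fun_le[of d] tail[OF d] inv_square_nonneg[of d]
      by (intro mult_mono) auto
    also have "\<dots> = 2 / real Y * (1 / real d)"
      using d by (simp add: inv_square_def power2_eq_square A_def)
    finally show "\<bar>moebius_fun d * inv_square d * (coprime_zeta m - sum inv_square (E d))\<bar> \<le> 2 / real Y * (1 / real d)" .
  qed
  also have "\<dots> = 2 / real Y * (\<Sum>d\<in>A. 1 / real d)" by (rule sum_distrib_left[symmetric])
  also have "\<dots> \<le> 2 / real Y * (2 * sqrt (real Y))"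
  proof (rule mult_left_mono)
    have "(\<Sum>d\<in>A. 1 / real d) \<le> (\<Sum>d\<in>{1..<Suc Y}. 1 / real d)" by (rule sum_mono2) (auto simp: A_def)
    also have "\<dots> \<le> 2 * sqrt (real Y)" by (rule sum_inverse_le)
    finally show "(\<Sum>d\<in>A. 1 / real d) \<le> 2 * sqrt (real Y)" .
  qed simp
  also have "\<dots> = 4 / sqrt (real Y)"
  proof -
    define y where "y = sqrt (real Y)"
    have y: "y > 0" "real Y = y * y" using Y by (simp_all add: y_def)
    show ?thesis unfolding y_def[symmetric] unfolding y(2) using y(1) by (simp add: field_simps)
  qed
  finally show ?thesis unfolding A_def .
qed

section \<open>Counting squarefree palindromes\<close>

context
  fixes b :: nat
  assumes b2: "b \<ge> 2"
begin

lemma restricted_palindromes_upto_eq: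
  assumes "x \<ge> 0"
  shows "restricted_palindromes_upto b x
    = {n. (\<exists>k. n \<in> pal b k) \<and> coprime n (b ^ 3 - b) \<and> n \<le> nat \<lfloor>x\<rfloor>}"
proof -
  have "n \<in> palindromes b \<and> coprime n (b ^ 3 - b) \<longleftrightarrow> (\<exists>k. n \<in> pal b k) \<and> coprime n (b ^ 3 - b)" for n
    using restricted_palindromes_eq[OF b2, of n] by auto
  moreover have "real n \<le> x \<longleftrightarrow> n \<le> nat \<lfloor>x\<rfloor>" for n using assms by linarith
  ultimately show ?thesis
    unfolding restricted_palindromes_upto_def palindromes_upto_def coprime_iff_gcd_eq_1[symmetric] by auto
qed

text \<open>
  Being coprime to \<open>b\<close> excludes leading zeros, so these are restricted palindromes with exactly
  \<open>2 k + 1\<close> digits.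
\<close>
definition shell :: "nat \<Rightarrow> nat \<Rightarrow> nat set" where
  "shell X k = {n \<in> pal b k. coprime n (b ^ 3 - b) \<and> n \<le> X}"

lemma finite_shell [simp]: "finite (shell X k)" using b2 by (simp add: shell_def)

lemma coprime_base: "coprime n (b ^ 3 - b) \<Longrightarrow> coprime n b"
  by (rule coprime_divisors[OF dvd_refl dvd_cube_minus(1)[OF b2]])

lemma shell_bounds:
  assumes "n \<in> shell X k"
  shows "b ^ (2 * k) \<le> n" "n < b ^ (2 * k + 1)" "n > 0"
proof -
  have "coprime n b" using assms coprime_base by (simp add: shell_def)
  then have "\<not> b dvd n" using b2 by (metis coprime_common_divisor dvd_refl nat_dvd_1_iff_1 numeral_le_one_iff semiring_norm(69))
  then show "b ^ (2 * k) \<le> n" using pal_lower[OF b2, of n k] assms by (simp add: shell_def)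
  moreover have "0 < b ^ (2 * k)" using b2 by simp
  ultimately show "n > 0" by linarith
  show "n < b ^ (2 * k + 1)" using pal_less[OF b2, of n k] assms by (simp add: shell_def)
qed

lemma shell_disjoint: "k \<noteq> k' \<Longrightarrow> shell X k \<inter> shell X k' = {}"
proof (induction k k' rule: linorder_wlog)
  case (le k k')
  have "b ^ (2 * k + 1) \<le> b ^ (2 * k')" using le b2 by (intro power_increasing) auto
  then show ?case using shell_bounds(1)[of _ X k'] shell_bounds(2)[of _ X k] by force
qed (simp add: Int_commute)

lemma restricted_palindromes_upto_Union:
  assumes "x \<ge> 0" "nat \<lfloor>x\<rfloor> < b ^ (2 * K + 2)"
  shows "restricted_palindromes_upto b x = (\<Union>k\<le>K. shell (nat \<lfloor>x\<rfloor>) k)"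
proof -
  have "k \<le> K" if n: "n \<in> shell (nat \<lfloor>x\<rfloor>) k" for n k
  proof -
    have "b ^ (2 * k) < b ^ (2 * K + 2)" using shell_bounds(1)[OF n] assms(2) n by (simp add: shell_def)
    then have "2 * k < 2 * K + 2" using b2 by (simp only: power_strict_increasing_iff)
    then show ?thesis by simp
  qed
  moreover have "restricted_palindromes_upto b x = (\<Union>k. shell (nat \<lfloor>x\<rfloor>) k)"
    unfolding restricted_palindromes_upto_eq[OF assms(1)] by (auto simp: shell_def)
  ultimately show ?thesis by auto
qed

lemma card_Union_shell_filter:
  "card {n \<in> (\<Union>k\<le>K. shell X k). P n} = (\<Sum>k\<le>K. card {n \<in> shell X k. P n})"
proof -
  have "{n \<in> (\<Union>k\<le>K. shell X k). P n} = (\<Union>k\<le>K. {n \<in> shell X k. P n})" by auto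
  moreover have "card (\<Union>k\<le>K. {n \<in> shell X k. P n}) = (\<Sum>k\<le>K. card {n \<in> shell X k. P n})"
    using shell_disjoint[of _ _ X] by (intro card_UN_disjoint) auto
  ultimately show ?thesis by simp
qed

lemma sum_powers_le: "(\<Sum>k\<le>K. real b ^ k) \<le> 2 * real b ^ K"
proof (induction K)
  case (Suc K)
  have "2 * real b ^ K \<le> real b * real b ^ K" using b2 by (intro mult_right_mono) auto
  then show ?case using Suc by simp
qed simp

lemma card_Union_shell_le: "real (card (\<Union>k\<le>K. shell X k)) \<le> 2 * real b * real b ^ K"
proof -
  have "card (\<Union>k\<le>K. shell X k) \<le> (\<Sum>k\<le>K. card (shell X k))" by (intro card_UN_le) simp
  also have "\<dots> \<le> (\<Sum>k\<le>K. b ^ (k + 1))"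
  proof (rule sum_mono)
    fix k
    have "card (shell X k) \<le> card (pal b k)" using b2 by (intro card_mono) (auto simp: shell_def)
    then show "card (shell X k) \<le> b ^ (k + 1)" by (simp only: card_pal[OF b2])
  qed
  finally have "real (card (\<Union>k\<le>K. shell X k)) \<le> real (\<Sum>k\<le>K. b ^ (k + 1))" by (simp only: of_nat_le_iff)
  also have "\<dots> = real b * (\<Sum>k\<le>K. real b ^ k)" by (simp add: sum_distrib_left)
  also have "\<dots> \<le> real b * (2 * real b ^ K)" by (intro mult_left_mono sum_powers_le) simp
  finally show ?thesis by (simp add: mult_ac)
qed

text \<open>
  The largest even \<open>k\<close> below \<open>K\<close> gives enough palindromes, all of them below \<open>b^(2K)\<close>. For \<open>K < 5\<close>
  the number 1 suffices.
\<close>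
lemma card_Union_shell_ge:
  assumes X: "X \<ge> 1" "b ^ (2 * K) \<le> X"
  shows "real b ^ K \<le> real b ^ 6 * real (card (\<Union>k\<le>K. shell X k))"
proof (cases "K < 5")
  case True
  have "1 \<in> shell X 0" using X b2 by (simp add: shell_def)
  then have "1 \<in> (\<Union>k\<le>K. shell X k)" by blast
  then have "card (\<Union>k\<le>K. shell X k) \<noteq> 0" by (subst card_0_eq) auto
  then have "1 \<le> real (card (\<Union>k\<le>K. shell X k))" by linarith
  moreover have "real b ^ K \<le> real b ^ 6" using True b2 by (intro power_increasing) auto
  ultimately have "real b ^ K * 1 \<le> real b ^ 6 * real (card (\<Union>k\<le>K. shell X k))"
    by (intro mult_mono) auto
  then show ?thesis by simp
next
  case False
  define k where "k = (if even K then K - 2 else K - 1)"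
  have k: "even k" "k \<ge> 3" "k < K" "K \<le> 6 + (k - 3)" using False by (auto simp: k_def)
  have "{n \<in> pal b k. coprime n (b ^ 3 - b)} \<subseteq> (\<Union>k\<le>K. shell X k)"
  proof
    fix n assume n: "n \<in> {n \<in> pal b k. coprime n (b ^ 3 - b)}"
    then have "n < b ^ (2 * k + 1)" using pal_less[OF b2] by blast
    also have "\<dots> \<le> b ^ (2 * K)" using k b2 by (intro power_increasing) auto
    finally have "n \<in> shell X k" using X n by (simp add: shell_def)
    then show "n \<in> (\<Union>k\<le>K. shell X k)" using k(3) by (intro UN_I[of k]) auto
  qed
  then have "card {n \<in> pal b k. coprime n (b ^ 3 - b)} \<le> card (\<Union>k\<le>K. shell X k)"
    by (intro card_mono) auto
  then have "b ^ (k - 3) \<le> card (\<Union>k\<le>K. shell X k)"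
    using card_coprime_palindromes_ge[OF b2 k(1,2)] by linarith
  then have "real (b ^ (k - 3)) \<le> real (card (\<Union>k\<le>K. shell X k))" by (simp only: of_nat_le_iff)
  then have 1: "real b ^ 6 * real b ^ (k - 3) \<le> real b ^ 6 * real (card (\<Union>k\<le>K. shell X k))"
    by (intro mult_left_mono) auto
  have "real b ^ K \<le> real b ^ (6 + (k - 3))" using k b2 by (intro power_increasing) auto
  then show ?thesis using 1 by (simp add: power_add)
qed

lemma equidistribution_sum:
  assumes q: "q > 0" "coprime q (b ^ 3 - b)" and w: "real q \<le> (3 / 2) ^ w"
  shows "\<bar>real (card {n \<in> (\<Union>k\<le>K. shell X k). q dvd n}) - real (card (\<Union>k\<le>K. shell X k)) / real q\<bar>
    \<le> real (b ^ 3 - b) * real b ^ 2 * real (K + 1) ^ 2 * (real b ^ K * contraction b ^ (K div (w + 3)))"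
proof -
  define m where "m = b ^ 3 - b"
  have "\<bar>real (card {n \<in> (\<Union>k\<le>K. shell X k). q dvd n}) - real (card (\<Union>k\<le>K. shell X k)) / real q\<bar>
    = \<bar>\<Sum>k\<le>K. real (card {n \<in> shell X k. q dvd n}) - real (card (shell X k)) / real q\<bar>"
  proof -
    have "card (\<Union>k\<le>K. shell X k) = (\<Sum>k\<le>K. card (shell X k))"
      using card_Union_shell_filter[where X = X and K = K and P = "\<lambda>_. True"]
      by (simp only: simp_thms Collect_mem_eq)
    then show ?thesis
      by (simp only: card_Union_shell_filter of_nat_sum sum_divide_distrib sum_subtractf)
  qed
  also have "\<dots> \<le> (\<Sum>k\<le>K. \<bar>real (card {n \<in> shell X k. q dvd n}) - real (card (shell X k)) / real q\<bar>)"
    by (rule sum_abs)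
  also have "\<dots> \<le> (\<Sum>k\<le>K. real m * (real (K + 1) * (real b ^ 2 * (real b ^ K * contraction b ^ (K div (w + 3))))))"
  proof (rule sum_mono)
    fix k assume k: "k \<in> {..K}"
    have "{n \<in> shell X k. q dvd n} = {n \<in> pal b k. coprime n m \<and> n \<le> X \<and> q dvd n}"
      by (auto simp: shell_def m_def)
    then have "\<bar>real (card {n \<in> shell X k. q dvd n}) - real (card (shell X k)) / real q\<bar>
      \<le> real m * (real (k + 1) * (real b ^ (k + 2) * contraction b ^ (k div (w + 3))))"
      using equidistribution_mod[OF b2 q w, of k X] unfolding shell_def m_def by simp
    also have "\<dots> \<le> real m * (real (K + 1) * (real b ^ 2 * (real b ^ K * contraction b ^ (K div (w + 3)))))"
    proof (rule mult_left_mono, rule mult_mono)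
      have "real b ^ k * contraction b ^ (k div (w + 3)) \<le> real b ^ K * contraction b ^ (K div (w + 3))"
        using k by (intro power_times_contraction_mono[OF b2]) simp
      then have "real b ^ 2 * (real b ^ k * contraction b ^ (k div (w + 3))) \<le> real b ^ 2 * (real b ^ K * contraction b ^ (K div (w + 3)))"
        by (intro mult_left_mono) auto
      then show "real b ^ (k + 2) * contraction b ^ (k div (w + 3)) \<le> real b ^ 2 * (real b ^ K * contraction b ^ (K div (w + 3)))"
        by (simp only: power_add mult_ac)
    qed (use k contraction_bounds(1)[OF b2] in auto)
    finally show "\<bar>real (card {n \<in> shell X k. q dvd n}) - real (card (shell X k)) / real q\<bar>
      \<le> real m * (real (K + 1) * (real b ^ 2 * (real b ^ K * contraction b ^ (K div (w + 3)))))" .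
  qed
  also have "\<dots> = real m * real b ^ 2 * real (K + 1) ^ 2 * (real b ^ K * contraction b ^ (K div (w + 3)))"
    by (simp add: power2_eq_square mult_ac)
  finally show ?thesis unfolding m_def .
qed

lemma square_divisor_tail_le:
  assumes u0: "u0 \<ge> 1"
  shows "(\<Sum>d\<in>{b ^ (48 * u0)..<b ^ (K + 1)}. real (card {n \<in> (\<Union>k\<le>K. shell X k). d\<^sup>2 dvd n}))
    \<le> 48 * real b ^ 51 * (real b ^ K / real b ^ u0) + real (K + 1) * real b ^ (3 * K div 4 + 8)"
proof -
  let ?D = "{b ^ (48 * u0)..<b ^ (K + 1)}"
  have "(\<Sum>d\<in>?D. real (card {n \<in> (\<Union>k\<le>K. shell X k). d\<^sup>2 dvd n}))
    = (\<Sum>k\<le>K. \<Sum>d\<in>?D. real (card {n \<in> shell X k. d\<^sup>2 dvd n}))"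
    unfolding card_Union_shell_filter of_nat_sum by (rule sum.swap)
  also have "\<dots> \<le> (\<Sum>k\<le>K. 24 * real b ^ 51 * (real b ^ k / real b ^ u0) + real b ^ (3 * K div 4 + 8))"
  proof (rule sum_mono)
    fix k assume k: "k \<in> {..K}"
    let ?D' = "{b ^ (48 * u0)..<b ^ (k + 1)}"
    have "(\<Sum>d\<in>?D. real (card {n \<in> shell X k. d\<^sup>2 dvd n})) = (\<Sum>d\<in>?D'. real (card {n \<in> shell X k. d\<^sup>2 dvd n}))"
    proof (rule sum.mono_neutral_right)
      have "b ^ (k + 1) \<le> b ^ (K + 1)" using k b2 by (intro power_increasing) auto
      then show "?D' \<subseteq> ?D" by auto
      show "\<forall>d\<in>?D - ?D'. real (card {n \<in> shell X k. d\<^sup>2 dvd n}) = 0"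
      proof
        fix d assume "d \<in> ?D - ?D'"
        then have "b ^ (k + 1) \<le> d" by auto
        then have "(b ^ (k + 1))\<^sup>2 \<le> d\<^sup>2" by (rule power_mono) simp
        moreover have "(b ^ (k + 1))\<^sup>2 = b ^ (2 * k + 2)"
        proof -
          have "2 * k + 2 = (k + 1) * 2" by simp
          then show ?thesis by (simp only: power_mult)
        qed
        moreover have "b ^ (2 * k + 1) \<le> b ^ (2 * k + 2)" using b2 by (intro power_increasing) auto
        ultimately have le: "b ^ (2 * k + 1) \<le> d\<^sup>2" by linarith
        have "{n \<in> shell X k. d\<^sup>2 dvd n} = {}"
        proof (intro equals0I)
          fix n assume n: "n \<in> {n \<in> shell X k. d\<^sup>2 dvd n}"
          then have "d\<^sup>2 \<le> n" using shell_bounds(3)[of n X k] by (intro dvd_imp_le) auto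
          then show False using n shell_bounds(2)[of n X k] le by simp
        qed
        then show "real (card {n \<in> shell X k. d\<^sup>2 dvd n}) = 0" by (simp only: card.empty of_nat_0)
      qed
    qed simp
    also have "\<dots> \<le> (\<Sum>d\<in>?D'. real (card {n \<in> pal b k. coprime n b \<and> d\<^sup>2 dvd n}))"
      using b2 coprime_base by (intro sum_mono of_nat_mono card_mono) (auto simp: shell_def)
    also have "\<dots> \<le> 24 * real b ^ 51 * (real b ^ k / real b ^ u0) + real b ^ (3 * k div 4 + 8)"
      by (rule sum_tail_square_divisors_le[OF b2 u0])
    also have "\<dots> \<le> 24 * real b ^ 51 * (real b ^ k / real b ^ u0) + real b ^ (3 * K div 4 + 8)"
      using b2 k by (intro add_left_mono power_increasing) (auto intro!: div_le_mono)
    finally show "(\<Sum>d\<in>?D. real (card {n \<in> shell X k. d\<^sup>2 dvd n}))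
      \<le> 24 * real b ^ 51 * (real b ^ k / real b ^ u0) + real b ^ (3 * K div 4 + 8)" .
  qed
  also have "\<dots> = 24 * real b ^ 51 * ((\<Sum>k\<le>K. real b ^ k) / real b ^ u0) + real (K + 1) * real b ^ (3 * K div 4 + 8)"
    by (simp add: sum.distrib sum_distrib_left sum_divide_distrib)
  also have "\<dots> \<le> 24 * real b ^ 51 * ((2 * real b ^ K) / real b ^ u0) + real (K + 1) * real b ^ (3 * K div 4 + 8)"
    by (intro add_right_mono mult_left_mono divide_right_mono sum_powers_le) auto
  finally show ?thesis by simp
qed

lemma card_squarefree_eq_moebius_sum:
  "real (card {n \<in> (\<Union>k\<le>K. shell X k). squarefree n})
    = (\<Sum>d\<in>{1..<b ^ (K + 1)}. moebius_fun d * real (card {n \<in> (\<Union>k\<le>K. shell X k). d\<^sup>2 dvd n}))"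
proof -
  define R where "R = (\<Union>k\<le>K. shell X k)"
  have finR: "finite R" by (simp add: R_def)
  have sub: "{d. d\<^sup>2 dvd n} \<subseteq> {1..<b ^ (K + 1)}" if n: "n \<in> R" for n
  proof
    fix d assume "d \<in> {d. d\<^sup>2 dvd n}"
    then have d: "d\<^sup>2 dvd n" by simp
    obtain k where k: "k \<le> K" "n \<in> shell X k" using n by (auto simp: R_def)
    have n0: "n > 0" by (rule shell_bounds(3)[OF k(2)])
    then have "d > 0" using d by (intro gr0I) auto
    have "d\<^sup>2 \<le> n" using d n0 by (rule dvd_imp_le)
    also have "n < b ^ (2 * k + 1)" by (rule shell_bounds(2)[OF k(2)])
    also have "\<dots> \<le> b ^ ((K + 1) * 2)" using k(1) b2 by (intro power_increasing) auto
    finally have "d\<^sup>2 < (b ^ (K + 1))\<^sup>2" by (simp only: power_mult)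
    then have "d < b ^ (K + 1)" by (rule power_less_imp_less_base) simp
    then show "d \<in> {1..<b ^ (K + 1)}" using \<open>d > 0\<close> by simp
  qed
  have "real (card {n \<in> R. squarefree n}) = (\<Sum>n\<in>R. if squarefree n then 1 else 0)"
    using finR by (simp add: sum.If_cases Int_def)
  also have "\<dots> = (\<Sum>n\<in>R. \<Sum>d | d\<^sup>2 dvd n. moebius_fun d)"
  proof (rule sum.cong[OF refl])
    fix n assume "n \<in> R"
    then have "n > 0" using shell_bounds(3) by (auto simp: R_def)
    then show "(if squarefree n then 1 else 0) = (\<Sum>d | d\<^sup>2 dvd n. moebius_fun d)"
      by (rule sum_moebius_fun_square_divisors[symmetric])
  qed
  also have "\<dots> = (\<Sum>n\<in>R. \<Sum>d\<in>{1..<b ^ (K + 1)}. if d\<^sup>2 dvd n then moebius_fun d else 0)"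
  proof (rule sum.cong[OF refl])
    fix n assume n: "n \<in> R"
    have "{d \<in> {1..<b ^ (K + 1)}. d\<^sup>2 dvd n} = {d. d\<^sup>2 dvd n}" using sub[OF n] by auto
    then show "(\<Sum>d | d\<^sup>2 dvd n. moebius_fun d) = (\<Sum>d\<in>{1..<b ^ (K + 1)}. if d\<^sup>2 dvd n then moebius_fun d else 0)"
      using sum.inter_filter[of "{1..<b ^ (K + 1)}" moebius_fun "\<lambda>d. d\<^sup>2 dvd n"] by simp
  qed
  also have "\<dots> = (\<Sum>d\<in>{1..<b ^ (K + 1)}. \<Sum>n\<in>R. if d\<^sup>2 dvd n then moebius_fun d else 0)" by (rule sum.swap)
  also have "\<dots> = (\<Sum>d\<in>{1..<b ^ (K + 1)}. moebius_fun d * real (card {n \<in> R. d\<^sup>2 dvd n}))"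
    using finR by (intro sum.cong refl) (simp add: sum.If_cases Int_def)
  finally show ?thesis unfolding R_def .
qed

text \<open>
  The three error terms come from \<open>d\<close> below \<open>b^(48 u0)\<close>, where equidistribution is used; from
  completing the sum of \<open>\<mu>(d) / d^2\<close>; and from the palindromes divisible by the square of some larger
  \<open>d\<close>.
\<close>
lemma squarefree_count_error:
  fixes u0 w K X :: nat
  assumes u0: "u0 \<ge> 1" and w: "real b ^ (96 * u0) \<le> (3 / 2) ^ w"
  defines "N \<equiv> real (card (\<Union>k\<le>K. shell X k))"
  shows "\<bar>real (card {n \<in> (\<Union>k\<le>K. shell X k). squarefree n}) - N / coprime_zeta (b ^ 3 - b)\<bar>
    \<le> real b ^ (48 * u0) * (real (b ^ 3 - b) * real b ^ 2 * real (K + 1) ^ 2 * (real b ^ K * contraction b ^ (K div (w + 3))))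
      + N * (4 / real b ^ (24 * u0))
      + (48 * real b ^ 51 * (real b ^ K / real b ^ u0) + real (K + 1) * real b ^ (3 * K div 4 + 8))"
proof -
  define R where "R = (\<Union>k\<le>K. shell X k)"
  define m where "m = b ^ 3 - b"
  define Z where "Z = coprime_zeta m"
  have Z1: "Z \<ge> 1" unfolding Z_def by (rule coprime_zeta_ge_1)
  define Y where "Y = b ^ (48 * u0)"
  define D where "D = b ^ (K + 1)"
  define S where "S d = real (card {n \<in> R. d\<^sup>2 dvd n})" for d
  define err where "err = real m * real b ^ 2 * real (K + 1) ^ 2 * (real b ^ K * contraction b ^ (K div (w + 3)))"
  have Y2: "Y \<ge> 2"
  proof -
    have "b ^ 1 \<le> b ^ (48 * u0)" using u0 b2 by (intro power_increasing) auto
    then show ?thesis using b2 by (simp add: Y_def)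
  qed
  have S0: "S d = 0" if "d \<ge> D \<or> \<not> coprime d m" "d \<ge> 1" for d
  proof -
    have "{n \<in> R. d\<^sup>2 dvd n} = {}"
    proof (intro equals0I)
      fix n assume n: "n \<in> {n \<in> R. d\<^sup>2 dvd n}"
      then obtain k where k: "k \<le> K" "n \<in> shell X k" by (auto simp: R_def)
      have "coprime n m" using k by (simp add: shell_def m_def)
      then have "coprime (d\<^sup>2) m" using n by (intro coprime_divisors[of "d\<^sup>2" n m m]) auto
      then have "d \<ge> D" using that by simp
      then have "D\<^sup>2 \<le> d\<^sup>2" by (rule power_mono) simp
      also have "d\<^sup>2 \<le> n" using n shell_bounds(3)[OF k(2)] by (intro dvd_imp_le) auto
      also have "n < b ^ (2 * k + 1)" by (rule shell_bounds(2)[OF k(2)])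
      also have "\<dots> \<le> b ^ ((K + 1) * 2)" using k(1) b2 by (intro power_increasing) auto
      also have "\<dots> = D\<^sup>2" by (simp only: D_def power_mult)
      finally show False by simp
    qed
    then show ?thesis unfolding S_def by (simp only: card.empty of_nat_0)
  qed
  have Ssum: "(\<Sum>d\<in>A. moebius_fun d * S d) = (\<Sum>d\<in>B. moebius_fun d * S d)"
    if "finite B" "A \<subseteq> B" "\<And>d. d \<in> B - A \<Longrightarrow> (d \<ge> D \<or> \<not> coprime d m) \<and> d \<ge> 1" for A B
    using that S0 by (intro sum.mono_neutral_left) auto
  define A where "A = {d \<in> {1..<Y}. coprime d m}"
  have "real (card {n \<in> R. squarefree n}) = (\<Sum>d\<in>{1..<D}. moebius_fun d * S d)"
    unfolding R_def D_def S_def by (rule card_squarefree_eq_moebius_sum)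
  also have "\<dots> = (\<Sum>d\<in>{1..<Y} \<union> {Y..<D}. moebius_fun d * S d)" using Y2 by (intro Ssum) auto
  also have "\<dots> = (\<Sum>d\<in>{1..<Y}. moebius_fun d * S d) + (\<Sum>d\<in>{Y..<D}. moebius_fun d * S d)"
    by (rule sum.union_disjoint) auto
  also have "(\<Sum>d\<in>{1..<Y}. moebius_fun d * S d) = (\<Sum>d\<in>A. moebius_fun d * S d)"
    by (rule Ssum[symmetric]) (auto simp: A_def)
  finally have Q: "real (card {n \<in> R. squarefree n}) = (\<Sum>d\<in>A. moebius_fun d * S d) + (\<Sum>d\<in>{Y..<D}. moebius_fun d * S d)" .
  have tail: "\<bar>\<Sum>d\<in>{Y..<D}. moebius_fun d * S d\<bar> \<le> 48 * real b ^ 51 * (real b ^ K / real b ^ u0) + real (K + 1) * real b ^ (3 * K div 4 + 8)"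
  proof -
    have "\<bar>\<Sum>d\<in>{Y..<D}. moebius_fun d * S d\<bar> \<le> (\<Sum>d\<in>{Y..<D}. \<bar>moebius_fun d * S d\<bar>)" by (rule sum_abs)
    also have "\<dots> \<le> (\<Sum>d\<in>{Y..<D}. S d)"
    proof (rule sum_mono)
      fix d
      have "\<bar>moebius_fun d\<bar> * \<bar>S d\<bar> \<le> 1 * \<bar>S d\<bar>" using abs_moebius_fun_le by (intro mult_right_mono) auto
      then show "\<bar>moebius_fun d * S d\<bar> \<le> S d" by (simp add: abs_mult S_def)
    qed
    also have "\<dots> \<le> 48 * real b ^ 51 * (real b ^ K / real b ^ u0) + real (K + 1) * real b ^ (3 * K div 4 + 8)"
      unfolding Y_def D_def S_def R_def by (rule square_divisor_tail_le[OF u0])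
    finally show ?thesis .
  qed
  have err0: "err \<ge> 0" unfolding err_def using contraction_bounds(1)[OF b2] by simp
  have small: "\<bar>(\<Sum>d\<in>A. moebius_fun d * S d) - (\<Sum>d\<in>A. moebius_fun d * (N / (real d)\<^sup>2))\<bar> \<le> real Y * err"
  proof -
    have "\<bar>(\<Sum>d\<in>A. moebius_fun d * S d) - (\<Sum>d\<in>A. moebius_fun d * (N / (real d)\<^sup>2))\<bar>
      = \<bar>\<Sum>d\<in>A. moebius_fun d * (S d - N / (real d)\<^sup>2)\<bar>"
      by (simp add: sum_subtractf right_diff_distrib)
    also have "\<dots> \<le> (\<Sum>d\<in>A. \<bar>moebius_fun d * (S d - N / (real d)\<^sup>2)\<bar>)" by (rule sum_abs)
    also have "\<dots> \<le> (\<Sum>d\<in>A. err)"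
    proof (rule sum_mono)
      fix d assume d: "d \<in> A"
      have "real (d\<^sup>2) \<le> (3 / 2) ^ w"
      proof -
        have "d\<^sup>2 \<le> Y\<^sup>2" using d by (intro power_mono) (auto simp: A_def)
        also have "\<dots> = b ^ (96 * u0)" by (simp add: Y_def flip: power_mult)
        finally have "real (d\<^sup>2) \<le> real (b ^ (96 * u0))" by (simp only: of_nat_le_iff)
        then show ?thesis using w by simp
      qed
      then have "\<bar>S d - N / real (d\<^sup>2)\<bar> \<le> err"
        unfolding S_def N_def err_def R_def m_def using d
        by (intro equidistribution_sum) (auto simp: A_def m_def)
      then have "\<bar>moebius_fun d\<bar> * \<bar>S d - N / (real d)\<^sup>2\<bar> \<le> 1 * err"
        using abs_moebius_fun_le by (intro mult_mono) auto
      then show "\<bar>moebius_fun d * (S d - N / (real d)\<^sup>2)\<bar> \<le> err" by (simp add: abs_mult)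
    qed
    also have "\<dots> = real (card A) * err" by simp
    also have "\<dots> \<le> real Y * err"
    proof (rule mult_right_mono[OF _ err0])
      have "card A \<le> card {1..<Y}" by (intro card_mono) (auto simp: A_def)
      then show "real (card A) \<le> real Y" by simp
    qed
    finally show ?thesis .
  qed
  have main: "\<bar>(\<Sum>d\<in>A. moebius_fun d * (N / (real d)\<^sup>2)) - N / Z\<bar> \<le> N * (4 / real b ^ (24 * u0))"
  proof -
    define \<Sigma> where "\<Sigma> = (\<Sum>d\<in>A. moebius_fun d / (real d)\<^sup>2)"
    have 1: "\<bar>Z * \<Sigma> - 1\<bar> \<le> 4 / sqrt (real Y)"
      unfolding Z_def \<Sigma>_def A_def by (rule moebius_partial_sum[OF Y2])
    have "sqrt (real Y) = real b ^ (24 * u0)"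
    proof -
      have "real Y = (real b ^ (24 * u0))\<^sup>2" by (simp add: Y_def flip: power_mult)
      then show ?thesis by simp
    qed
    with 1 have 2: "\<bar>Z * \<Sigma> - 1\<bar> \<le> 4 / real b ^ (24 * u0)" by simp
    have "\<Sigma> - 1 / Z = (Z * \<Sigma> - 1) / Z" using Z1 by (simp add: field_simps)
    then have "\<bar>\<Sigma> - 1 / Z\<bar> = \<bar>Z * \<Sigma> - 1\<bar> / Z" using Z1 by simp
    also have "\<dots> \<le> \<bar>Z * \<Sigma> - 1\<bar> / 1" using Z1 by (intro divide_left_mono) auto
    finally have 3: "\<bar>\<Sigma> - 1 / Z\<bar> \<le> 4 / real b ^ (24 * u0)" using 2 by simp
    have "(\<Sum>d\<in>A. moebius_fun d * (N / (real d)\<^sup>2)) - N / Z = N * (\<Sigma> - 1 / Z)"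
      by (simp add: \<Sigma>_def sum_distrib_left right_diff_distrib mult_ac)
    then have "\<bar>(\<Sum>d\<in>A. moebius_fun d * (N / (real d)\<^sup>2)) - N / Z\<bar> = N * \<bar>\<Sigma> - 1 / Z\<bar>"
      by (simp add: abs_mult N_def)
    also have "\<dots> \<le> N * (4 / real b ^ (24 * u0))" using 3 by (intro mult_left_mono) (auto simp: N_def)
    finally show ?thesis .
  qed
  have "\<bar>real (card {n \<in> R. squarefree n}) - N / Z\<bar> \<le> real Y * err + N * (4 / real b ^ (24 * u0))
      + (48 * real b ^ 51 * (real b ^ K / real b ^ u0) + real (K + 1) * real b ^ (3 * K div 4 + 8))"
    using Q tail small main by linarith
  then show ?thesis unfolding R_def Z_def m_def err_def Y_def by simp
qed

end

section \<open>Growth estimates\<close>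

lemma bounded_of_tendsto_0:
  fixes f :: "nat \<Rightarrow> real"
  assumes "f \<longlonglongrightarrow> 0"
  shows "\<exists>C. \<forall>n. f n \<le> C"
proof -
  have "Bseq f" using assms by (intro convergent_imp_Bseq) (auto simp: convergent_def)
  then obtain C where C: "\<forall>n. norm (f n) \<le> C" by (elim BseqE)
  have "f n \<le> C" for n using spec[OF C, of n] abs_ge_self[of "f n"] by simp
  then show ?thesis by (intro exI[of _ C]) simp
qed

lemma polynomial_times_geometric_bounded:
  fixes M :: nat
  assumes b: "b \<ge> (2::nat)"
  shows "\<exists>C. \<forall>K. real (K + 1) ^ M * (real b ^ (3 * K div 4) / real b ^ K) \<le> C"
proof -
  have "(\<lambda>K. real (K + 1) powr real M * 2 powr (- real K / 4)) \<longlonglongrightarrow> 0" by real_asymp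
  from bounded_of_tendsto_0[OF this] obtain C where
    C: "\<And>K. real (K + 1) powr real M * 2 powr (- real K / 4) \<le> C" by blast
  have "real (K + 1) ^ M * (real b ^ (3 * K div 4) / real b ^ K) \<le> C" for K
  proof -
    define j where "j = K - 3 * K div 4"
    have j: "K = 3 * K div 4 + j" "real K / 4 \<le> real j" unfolding j_def by linarith+
    have "real b ^ K = real b ^ (3 * K div 4) * real b ^ j" by (subst j(1)) (rule power_add)
    then have "real b ^ (3 * K div 4) / real b ^ K = 1 / real b ^ j" using b by simp
    also have "\<dots> \<le> 1 / 2 ^ j" using b by (intro divide_left_mono power_mono) auto
    also have "\<dots> = 2 powr (- real j)" by (simp add: powr_minus powr_realpow divide_inverse)
    also have "\<dots> \<le> 2 powr (- real K / 4)" using j(2) by simp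
    finally have "real (K + 1) ^ M * (real b ^ (3 * K div 4) / real b ^ K) \<le> real (K + 1) ^ M * 2 powr (- real K / 4)"
      by (intro mult_left_mono) auto
    also have "\<dots> = real (K + 1) powr real M * 2 powr (- real K / 4)" by (simp add: powr_realpow)
    finally show ?thesis using C[of K] by linarith
  qed
  then show ?thesis by blast
qed

text \<open>
  The equidistribution error gains a constant factor every \<open>W\<close> digits, with \<open>W\<close> logarithmic in \<open>K\<close>.
  The total gain \<open>\<kappa>^(K / W)\<close> beats every power of \<open>K\<close>.
\<close>
lemma polynomial_times_contraction_bounded:
  fixes M :: nat and \<kappa> c1 c2 :: real
  assumes \<kappa>: "0 < \<kappa>" "\<kappa> < 1" and c: "c1 > 0" "c2 > 0"
  shows "\<exists>C. \<forall>K W. 0 < W \<and> real W \<le> c1 + c2 * ln (real (K + 1)) \<longrightarrow> real (K + 1) ^ M * \<kappa> ^ (K div W) \<le> C"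
proof -
  define l where "l = - ln \<kappa>"
  have l: "l > 0" using \<kappa> by (simp add: l_def)
  have "(\<lambda>K. real (K + 1) powr real M * exp (- l * (real K / (c1 + c2 * ln (real (K + 1)))))) \<longlonglongrightarrow> 0"
    using l c by real_asymp
  from bounded_of_tendsto_0[OF this] obtain C where
    C: "\<And>K. real (K + 1) powr real M * exp (- l * (real K / (c1 + c2 * ln (real (K + 1))))) \<le> C" by blast
  have "real (K + 1) ^ M * \<kappa> ^ (K div W) \<le> exp l * C"
    if W: "0 < W" "real W \<le> c1 + c2 * ln (real (K + 1))" for K W
  proof -
    define V where "V = c1 + c2 * ln (real (K + 1))"
    have "K < W * (K div W + 1)" using dividend_less_times_div[of W K] W(1) by simp
    then have "real K < real (W * (K div W + 1))" by (simp only: of_nat_less_iff)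
    then have "real K < real W * (real (K div W) + 1)" by (simp only: of_nat_mult of_nat_add of_nat_1)
    also have "\<dots> \<le> V * (real (K div W) + 1)" using W(2) by (intro mult_right_mono) (auto simp: V_def)
    finally have "real K < V * (real (K div W) + 1)" .
    moreover have "V > 0" using W by (simp add: V_def)
    ultimately have "real K / V \<le> real (K div W) + 1" by (simp add: field_simps)
    then have "l * (real K / V) \<le> l * (real (K div W) + 1)" using l by (intro mult_left_mono) auto
    then have 1: "- l * real (K div W) \<le> l + - l * (real K / V)" by (simp add: distrib_left)
    have "\<kappa> ^ (K div W) = exp (- l * real (K div W))"
    proof -
      have "- l * real (K div W) = real (K div W) * ln \<kappa>" by (simp add: l_def)
      then show ?thesis using \<kappa> by (simp only: exp_of_nat_mult exp_ln)
    qed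
    also have "\<dots> \<le> exp (l + - l * (real K / V))" using 1 by (simp only: exp_le_cancel_iff)
    also have "\<dots> = exp l * exp (- l * (real K / V))" by (rule exp_add)
    finally have "real (K + 1) ^ M * \<kappa> ^ (K div W) \<le> real (K + 1) ^ M * (exp l * exp (- l * (real K / V)))"
      by (intro mult_left_mono) auto
    also have "\<dots> = exp l * (real (K + 1) powr real M * exp (- l * (real K / V)))"
      by (simp add: powr_realpow)
    also have "\<dots> \<le> exp l * C" using C[of K] unfolding V_def by (intro mult_left_mono) auto
    finally show ?thesis .
  qed
  then show ?thesis by blast
qed

section \<open>The asymptotic formula\<close>

context
  fixes b :: nat
  assumes b2: "b \<ge> 2"
begin

lemma three_halves_power_ge: "real b \<le> (3 / 2) ^ (2 * b)"
proof -
  have "1 + real (2 * b) * (1 / 2) \<le> (1 + 1 / 2 :: real) ^ (2 * b)"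
    by (rule Bernoulli_inequality) simp
  then show ?thesis by simp
qed

text \<open>
  With \<open>b^u0\<close> of the size of \<open>(K + 1)^a\<close> the medium and large \<open>d\<close> save \<open>(K + 1)^a\<close>, while the small
  \<open>d\<close> are only bounded by a fixed power of \<open>K\<close>, which the equidistribution error absorbs.
\<close>
lemma squarefree_count_error_le:
  fixes a :: nat
  assumes a: "a \<ge> 1"
  shows "\<exists>C. \<forall>K X. \<bar>real (card {n \<in> (\<Union>k\<le>K. shell b X k). squarefree n})
      - real (card (\<Union>k\<le>K. shell b X k)) / coprime_zeta (b ^ 3 - b)\<bar> \<le> C * (real b ^ K / real (K + 1) ^ a)"
proof -
  define m where "m = b ^ 3 - b"
  define c1 c2 where "c1 = real (192 * b + 3)" and "c2 = real (192 * b) * (real a / ln 2)"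
  have c: "c1 > 0" "c2 > 0" using b2 a by (auto simp: c1_def c2_def)
  have \<kappa>: "0 < contraction b" "contraction b < 1" using contraction_bounds[OF b2] by auto
  obtain C1 where C1: "\<And>K W. 0 < W \<Longrightarrow> real W \<le> c1 + c2 * ln (real (K + 1)) \<Longrightarrow>
      real (K + 1) ^ (49 * a + 2) * contraction b ^ (K div W) \<le> C1"
    using polynomial_times_contraction_bounded[OF \<kappa> c, of "49 * a + 2"] by blast
  obtain C2 where C2: "\<And>K. real (K + 1) ^ (a + 1) * (real b ^ (3 * K div 4) / real b ^ K) \<le> C2"
    using polynomial_times_geometric_bounded[OF b2, of "a + 1"] by blast
  have "\<bar>real (card {n \<in> (\<Union>k\<le>K. shell b X k). squarefree n})
      - real (card (\<Union>k\<le>K. shell b X k)) / coprime_zeta m\<bar>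
    \<le> (real b ^ 50 * real m * C1 + 8 * real b + 48 * real b ^ 51 + real b ^ 8 * C2) * (real b ^ K / real (K + 1) ^ a)"
    for K X
  proof -
    \<comment> \<open>The least \<open>u0\<close> with \<open>b^u0 > (K + 1)^a\<close>.\<close>
    define u0 where "u0 = floorlog b ((K + 1) ^ a)"
    define P where "P = real (K + 1) ^ a"
    define N where "N = real (card (\<Union>k\<le>K. shell b X k))"
    have P1: "P \<ge> 1" by (simp add: P_def)
    have fl: "b ^ (u0 - 1) \<le> (K + 1) ^ a" "(K + 1) ^ a < b ^ u0"
      using floorlog_bounds[of "(K + 1) ^ a" b] b2 unfolding u0_def by auto
    have u0: "u0 \<ge> 1"
    proof (rule ccontr)
      assume "\<not> u0 \<ge> 1"
      then have "(K + 1) ^ a < 1" using fl(2) by (simp add: not_le)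
      moreover have "0 < (K + 1) ^ a" by simp
      ultimately show False by linarith
    qed
    have Ple: "P \<le> real b ^ u0"
    proof -
      have "real ((K + 1) ^ a) \<le> real (b ^ u0)" using fl(2) by (intro of_nat_mono) simp
      then show ?thesis by (simp add: P_def)
    qed
    have low: "real b ^ (u0 - 1) \<le> P"
    proof -
      have "real (b ^ (u0 - 1)) \<le> real ((K + 1) ^ a)" using fl(1) by (intro of_nat_mono)
      then show ?thesis by (simp add: P_def)
    qed
    have bu: "real b ^ u0 \<le> real b * P"
    proof -
      have "real b ^ u0 = real b * real b ^ (u0 - 1)" using u0 by (simp flip: power_Suc)
      then show ?thesis using low by (simp add: mult_left_mono)
    qed
    \<comment> \<open>\<open>2 b\<close> steps of the expansion gain a factor \<open>b\<close>, so \<open>w\<close> steps exceed every \<open>q = d^2 < b^(96 u0)\<close>.\<close>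
    define w where "w = 2 * b * (96 * u0)"
    have w: "real b ^ (96 * u0) \<le> (3 / 2) ^ w"
      unfolding w_def power_mult[of _ "2 * b"] using three_halves_power_ge by (intro power_mono) auto
    have W: "real (w + 3) \<le> c1 + c2 * ln (real (K + 1))"
    proof -
      have "2 ^ (u0 - 1) \<le> real b ^ (u0 - 1)" using b2 by (intro power_mono) auto
      also have "\<dots> \<le> P" by (rule low)
      finally have "ln (2 ^ (u0 - 1)) \<le> ln P" by (subst ln_le_cancel_iff) (use P1 in auto)
      then have "real (u0 - 1) * ln 2 \<le> real a * ln (real (K + 1))"
        by (simp add: P_def ln_realpow)
      then have "real (u0 - 1) \<le> real a * ln (real (K + 1)) / ln 2" by (simp add: pos_le_divide_eq)
      then have "real u0 \<le> 1 + real a / ln 2 * ln (real (K + 1))" using u0 by (simp add: of_nat_diff)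
      then have "real (192 * b) * real u0 \<le> real (192 * b) * (1 + real a / ln 2 * ln (real (K + 1)))"
        by (intro mult_left_mono) auto
      moreover have "real (w + 3) = real (192 * b) * real u0 + 3" by (simp add: w_def)
      moreover have "c1 + c2 * ln (real (K + 1)) = real (192 * b) * (1 + real a / ln 2 * ln (real (K + 1))) + 3"
        by (simp add: c1_def c2_def distrib_left)
      ultimately show ?thesis by linarith
    qed
    have t1: "real b ^ (48 * u0) * (real m * real b ^ 2 * real (K + 1) ^ 2 * (real b ^ K * contraction b ^ (K div (w + 3))))
        \<le> real b ^ 50 * real m * C1 * (real b ^ K / P)"
    proof -
      define c where "c = contraction b ^ (K div (w + 3))"
      have c0: "c \<ge> 0" using \<kappa> by (simp add: c_def)
      have "real b ^ (48 * u0) = (real b ^ u0) ^ 48" by (simp add: mult.commute flip: power_mult)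
      also have "\<dots> \<le> (real b * P) ^ 48" using bu by (intro power_mono) auto
      also have "\<dots> = real b ^ 48 * P ^ 48" by (rule power_mult_distrib)
      finally have "real b ^ (48 * u0) * (real m * real b ^ 2 * real (K + 1) ^ 2 * (real b ^ K * c))
        \<le> (real b ^ 48 * P ^ 48) * (real m * real b ^ 2 * real (K + 1) ^ 2 * (real b ^ K * c))"
        using c0 by (intro mult_right_mono) auto
      also have "\<dots> = (real b ^ 48 * real b ^ 2) * real m * ((P ^ 48 * P) * real (K + 1) ^ 2 * c) * (real b ^ K / P)"
        using P1 by (simp add: field_simps)
      also have "(P ^ 48 * P) * real (K + 1) ^ 2 = real (K + 1) ^ (49 * a + 2)"
      proof -
        have "P ^ 48 * P = P ^ 49" by (simp add: eval_nat_numeral)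
        then show ?thesis by (simp only: P_def power_mult[symmetric] power_add mult.commute[of a])
      qed
      also have "real b ^ 48 * real b ^ 2 = real b ^ 50" by (simp flip: power_add)
      also have "real b ^ 50 * real m * (real (K + 1) ^ (49 * a + 2) * c) * (real b ^ K / P)
          \<le> real b ^ 50 * real m * C1 * (real b ^ K / P)"
        unfolding c_def using P1 W by (intro mult_right_mono mult_left_mono C1) auto
      finally show ?thesis unfolding c_def .
    qed
    have t2: "N * (4 / real b ^ (24 * u0)) \<le> 8 * real b * (real b ^ K / P)"
    proof -
      have "real b ^ u0 \<le> real b ^ (24 * u0)" using b2 by (intro power_increasing) auto
      then have "P \<le> real b ^ (24 * u0)" using Ple by linarith
      then have "4 / real b ^ (24 * u0) \<le> 4 / P" using P1 b2 by (intro divide_left_mono) auto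
      then have "N * (4 / real b ^ (24 * u0)) \<le> (2 * real b * real b ^ K) * (4 / P)"
        unfolding N_def using card_Union_shell_le[OF b2] P1 by (intro mult_mono) auto
      then show ?thesis by simp
    qed
    have t3: "48 * real b ^ 51 * (real b ^ K / real b ^ u0) \<le> 48 * real b ^ 51 * (real b ^ K / P)"
      using Ple P1 b2 by (intro mult_left_mono divide_left_mono) auto
    have t4: "real (K + 1) * real b ^ (3 * K div 4 + 8) \<le> real b ^ 8 * C2 * (real b ^ K / P)"
    proof -
      have "real (K + 1) * real b ^ (3 * K div 4 + 8)
        = real b ^ 8 * (real (K + 1) ^ (a + 1) * (real b ^ (3 * K div 4) / real b ^ K)) * (real b ^ K / P)"
        using P1 b2 by (simp add: P_def power_add)
      also have "\<dots> \<le> real b ^ 8 * C2 * (real b ^ K / P)"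
        using P1 by (intro mult_right_mono mult_left_mono C2) auto
      finally show ?thesis .
    qed
    have "\<bar>real (card {n \<in> (\<Union>k\<le>K. shell b X k). squarefree n}) - N / coprime_zeta m\<bar>
      \<le> real b ^ 50 * real m * C1 * (real b ^ K / P) + 8 * real b * (real b ^ K / P)
        + (48 * real b ^ 51 * (real b ^ K / P) + real b ^ 8 * C2 * (real b ^ K / P))"
      using squarefree_count_error[OF b2 u0 w, where K = K and X = X] t1 t2 t3 t4 unfolding N_def m_def by linarith
    then show ?thesis unfolding N_def P_def by (simp only: distrib_right add.assoc)
  qed
  then show ?thesis unfolding m_def by blast
qed

end

theorem theorem1p2:
  fixes b :: nat and A :: real
  assumes "b \<ge> 2" and "A > 0"
  shows "\<exists>C::real. \<forall>x::real. x \<ge> 2 \<longrightarrow>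
           (\<exists>E::real. \<bar>E\<bar> \<le> C * (1 / ln x powr A) \<and>
              real (squarefree_count b x) =
                real (card (restricted_palindromes_upto b x)) / zeta 2
                  * (\<Prod>p | prime p \<and> p dvd b ^ 3 - b. inverse (1 - 1 / real p ^ 2))
                  * (1 + E))"
proof -
  define a where "a = nat \<lceil>A\<rceil>"
  have a: "a \<ge> 1" "A \<le> real a" using assms(2) unfolding a_def by linarith+
  define Z where "Z = coprime_zeta (b ^ 3 - b)"
  have Z1: "Z \<ge> 1" unfolding Z_def by (rule coprime_zeta_ge_1)
  obtain C where C: "\<And>K X. \<bar>real (card {n \<in> (\<Union>k\<le>K. shell b X k). squarefree n})
      - real (card (\<Union>k\<le>K. shell b X k)) / Z\<bar> \<le> C * (real b ^ K / real (K + 1) ^ a)"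
    using squarefree_count_error_le[OF assms(1) a(1)] unfolding Z_def by blast
  have C0: "C \<ge> 0" using C[of 0 0] by (simp add: order.trans[OF abs_ge_zero])
  have lnb: "ln (real b) > 0" using assms(1) by simp
  show ?thesis
  proof (intro exI allI impI)
    fix x :: real assume x: "x \<ge> 2"
    define X where "X = nat \<lfloor>x\<rfloor>"
    have X: "X \<ge> 1" "x < real X + 1" using x unfolding X_def by linarith+
    \<comment> \<open>Halving the digit count of \<open>X\<close> gives \<open>b^(2K) \<le> X < b^(2K + 2)\<close>.\<close>
    define K where "K = (floorlog b X - 1) div 2"
    have fl: "b ^ (floorlog b X - 1) \<le> X" "X < b ^ floorlog b X"
      using floorlog_bounds[of X b] X assms(1) by auto
    have XK: "b ^ (2 * K) \<le> X" "X < b ^ (2 * K + 2)"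
    proof -
      have "b ^ (2 * K) \<le> b ^ (floorlog b X - 1)"
        using assms(1) unfolding K_def by (intro power_increasing) auto
      then show "b ^ (2 * K) \<le> X" using fl(1) by linarith
      have "b ^ floorlog b X \<le> b ^ (2 * K + 2)"
        using assms(1) unfolding K_def by (intro power_increasing) auto
      then show "X < b ^ (2 * K + 2)" using fl(2) by linarith
    qed
    define R where "R = (\<Union>k\<le>K. shell b X k)"
    have R: "restricted_palindromes_upto b x = R"
      unfolding R_def X_def
      by (rule restricted_palindromes_upto_Union[OF assms(1)]) (use x XK in \<open>auto simp: X_def\<close>)
    define N Q where "N = real (card R)" and "Q = real (squarefree_count b x)"
    have Q: "Q = real (card {n \<in> R. squarefree n})" by (simp add: Q_def squarefree_count_def R)
    have N: "real b ^ K \<le> real b ^ 6 * N"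
      unfolding N_def R_def by (rule card_Union_shell_ge[OF assms(1) X(1) XK(1)])
    have bK: "real b ^ K > 0" using assms(1) by simp
    have N0: "N > 0"
    proof (rule ccontr)
      assume "\<not> N > 0"
      then have "N = 0" by (simp add: N_def)
      then show False using N bK by simp
    qed
    define E where "E = (Q - N / Z) * (Z / N)"
    have "Q = N / Z * (1 + E)" using N0 Z1 by (simp add: E_def field_simps)
    moreover have "N / Z = N / zeta 2 * (\<Prod>p | prime p \<and> p dvd b ^ 3 - b. inverse (1 - 1 / real p ^ 2))"
      unfolding Z_def coprime_zeta_eq[OF dvd_cube_minus(3)[OF assms(1)]]
      by (simp add: prod_inversef[unfolded o_def] divide_inverse)
    ultimately have 1: "Q = N / zeta 2 * (\<Prod>p | prime p \<and> p dvd b ^ 3 - b. inverse (1 - 1 / real p ^ 2)) * (1 + E)"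
      by simp
    have lnx: "ln x > 0" using x by simp
    have pw: "1 / real (K + 1) ^ a \<le> (2 * ln (real b)) powr A * (1 / ln x powr A)"
    proof -
      have "real X + 1 \<le> real (b ^ (2 * K + 2))"
      proof -
        have "X + 1 \<le> b ^ (2 * K + 2)" using XK(2) by simp
        then have "real (X + 1) \<le> real (b ^ (2 * K + 2))" by (simp only: of_nat_le_iff)
        then show ?thesis by simp
      qed
      then have "x \<le> real b ^ (2 * K + 2)" using X by simp
      then have "ln x \<le> ln (real b ^ (2 * K + 2))" using x assms(1) by (subst ln_le_cancel_iff) auto
      also have "\<dots> = real (2 * K + 2) * ln (real b)" using assms(1) by (subst ln_realpow) auto
      also have "\<dots> = 2 * ln (real b) * real (K + 1)" by simp
      finally have "ln x \<le> 2 * ln (real b) * real (K + 1)" .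
      then have "ln x powr A \<le> (2 * ln (real b) * real (K + 1)) powr A"
        using lnx assms(2) by (intro powr_mono2) auto
      also have "\<dots> = (2 * ln (real b)) powr A * real (K + 1) powr A"
        using lnb by (subst powr_mult) auto
      also have "\<dots> \<le> (2 * ln (real b)) powr A * real (K + 1) powr real a"
        using a by (intro mult_left_mono powr_mono) auto
      also have "real (K + 1) powr real a = real (K + 1) ^ a" by (rule powr_realpow) simp
      finally show ?thesis using lnx by (simp add: field_simps)
    qed
    have "\<bar>E\<bar> = \<bar>Q - N / Z\<bar> * (Z / N)" using N0 Z1 by (simp add: E_def abs_mult)
    also have "\<dots> \<le> C * (real b ^ K / real (K + 1) ^ a) * (Z / N)"
      using C[where K = K and X = X] N0 Z1 unfolding Q N_def R_def by (intro mult_right_mono) auto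
    also have "\<dots> = C * Z * (1 / real (K + 1) ^ a) * (real b ^ K / N)" by simp
    also have "\<dots> \<le> C * Z * (1 / real (K + 1) ^ a) * real b ^ 6"
      using C0 Z1 N N0 by (intro mult_left_mono) (auto simp: pos_divide_le_eq)
    also have "\<dots> = C * Z * real b ^ 6 * (1 / real (K + 1) ^ a)" by simp
    also have "\<dots> \<le> C * Z * real b ^ 6 * ((2 * ln (real b)) powr A * (1 / ln x powr A))"
      using C0 Z1 pw by (intro mult_left_mono) auto
    finally have 2: "\<bar>E\<bar> \<le> (C * Z * real b ^ 6 * (2 * ln (real b)) powr A) * (1 / ln x powr A)" by (simp only: mult.assoc)
    show "\<bar>E\<bar> \<le> (C * Z * real b ^ 6 * (2 * ln (real b)) powr A) * (1 / ln x powr A) \<and>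
      real (squarefree_count b x) = real (card (restricted_palindromes_upto b x)) / zeta 2
                  * (\<Prod>p | prime p \<and> p dvd b ^ 3 - b. inverse (1 - 1 / real p ^ 2)) * (1 + E)"
      using 1 2 unfolding Q_def N_def R by blast
  qed
qed

end
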